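(* Let $\mathbb T^{2n}$ be a flat torus and let $(G,I,J,K)$ be the standard hyperkähler structure on $T^*\mathbb T^{2n}$. Let $$H_s(t,q,p)=\tfrac12|p|^2+\beta(s)\,h(t,q,p),\qquad s\in\mathbb R,\ t\in\mathbb T^2,\ (q,p)\in T^*\mathbb T^{2n},$$ where $h:\mathbb T^2\times T^*\mathbb T^{2n}\to\mathbb R$ is smooth with $\|h\|_{C^2}<+\infty$ and $\beta$ is a cut-off function as in the context. Then for every $\delta\in(0,+\infty)$ there exists $\nu=\nu(\delta,\|h\|_{C^2})>0$ such that, if $\|h\|_{C^1}<\nu$, every smooth solution $Z:\mathbb R\times\mathbb T^2\to T^*\mathbb T^{2n}$ of $$\partial_sZ+J\partial_xZ+K\partial_yZ=\nabla^GH_s(Z)$$ satisfying $|Z(s,\cdot)|\to0$ as $s\to\pm\infty$ has image contained in $\mathbb D^*_\delta\mathbb T^{2n}=\{(q,p)\in T^*\mathbb T^{2n}:|p|<\delta\}$.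
   Context: $\mathbb T^2=(\mathbb R/2\pi\mathbb Z)^2$ with coordinates $t=(x,y)$. For $Z=(q,p)$, $|Z|:=|p|$ is the fibre norm; $|Z(s,\cdot)|\to0$ means uniformly on $\mathbb T^2$. Standard hyperkähler structure: in the coordinates $(q_1^j,q_2^j,p_j^1,p_j^2)_{j=1,\dots,n}$ on $T^*\mathbb T^{2n}\cong\mathbb T^{2n}\times\mathbb R^{2n}$, $G$ is the flat Euclidean metric, and $I\partial_{q_1^j}=\partial_{q_2^j}$, $I\partial_{p_j^1}=-\partial_{p_j^2}$; $J\partial_{q_1^j}=\partial_{p_j^1}$, $J\partial_{q_2^j}=\partial_{p_j^2}$; $K=IJ$, i.e. $K\partial_{q_1^j}=-\partial_{p_j^2}$, $K\partial_{q_2^j}=\partial_{p_j^1}$. Equivalently $G(\cdot,J\cdot)=\sum_j dp_j^1\wedge dq_1^j+dp_j^2\wedge dq_2^j$ and $G(\cdot,K\cdot)=\sum_jdp_j^1\wedge dq_2^j-dp_j^2\wedge dq_1^j$. Cut-off: $\beta=\beta_\tau$ for some $\tau\ge0$, where the smooth functions $\beta_\tau:\mathbb R\to[0,1]$ satisfy: $\beta_\tau(s)=0$ for $s\le-1$ and $s\ge\tau+1$; $\beta_\tau|_{[0,\tau]}\equiv1$ for $\tau\ge1$; $0\le\beta_\tau'\le2$ on $(-1,0)$ and $-2\le\beta_\tau'\le0$ on $(\tau,\tau+1)$; $\beta_\tau\to0$ in the strong $C^\infty$ topology as $\tau\to0^+$. *)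

theory Defs
  imports "HOL-Analysis.Analysis"
begin

section \<open>Smooth functions and \<open>C\<^sup>k\<close> norms on Euclidean spaces\<close>

definition partial_deriv ::
  "'a::euclidean_space \<Rightarrow> ('a \<Rightarrow> 'b::real_normed_vector) \<Rightarrow> 'a \<Rightarrow> 'b"
  where "partial_deriv v f x = frechet_derivative f (at x) v"

text \<open>Meant for open sets: there it says that all iterated partial derivatives exist and are
  Frechet differentiable, hence continuous.\<close>

definition smooth_on :: "'a::euclidean_space set \<Rightarrow> ('a \<Rightarrow> 'b::real_normed_vector) \<Rightarrow> bool"
  where "smooth_on U f \<longleftrightarrow>
    (\<forall>vs. set vs \<subseteq> Basis \<longrightarrow> foldr partial_deriv vs f differentiable_on U)"

text \<open>The maximum of the supremum norms of all partial derivatives of order at most \<open>k\<close>;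
  the value may be \<open>\<infinity>\<close>. Only meaningful for smooth \<open>f\<close>.\<close>

definition Ck_norm :: "nat \<Rightarrow> ('a::euclidean_space \<Rightarrow> real) \<Rightarrow> ennreal"
  where "Ck_norm k f =
    (SUP vs\<in>{vs. set vs \<subseteq> Basis \<and> length vs \<le> k}. SUP x. ennreal \<bar>foldr partial_deriv vs f x\<bar>)"


section \<open>Flat tori\<close>

definition full_lattice :: "'a::euclidean_space set \<Rightarrow> bool"
  where "full_lattice \<Lambda> \<longleftrightarrow>
    (\<exists>B. independent B \<and> span B = UNIV \<and> \<Lambda> = range (\<lambda>k. \<Sum>b\<in>B. of_int (k b) *\<^sub>R b))"

definition lattice_rel :: "'a::euclidean_space set \<Rightarrow> ('a \<times> 'a) set"
  where "lattice_rel \<Lambda> = {(x, y). y - x \<in> \<Lambda>}"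

definition torus :: "'a::euclidean_space set \<Rightarrow> 'a set set"
  where "torus \<Lambda> = UNIV // lattice_rel \<Lambda>"

definition torus_proj :: "'a::euclidean_space set \<Rightarrow> 'a \<Rightarrow> 'a set"
  where "torus_proj \<Lambda> x = lattice_rel \<Lambda> `` {x}"

definition lattice_2pi :: "(real \<times> real) set"
  where "lattice_2pi = {(2 * pi * of_int k, 2 * pi * of_int l) | k l. True}"

abbreviation T2 :: "(real \<times> real) set set"
  where "T2 \<equiv> torus lattice_2pi"

abbreviation T2_proj :: "real \<times> real \<Rightarrow> (real \<times> real) set"
  where "T2_proj \<equiv> torus_proj lattice_2pi"


section \<open>The cotangent bundle of a flat torus and its hyperkaehler structure\<close>

text \<open>\<open>\<real>\<^sup>2\<^sup>n\<close> is written as pairs \<open>(q\<^sub>1, q\<^sub>2)\<close> of vectors in \<open>\<real>\<^sup>n\<close>, with \<open>n = CARD('n)\<close>: the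
  coordinate \<open>q\<^sub>i\<^sup>j\<close> is the \<open>j\<close>-th entry of \<open>q\<^sub>i\<close>, and likewise for \<open>(p\<^sup>1, p\<^sup>2)\<close>. The bundle is
  trivialised as \<open>torus \<times> \<real>\<^sup>2\<^sup>n\<close>, with universal cover \<open>\<real>\<^sup>2\<^sup>n \<times> \<real>\<^sup>2\<^sup>n\<close>. In these coordinates the
  flat metric \<open>G\<close> is the inner product of the product type.\<close>

type_synonym 'n base = "(real^'n) \<times> (real^'n)"
type_synonym 'n cover = "'n base \<times> 'n base"
type_synonym 'n cot = "'n base set \<times> 'n base"

definition cot_proj :: "'n::finite base set \<Rightarrow> 'n cover \<Rightarrow> 'n cot"
  where "cot_proj \<Lambda> z = (torus_proj \<Lambda> (fst z), snd z)"

definition disc_cot :: "'n::finite base set \<Rightarrow> real \<Rightarrow> 'n cot set"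
  where "disc_cot \<Lambda> \<delta> = {(q, p). q \<in> torus \<Lambda> \<and> norm p < \<delta>}"

text \<open>A tangent vector \<open>((a\<^sub>1, a\<^sub>2), (b\<^sub>1, b\<^sub>2))\<close> has \<open>q\<close>-components \<open>a\<close> and \<open>p\<close>-components \<open>b\<close>.\<close>

fun hk_I :: "'n::finite cover \<Rightarrow> 'n cover"
  where "hk_I ((a1, a2), (b1, b2)) = ((- a2, a1), (b2, - b1))"

fun hk_J :: "'n::finite cover \<Rightarrow> 'n cover"
  where "hk_J ((a1, a2), (b1, b2)) = ((- b1, - b2), (a1, a2))"

definition hk_K :: "'n::finite cover \<Rightarrow> 'n cover"
  where "hk_K v = hk_I (hk_J v)"

lemma hk_K_apply: "hk_K ((a1, a2), (b1, b2)) = ((b2, - b1), (a2, - a1))"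
  by (simp add: hk_K_def)

lemma hk_squares: "hk_I (hk_I v) = - v" "hk_J (hk_J v) = - v" "hk_K (hk_K v) = - v"
  by (cases v rule: hk_I.cases, simp add: hk_K_apply)+

lemma inner_hk_J:
  "inner ((a1, a2), (b1, b2)) (hk_J ((c1, c2), (d1, d2)))
     = (inner b1 c1 - inner a1 d1) + (inner b2 c2 - inner a2 d2)"
  by (simp add: inner_prod_def)

lemma inner_hk_K:
  "inner ((a1, a2), (b1, b2)) (hk_K ((c1, c2), (d1, d2)))
     = (inner b1 c2 - inner a2 d1) - (inner b2 c1 - inner a1 d2)"
  by (simp add: inner_prod_def hk_K_apply)


section \<open>Cut-off functions\<close>

text \<open>The last clause is convergence in the strong (Whitney) \<open>C\<^sup>\<infinity>\<close> topology: for each order of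
  differentiation the bound may be any positive continuous function on the line.\<close>

definition cutoff_family :: "(real \<Rightarrow> real \<Rightarrow> real) \<Rightarrow> bool"
  where "cutoff_family \<beta> \<longleftrightarrow>
    (\<forall>\<tau>\<ge>0.
       smooth_on UNIV (\<beta> \<tau>) \<and>
       (\<forall>s. 0 \<le> \<beta> \<tau> s \<and> \<beta> \<tau> s \<le> 1) \<and>
       (\<forall>s. s \<le> - 1 \<or> s \<ge> \<tau> + 1 \<longrightarrow> \<beta> \<tau> s = 0) \<and>
       (\<tau> \<ge> 1 \<longrightarrow> (\<forall>s\<in>{0..\<tau>}. \<beta> \<tau> s = 1)) \<and>
       (\<forall>s\<in>{-1<..<0}. 0 \<le> deriv (\<beta> \<tau>) s \<and> deriv (\<beta> \<tau>) s \<le> 2) \<and>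
       (\<forall>s\<in>{\<tau><..<\<tau>+1}. - 2 \<le> deriv (\<beta> \<tau>) s \<and> deriv (\<beta> \<tau>) s \<le> 0)) \<and>
    (\<forall>k \<epsilon>. continuous_on UNIV \<epsilon> \<and> (\<forall>s. 0 < \<epsilon> s) \<longrightarrow>
       (\<forall>\<^sub>F \<tau> in at_right 0. \<forall>s. \<bar>(deriv ^^ k) (\<beta> \<tau>) s\<bar> < \<epsilon> s))"


section \<open>The Hamiltonian and the equation\<close>

definition pullback ::
  "'n::finite base set \<Rightarrow> ((real \<times> real) set \<Rightarrow> 'n cot \<Rightarrow> real) \<Rightarrow> (real \<times> real) \<times> 'n cover \<Rightarrow> real"
  where "pullback \<Lambda> h = (\<lambda>(t, z). h (T2_proj t) (cot_proj \<Lambda> z))"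

text \<open>The covering projections are local isometries, so smoothness of \<open>h\<close> and its \<open>C\<^sup>k\<close> norm
  (derivatives in all variables \<open>t\<close>, \<open>q\<close>, \<open>p\<close>) are those of the pullback.\<close>

definition smooth_perturbation ::
  "'n::finite base set \<Rightarrow> ((real \<times> real) set \<Rightarrow> 'n cot \<Rightarrow> real) \<Rightarrow> bool"
  where "smooth_perturbation \<Lambda> h \<longleftrightarrow> smooth_on UNIV (pullback \<Lambda> h)"

definition perturbation_norm ::
  "'n::finite base set \<Rightarrow> nat \<Rightarrow> ((real \<times> real) set \<Rightarrow> 'n cot \<Rightarrow> real) \<Rightarrow> ennreal"
  where "perturbation_norm \<Lambda> k h = Ck_norm k (pullback \<Lambda> h)"

definition hamiltonian ::
  "(real \<Rightarrow> real) \<Rightarrow> ((real \<times> real) set \<Rightarrow> 'n::finite cot \<Rightarrow> real) \<Rightarrow>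
    real \<Rightarrow> (real \<times> real) set \<Rightarrow> 'n cot \<Rightarrow> real"
  where "hamiltonian \<beta> h s t z = 1/2 * (norm (snd z))\<^sup>2 + \<beta> s * h t z"

text \<open>\<open>w\<close> is a smooth representation over \<open>U\<close> of the map \<open>Z : \<real> \<times> \<T>\<^sup>2 \<rightarrow> T\<^sup>*\<T>\<^sup>2\<^sup>n\<close> in the flat
  coordinates \<open>(s, (x, y))\<close> and \<open>(q, p)\<close>.\<close>

definition local_lift ::
  "'n::finite base set \<Rightarrow> (real \<Rightarrow> (real \<times> real) set \<Rightarrow> 'n cot) \<Rightarrow>
    (real \<times> (real \<times> real)) set \<Rightarrow> (real \<times> (real \<times> real) \<Rightarrow> 'n cover) \<Rightarrow> bool"
  where "local_lift \<Lambda> Z U w \<longleftrightarrow>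
    open U \<and> smooth_on U w \<and> (\<forall>(s, t)\<in>U. Z s (T2_proj t) = cot_proj \<Lambda> (w (s, t)))"

definition smooth_map ::
  "'n::finite base set \<Rightarrow> (real \<Rightarrow> (real \<times> real) set \<Rightarrow> 'n cot) \<Rightarrow> bool"
  where "smooth_map \<Lambda> Z \<longleftrightarrow> (\<forall>u. \<exists>U w. u \<in> U \<and> local_lift \<Lambda> Z U w)"

text \<open>\<open>\<partial>\<^sub>sZ + J\<partial>\<^sub>xZ + K\<partial>\<^sub>yZ = \<nabla>\<^sup>GH\<^sub>s(Z)\<close> in flat coordinates; \<open>GDERIV\<close> is the gradient with respect
  to the inner product, that is, to \<open>G\<close>.\<close>

definition solves_equation ::
  "'n::finite base set \<Rightarrow> (real \<Rightarrow> (real \<times> real) set \<Rightarrow> 'n cot \<Rightarrow> real) \<Rightarrow>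
    (real \<Rightarrow> (real \<times> real) set \<Rightarrow> 'n cot) \<Rightarrow> bool"
  where "solves_equation \<Lambda> H Z \<longleftrightarrow>
    (\<forall>U w. local_lift \<Lambda> Z U w \<longrightarrow>
      (\<forall>(s, t)\<in>U.
        GDERIV (\<lambda>z. H s (T2_proj t) (cot_proj \<Lambda> z)) (w (s, t)) :>
          partial_deriv (1, (0, 0)) w (s, t)
          + hk_J (partial_deriv (0, (1, 0)) w (s, t))
          + hk_K (partial_deriv (0, (0, 1)) w (s, t))))"

definition fibre_decay :: "(real \<Rightarrow> (real \<times> real) set \<Rightarrow> 'n::finite cot) \<Rightarrow> bool"
  where "fibre_decay Z \<longleftrightarrow>
    uniform_limit T2 (\<lambda>s t. norm (snd (Z s t))) (\<lambda>_. 0) at_top \<and>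
    uniform_limit T2 (\<lambda>s t. norm (snd (Z s t))) (\<lambda>_. 0) at_bot"

end

theory Submission
  imports Defs
begin

text \<open>
  Write \<open>Z = (q, p)\<close> and \<open>D = \<partial>\<^sub>s + J \<partial>\<^sub>x + K \<partial>\<^sub>y\<close>. Because \<open>J\<close> and \<open>K\<close> are anticommuting complex
  structures, \<open>(\<partial>\<^sub>s - J \<partial>\<^sub>x - K \<partial>\<^sub>y) D\<close> is the Laplacian \<open>\<Delta>\<close> in \<open>(s, x, y)\<close>. The equation says
  \<open>D Z = (0, p) + F\<close> with \<open>F = \<beta> \<nabla>h\<close>, and \<open>J\<close>, \<open>K\<close> exchange base and fibre directions, so that
  every fibre coordinate \<open>u\<close> satisfies \<open>\<Delta>u - \<partial>\<^sub>s u = div f\<close>, where the entries of \<open>f\<close> are, up to sign,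
  entries of \<open>F\<close>. They are bounded by \<open>\<epsilon> = \<parallel>h\<parallel>\<close> in \<open>C\<^sup>1\<close>; since the right-hand side is in
  divergence form, its derivatives can be moved to a kernel. The theorem follows from
  \<open>sup |u| \<le> C \<epsilon>\<close> with an absolute constant \<open>C\<close> (\<open>drift_poisson_sup_bound\<close>).

  The bound has two parts. For the oscillation of \<open>u\<close> over a slice \<open>{s} \<times> \<T>\<^sup>2\<close>, an explicit compactly
  supported kernel \<open>\<phi>\<close> is used, a regularisation at scale \<open>\<eta>\<close> of
  \<open>exp (-s/2) m(r) / r\<close> with a decreasing convex profile \<open>m\<close> that vanishes for \<open>r \<ge> 6\<close>. It satisfies
  \<open>(\<Delta> + \<partial>\<^sub>s) \<phi> = a - b\<close>, where \<open>a, b \<ge> 0\<close> have the same mass, \<open>b\<close>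
  concentrates at the origin as \<open>\<eta> \<rightarrow> 0\<close>, and \<open>a \<ge> c > 0\<close> on a box that contains a full period cell of the
  torus. Moreover \<open>\<nabla>\<phi>\<close> is bounded in \<open>L\<^sup>1\<close> uniformly in \<open>\<eta>\<close>. Testing the equation with \<open>\<phi>\<close>
  represents \<open>w(0)\<close>, for a difference \<open>w\<close> of two translates of \<open>u\<close> along the torus, as the \<open>a\<close>-average of
  \<open>w\<close> plus an error \<open>O(\<epsilon>)\<close>. Since \<open>w\<close> has integral zero over the box, \<open>a\<close> may be replaced by \<open>a - c\<close>
  there, and the average is at most \<open>\<theta> sup |w|\<close> with a fixed \<open>\<theta> < 1\<close> (\<open>oscillation_contraction\<close>).
  Hence the oscillation is \<open>O(\<epsilon>)\<close>.

  The integral \<open>U(s)\<close> of \<open>u\<close> over the slice satisfies \<open>U' = U + O(\<epsilon>) + const\<close>. For large \<open>s\<close> the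
  term \<open>O(\<epsilon>)\<close> vanishes and \<open>U \<rightarrow> 0\<close>, which forces the constant to be zero; then \<open>|U|\<close> is bounded by a
  multiple of \<open>\<epsilon>\<close>, since otherwise \<open>U\<close> would grow exponentially (\<open>slice_mean_bound\<close>).
\<close>


section \<open>Directional derivatives and integration by parts\<close>

text \<open>Integration by parts only needs the derivative along one coordinate direction at a time; this form
  avoids total derivatives and is stable under sums, products and translations.\<close>

definition has_dir_deriv :: "'a::real_normed_vector \<Rightarrow> ('a \<Rightarrow> real) \<Rightarrow> ('a \<Rightarrow> real) \<Rightarrow> bool"
  where "has_dir_deriv b f f' \<longleftrightarrow>
    (\<forall>z. ((\<lambda>h. f (z + h *\<^sub>R b)) has_real_derivative f' z) (at 0))"

lemma has_dir_deriv_along_line: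
  assumes "has_dir_deriv b f f'"
  shows "((\<lambda>h. f (z + h *\<^sub>R b)) has_real_derivative f' (z + x *\<^sub>R b)) (at x)"
proof -
  have "((\<lambda>h. f ((z + x *\<^sub>R b) + h *\<^sub>R b)) has_real_derivative f' (z + x *\<^sub>R b)) (at 0)"
    using assms unfolding has_dir_deriv_def by blast
  then have "((\<lambda>h. f (z + (x + h) *\<^sub>R b)) has_real_derivative f' (z + x *\<^sub>R b)) (at 0)"
    by (simp add: algebra_simps)
  then show ?thesis
    using DERIV_shift[of "\<lambda>h. f (z + h *\<^sub>R b)" "f' (z + x *\<^sub>R b)" 0 x]
    by (simp add: add.commute)
qed

lemma has_dir_deriv_translate:
  assumes "has_dir_deriv b f f'"
  shows "has_dir_deriv b (\<lambda>z. f (c + z)) (\<lambda>z. f' (c + z))"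
  using assms unfolding has_dir_deriv_def by (auto simp: add.assoc[symmetric])

lemma has_dir_deriv_add:
  assumes "has_dir_deriv b f f'" "has_dir_deriv b g g'"
  shows "has_dir_deriv b (\<lambda>z. f z + g z) (\<lambda>z. f' z + g' z)"
  using assms unfolding has_dir_deriv_def by (auto intro!: derivative_eq_intros)

lemma has_dir_deriv_diff:
  assumes "has_dir_deriv b f f'" "has_dir_deriv b g g'"
  shows "has_dir_deriv b (\<lambda>z. f z - g z) (\<lambda>z. f' z - g' z)"
  using assms unfolding has_dir_deriv_def by (auto intro!: derivative_eq_intros)

lemma has_dir_deriv_mult:
  assumes "has_dir_deriv b f f'" "has_dir_deriv b g g'"
  shows "has_dir_deriv b (\<lambda>z. f z * g z) (\<lambda>z. f' z * g z + f z * g' z)"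
  using assms unfolding has_dir_deriv_def by (auto intro!: derivative_eq_intros)

lemma has_dir_deriv_cmult:
  assumes "has_dir_deriv b f f'"
  shows "has_dir_deriv b (\<lambda>z. c * f z) (\<lambda>z. c * f' z)"
  using assms unfolding has_dir_deriv_def by (auto intro!: derivative_eq_intros)

lemma integral_vanishing_outside:
  fixes V :: "'a::euclidean_space \<Rightarrow> real"
  assumes "\<And>z. z \<notin> S \<Longrightarrow> V z = 0"
  shows "integral S V = integral UNIV V"
proof -
  have "(\<lambda>z. if z \<in> S then V z else 0) = V" using assms by auto
  then show ?thesis using integral_restrict_UNIV[of S V] by simp
qed

lemma has_derivative_integral_dir_deriv:
  fixes V :: "'a::euclidean_space \<Rightarrow> real"
  assumes dV: "has_dir_deriv v V V'"
    and cV: "continuous_on UNIV V" and cV': "continuous_on UNIV V'"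
  shows "((\<lambda>h. integral (cbox a b) (\<lambda>z. V (z + h *\<^sub>R v))) has_real_derivative
           integral (cbox a b) (\<lambda>z. V' (z + x *\<^sub>R v))) (at x)"
proof (rule leibniz_rule_field_derivative[where U = UNIV and fx = "\<lambda>h z. V' (z + h *\<^sub>R v)"])
  show "(\<lambda>z. V (z + h *\<^sub>R v)) integrable_on cbox a b" for h
    by (intro integrable_continuous continuous_on_compose2[OF cV] continuous_intros) auto
  show "continuous_on (UNIV \<times> cbox a b) (\<lambda>(h, z). V' (z + h *\<^sub>R v))"
    unfolding case_prod_unfold
    by (intro continuous_on_compose2[OF cV'] continuous_intros) auto
qed (use has_dir_deriv_along_line[OF dV] in auto)

text \<open>The integral over the box does not change when \<open>V\<close> is translated a little, because the support stays
  inside; the derivative of that constant function under the integral sign is the claim.\<close>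

lemma integral_dir_deriv_compact_support:
  fixes V :: "'a::euclidean_space \<Rightarrow> real"
  assumes dV: "has_dir_deriv v V V'"
    and cV: "continuous_on UNIV V" and cV': "continuous_on UNIV V'"
    and supp: "\<And>z. R \<le> norm z \<Longrightarrow> V z = 0"
    and box: "cball 0 (R + norm v) \<subseteq> cbox a b"
  shows "integral (cbox a b) V' = 0"
proof -
  define I where "I h = integral (cbox a b) (\<lambda>z. V (z + h *\<^sub>R v))" for h
  have D: "(I has_real_derivative integral (cbox a b) V') (at 0)"
    using has_derivative_integral_dir_deriv[OF dV cV cV', of a b 0] by (simp add: I_def[abs_def])
  have const: "I h = integral UNIV V" if "\<bar>h\<bar> \<le> 1" for h
  proof -
    have "V z = 0" if "z \<notin> cbox (a + h *\<^sub>R v) (b + h *\<^sub>R v)" for z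
    proof (rule ccontr)
      assume "V z \<noteq> 0"
      then have "norm z < R" using supp[of z] by force
      moreover have "\<bar>h\<bar> * norm v \<le> 1 * norm v" using \<open>\<bar>h\<bar> \<le> 1\<close> by (intro mult_right_mono) auto
      ultimately have "norm (z - h *\<^sub>R v) \<le> R + norm v"
        using norm_triangle_ineq4[of z "h *\<^sub>R v"] by simp
      then have "z - h *\<^sub>R v \<in> cbox a b" using box by auto
      then have "z \<in> cbox (a + h *\<^sub>R v) (b + h *\<^sub>R v)"
        by (auto simp: mem_box algebra_simps)
      with that show False by simp
    qed
    then have "integral (cbox (a + h *\<^sub>R v) (b + h *\<^sub>R v)) V = integral UNIV V"
      by (rule integral_vanishing_outside)
    moreover have "I h = integral (cbox (a + h *\<^sub>R v) (b + h *\<^sub>R v)) V"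
      unfolding I_def using integral_shift_cbox[of "a + h *\<^sub>R v" "h *\<^sub>R v" "b + h *\<^sub>R v" V] by simp
    ultimately show ?thesis by simp
  qed
  have "(I has_real_derivative 0) (at 0)"
  proof (rule DERIV_cong_ev[THEN iffD2])
    show "\<forall>\<^sub>F x in nhds 0. I x = integral UNIV V"
      unfolding eventually_nhds_metric using const by (intro exI[of _ 1]) (auto simp: dist_norm)
    show "((\<lambda>x. integral UNIV V) has_real_derivative 0) (at 0)" by simp
  qed auto
  with D show ?thesis by (rule DERIV_unique)
qed

text \<open>The equation \<open>\<Delta>u - \<partial>\<^sub>e u = div f\<close>. The derivatives \<open>du b\<close>, \<open>ddu b\<close>, \<open>df b\<close>
  along the coordinate directions \<open>b\<close> are part of the data, and only pure second derivatives occur. The components of \<open>f\<close> are indexed by the basis vectors.\<close>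

definition drift_poisson where
  "drift_poisson e u du ddu f df \<longleftrightarrow>
     continuous_on UNIV u \<and>
     (\<forall>b\<in>Basis. continuous_on UNIV (du b) \<and> continuous_on UNIV (ddu b) \<and>
        continuous_on UNIV (f b) \<and> continuous_on UNIV (df b) \<and>
        has_dir_deriv b u (du b) \<and> has_dir_deriv b (du b) (ddu b) \<and> has_dir_deriv b (f b) (df b)) \<and>
     (\<forall>z. (\<Sum>b\<in>Basis. ddu b z) - du e z = (\<Sum>b\<in>Basis. df b (z::'a::euclidean_space) :: real))"

text \<open>The weak form of the equation. The integrand is the divergence of the compactly supported field
  \<open>u \<nabla>\<phi> - \<phi> \<nabla>u + \<phi> f + \<phi> u e\<close>; no derivative of \<open>u\<close> or \<open>f\<close> is left.\<close>

lemma drift_poisson_test_function: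
  fixes u :: "'a::euclidean_space \<Rightarrow> real"
  assumes sol: "drift_poisson e u du ddu f df" and e: "e \<in> Basis"
    and \<phi>: "continuous_on UNIV \<phi>"
      "\<And>b. b \<in> Basis \<Longrightarrow> continuous_on UNIV (d\<phi> b)" "\<And>b. b \<in> Basis \<Longrightarrow> continuous_on UNIV (dd\<phi> b)"
      "\<And>b. b \<in> Basis \<Longrightarrow> has_dir_deriv b \<phi> (d\<phi> b)"
      "\<And>b. b \<in> Basis \<Longrightarrow> has_dir_deriv b (d\<phi> b) (dd\<phi> b)"
    and supp: "\<And>z. R \<le> norm z \<Longrightarrow> \<phi> z = 0" "\<And>z b. R \<le> norm z \<Longrightarrow> d\<phi> b z = 0"
    and box: "cball 0 (R + 1) \<subseteq> cbox l r"
  shows "integral (cbox l r)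
     (\<lambda>z. ((\<Sum>b\<in>Basis. dd\<phi> b z) + d\<phi> e z) * u z + (\<Sum>b\<in>Basis. d\<phi> b z * f b z)) = 0"
proof -
  note S = sol[unfolded drift_poisson_def]
  define V where "V b z = u z * d\<phi> b z - \<phi> z * du b z + \<phi> z * f b z + (e \<bullet> b) * (\<phi> z * u z)" for b z
  define V' where "V' b z = (du b z * d\<phi> b z + u z * dd\<phi> b z) - (d\<phi> b z * du b z + \<phi> z * ddu b z)
     + (d\<phi> b z * f b z + \<phi> z * df b z) + (e \<bullet> b) * (d\<phi> b z * u z + \<phi> z * du b z)" for b z
  have cV': "continuous_on UNIV (V' b)" if b: "b \<in> Basis" for b
    unfolding V'_def[abs_def] using S \<phi> b by (auto intro!: continuous_intros)
  have "integral (cbox l r) (V' b) = 0" if b: "b \<in> Basis" for b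
  proof (rule integral_dir_deriv_compact_support)
    show "has_dir_deriv b (V b) (V' b)"
      unfolding V_def[abs_def] V'_def[abs_def] using S \<phi> b
      by (intro has_dir_deriv_add has_dir_deriv_diff has_dir_deriv_mult has_dir_deriv_cmult) auto
    show "continuous_on UNIV (V b)"
      unfolding V_def[abs_def] using S \<phi> b by (auto intro!: continuous_intros)
    show "continuous_on UNIV (V' b)" using cV' b .
    show "V b z = 0" if "R \<le> norm z" for z using supp that by (simp add: V_def)
    show "cball 0 (R + norm b) \<subseteq> cbox l r" using box b by simp
  qed
  moreover have "V' b integrable_on cbox l r" if b: "b \<in> Basis" for b
    by (rule integrable_continuous[OF continuous_on_subset[OF cV'[OF b] subset_UNIV]])
  ultimately have "integral (cbox l r) (\<lambda>z. \<Sum>b\<in>Basis. V' b z) = 0"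
    by (subst integral_sum) auto
  moreover have "(\<Sum>b\<in>Basis. V' b z) =
      ((\<Sum>b\<in>Basis. dd\<phi> b z) + d\<phi> e z) * u z + (\<Sum>b\<in>Basis. d\<phi> b z * f b z)" for z
  proof -
    have 1: "(\<Sum>b\<in>Basis. (e \<bullet> b) * F b) = F e" for F :: "'a \<Rightarrow> real"
    proof -
      have "(\<Sum>b\<in>Basis. (e \<bullet> b) * F b) = (\<Sum>b\<in>Basis. if b = e then F b else 0)"
        using e by (intro sum.cong) (auto simp: inner_Basis)
      then show ?thesis using e by simp
    qed
    have 2: "(\<Sum>b\<in>Basis. c * ((e \<bullet> b) * F b)) = c * F e" for c and F :: "'a \<Rightarrow> real"
      by (simp add: sum_distrib_left[symmetric] 1)
    have "(\<Sum>b\<in>Basis. V' b z) = (\<Sum>b\<in>Basis. dd\<phi> b z) * u z + (\<Sum>b\<in>Basis. d\<phi> b z * f b z)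
       - \<phi> z * ((\<Sum>b\<in>Basis. ddu b z) - (\<Sum>b\<in>Basis. df b z)) + (d\<phi> e z * u z + \<phi> z * du e z)"
      unfolding V'_def
      by (simp add: sum.distrib sum_subtractf 2 sum_distrib_left sum_distrib_right algebra_simps)
    moreover have "(\<Sum>b\<in>Basis. ddu b z) - (\<Sum>b\<in>Basis. df b z) = du e z"
      using S by (simp add: algebra_simps)
    ultimately show ?thesis by (simp add: algebra_simps)
  qed
  ultimately show ?thesis by simp
qed

section \<open>A kernel for the Laplacian with drift\<close>

text \<open>With \<open>P\<close> this profile and \<open>m = P\<^sup>4\<close>, the substitution \<open>\<phi> = exp (-s/2) m(r)/r\<close> gives
  \<open>(\<Delta> + \<partial>\<^sub>s) \<phi> = exp (-s/2) (m'' - m/4) / r\<close> away from the origin. The fourth power makes \<open>m\<close> twice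
  continuously differentiable at the end of its support, and \<open>m'' - m/4 = P\<^sup>2 (1/3 - P\<^sup>2/4)\<close> is nonnegative
  as \<open>0 \<le> P \<le> 1\<close>. The radius \<open>6\<close> is small enough for this and exceeds \<open>\<surd>2 \<pi>\<close>, so that the ball
  contains a period cell of the torus.\<close>

definition cutoff_profile :: "real \<Rightarrow> real"
  where "cutoff_profile \<rho> = max 0 (1 - \<rho> / 6)"

definition radial_g :: "real \<Rightarrow> real"
  where "radial_g \<rho> = cutoff_profile \<rho> ^ 4 / \<rho>"

text \<open>\<open>radial_k\<close> is \<open>radial_g'(\<rho>) / \<rho>\<close>, so that the gradient of \<open>radial_g \<circ> reg_norm\<close> at \<open>z\<close> is
  \<open>radial_k\<close> times \<open>z\<close>; \<open>radial_k'\<close> is its derivative.\<close>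

definition radial_k :: "real \<Rightarrow> real"
  where "radial_k \<rho> = - (2/3) * cutoff_profile \<rho> ^ 3 / \<rho>^2 - cutoff_profile \<rho> ^ 4 / \<rho>^3"

definition radial_k' :: "real \<Rightarrow> real"
  where "radial_k' \<rho> = cutoff_profile \<rho> ^ 2 / (3 * \<rho>^2) + 2 * cutoff_profile \<rho> ^ 3 / \<rho>^3
    + 3 * cutoff_profile \<rho> ^ 4 / \<rho>^4"

definition reg_norm :: "real \<Rightarrow> 'a::euclidean_space \<Rightarrow> real"
  where "reg_norm \<eta> z = sqrt ((norm z)\<^sup>2 + \<eta>\<^sup>2)"

definition drift_kernel :: "real \<Rightarrow> 'a::euclidean_space \<Rightarrow> 'a \<Rightarrow> real"
  where "drift_kernel \<eta> e z = exp (- (z \<bullet> e) / 2) * radial_g (reg_norm \<eta> z)"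

definition drift_kernel_deriv :: "real \<Rightarrow> 'a::euclidean_space \<Rightarrow> 'a \<Rightarrow> 'a \<Rightarrow> real"
  where "drift_kernel_deriv \<eta> e b z = exp (- (z \<bullet> e) / 2) *
    (radial_k (reg_norm \<eta> z) * (z \<bullet> b) - (e \<bullet> b) / 2 * radial_g (reg_norm \<eta> z))"

definition drift_kernel_deriv2 :: "real \<Rightarrow> 'a::euclidean_space \<Rightarrow> 'a \<Rightarrow> 'a \<Rightarrow> real"
  where "drift_kernel_deriv2 \<eta> e b z = exp (- (z \<bullet> e) / 2) *
    (radial_k (reg_norm \<eta> z) + radial_k' (reg_norm \<eta> z) * (z \<bullet> b)\<^sup>2 / reg_norm \<eta> z
      - (e \<bullet> b) * radial_k (reg_norm \<eta> z) * (z \<bullet> b) + (e \<bullet> b)\<^sup>2 / 4 * radial_g (reg_norm \<eta> z))"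

text \<open>The two nonnegative parts of \<open>(\<Delta> + \<partial>\<^sub>e)\<close> applied to the kernel: the first stays spread over the
  ball of radius \<open>6\<close>; the second, which enters with a minus sign, comes from the regularisation and
  turns into a point mass as \<open>\<eta>\<close> tends to \<open>0\<close>.\<close>

definition spread_part :: "real \<Rightarrow> 'a::euclidean_space \<Rightarrow> 'a \<Rightarrow> real"
  where "spread_part \<eta> e z = exp (- (z \<bullet> e) / 2) *
    (cutoff_profile (reg_norm \<eta> z) ^ 2 * (1/3 - cutoff_profile (reg_norm \<eta> z) ^ 2 / 4) / reg_norm \<eta> z)"

definition concentrated_part :: "real \<Rightarrow> 'a::euclidean_space \<Rightarrow> 'a \<Rightarrow> real"
  where "concentrated_part \<eta> e z = \<eta>\<^sup>2 * exp (- (z \<bullet> e) / 2) * (radial_k' (reg_norm \<eta> z) / reg_norm \<eta> z)"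

lemma cutoff_profile_bounds: "0 \<le> cutoff_profile \<rho>" "0 \<le> \<rho> \<Longrightarrow> cutoff_profile \<rho> \<le> 1"
  by (auto simp: cutoff_profile_def)

lemma has_real_derivative_max0_power:
  "((\<lambda>t::real. max 0 t ^ (n + 2)) has_real_derivative real (n + 2) * max 0 t ^ (n + 1)) (at t)"
proof -
  consider "t > 0" | "t < 0" | "t = 0" by linarith
  then show ?thesis
  proof cases
    case 1
    have "((\<lambda>t::real. t ^ (n + 2)) has_real_derivative real (n + 2) * t ^ (n + 1)) (at t)"
      using DERIV_pow[of "n + 2" t] by simp
    then have "((\<lambda>t::real. max 0 t ^ (n + 2)) has_real_derivative real (n + 2) * t ^ (n + 1)) (at t)"
      by (rule DERIV_cong_ev[THEN iffD1, rotated -1])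
        (use 1 eventually_nhds_in_open[of "{0<..}" t] in \<open>auto elim!: eventually_mono\<close>)
    with 1 show ?thesis by simp
  next
    case 2
    have "((\<lambda>t::real. 0) has_real_derivative 0) (at t)" by simp
    then have "((\<lambda>t::real. max 0 t ^ (n + 2)) has_real_derivative 0) (at t)"
      by (rule DERIV_cong_ev[THEN iffD1, rotated -1])
        (use 2 eventually_nhds_in_open[of "{..<0}" t] in \<open>auto elim!: eventually_mono\<close>)
    with 2 show ?thesis by simp
  next
    case 3
    have "(\<lambda>h::real. max 0 h ^ (n + 2) / h) \<midarrow>0\<rightarrow> 0"
    proof (rule Lim_null_comparison)
      show "\<forall>\<^sub>F h in at 0. norm (max 0 h ^ (n + 2) / h) \<le> \<bar>h::real\<bar> ^ (n + 1)"
        by (rule always_eventually) (auto simp: max_def intro!: mult_nonpos_nonneg)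
      have "((\<lambda>h::real. \<bar>h\<bar> ^ (n + 1)) \<longlongrightarrow> \<bar>0\<bar> ^ (n + 1)) (at 0)"
        by (intro tendsto_intros)
      then show "((\<lambda>h::real. \<bar>h\<bar> ^ (n + 1)) \<longlongrightarrow> 0) (at 0)" by simp
    qed
    with 3 show ?thesis by (simp add: DERIV_def)
  qed
qed

lemma has_real_derivative_cutoff_profile_power:
  "((\<lambda>\<rho>. cutoff_profile \<rho> ^ 4) has_real_derivative - (2/3) * cutoff_profile \<rho> ^ 3) (at \<rho>)"
  "((\<lambda>\<rho>. cutoff_profile \<rho> ^ 3) has_real_derivative - (1/2) * cutoff_profile \<rho> ^ 2) (at \<rho>)"
proof -
  have d: "((\<lambda>\<rho>::real. 1 - \<rho> / 6) has_real_derivative - (1/6)) (at \<rho>)"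
    by (auto intro!: derivative_eq_intros)
  show "((\<lambda>\<rho>. cutoff_profile \<rho> ^ 4) has_real_derivative - (2/3) * cutoff_profile \<rho> ^ 3) (at \<rho>)"
    using DERIV_chain2[OF has_real_derivative_max0_power[of 2] d]
    by (simp add: cutoff_profile_def)
  show "((\<lambda>\<rho>. cutoff_profile \<rho> ^ 3) has_real_derivative - (1/2) * cutoff_profile \<rho> ^ 2) (at \<rho>)"
    using DERIV_chain2[OF has_real_derivative_max0_power[of 1] d]
    by (simp add: cutoff_profile_def eval_nat_numeral)
qed

lemma has_real_derivative_radial_g:
  assumes "0 < \<rho>"
  shows "(radial_g has_real_derivative \<rho> * radial_k \<rho>) (at \<rho>)"
  unfolding radial_g_def[abs_def] radial_k_def 
  using assms
  by (intro DERIV_cong[OF DERIV_divide[OF has_real_derivative_cutoff_profile_power(1) DERIV_ident]])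
    (auto simp: field_simps eval_nat_numeral)

lemma has_real_derivative_radial_k:
  assumes "0 < \<rho>"
  shows "(radial_k has_real_derivative radial_k' \<rho>) (at \<rho>)"
  unfolding radial_k_def[abs_def] radial_k'_def 
  using assms
  by (intro DERIV_cong[OF DERIV_diff[OF
          DERIV_divide[OF DERIV_cmult[OF has_real_derivative_cutoff_profile_power(2)] DERIV_pow]
          DERIV_divide[OF has_real_derivative_cutoff_profile_power(1) DERIV_pow]]])
    (auto simp: field_simps eval_nat_numeral)

lemma reg_norm_pos: "\<eta> \<noteq> 0 \<Longrightarrow> 0 < reg_norm \<eta> z"
  by (simp add: reg_norm_def sum_power2_gt_zero_iff add_nonneg_pos)

lemma norm_le_reg_norm: "norm z \<le> reg_norm \<eta> z"
  by (rule real_le_rsqrt[of "norm z" "(norm z)\<^sup>2 + \<eta>\<^sup>2", folded reg_norm_def]) simp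

lemma reg_norm_sq: "(reg_norm \<eta> z)\<^sup>2 = (norm z)\<^sup>2 + \<eta>\<^sup>2"
  by (simp add: reg_norm_def)

lemma has_real_derivative_reg_norm:
  assumes "\<eta> \<noteq> 0"
  shows "((\<lambda>h. reg_norm \<eta> (z + h *\<^sub>R b)) has_real_derivative (z \<bullet> b) / reg_norm \<eta> z) (at 0)"
proof -
  have "0 < z \<bullet> z + \<eta>\<^sup>2" using assms by (simp add: add_nonneg_pos)
  then have "((\<lambda>h. sqrt ((z + h *\<^sub>R b) \<bullet> (z + h *\<^sub>R b) + \<eta>\<^sup>2)) has_real_derivative
      (z \<bullet> b) / sqrt (z \<bullet> z + \<eta>\<^sup>2)) (at 0)"
    unfolding inner_add_left inner_add_right inner_scaleR_left inner_scaleR_right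
    by (auto intro!: derivative_eq_intros simp: inner_commute field_simps)
  then show ?thesis by (simp add: reg_norm_def power2_norm_eq_inner)
qed

lemma has_real_derivative_tilt:
  fixes e :: "'a::euclidean_space"
  shows "((\<lambda>h. exp (- ((z + h *\<^sub>R b) \<bullet> e) / 2)) has_real_derivative
    - (e \<bullet> b) / 2 * exp (- (z \<bullet> e) / 2)) (at 0)"
  unfolding inner_add_left inner_scaleR_left
  by (auto intro!: derivative_eq_intros simp: inner_commute)

lemma has_dir_deriv_drift_kernel:
  assumes "\<eta> \<noteq> 0"
  shows "has_dir_deriv b (drift_kernel \<eta> e) (drift_kernel_deriv \<eta> e b)"
  unfolding has_dir_deriv_def
proof
  fix z
  have "((\<lambda>h. radial_g (reg_norm \<eta> (z + h *\<^sub>R b))) has_real_derivative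
      reg_norm \<eta> z * radial_k (reg_norm \<eta> z) * ((z \<bullet> b) / reg_norm \<eta> z)) (at 0)"
    by (rule DERIV_chain2[OF _ has_real_derivative_reg_norm[OF assms]])
      (simp add: has_real_derivative_radial_g reg_norm_pos[OF assms])
  from DERIV_mult[OF has_real_derivative_tilt[of z b e] this]
  show "((\<lambda>h. drift_kernel \<eta> e (z + h *\<^sub>R b)) has_real_derivative drift_kernel_deriv \<eta> e b z) (at 0)"
    unfolding drift_kernel_def drift_kernel_deriv_def using reg_norm_pos[OF assms, of z]
    by (auto elim!: DERIV_cong simp: field_simps)
qed

lemma has_dir_deriv_drift_kernel_deriv:
  assumes "\<eta> \<noteq> 0" "b \<in> Basis"
  shows "has_dir_deriv b (drift_kernel_deriv \<eta> e b) (drift_kernel_deriv2 \<eta> e b)"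
  unfolding has_dir_deriv_def
proof
  fix z
  note pos = reg_norm_pos[OF assms(1), of z]
  have G: "((\<lambda>h. radial_g (reg_norm \<eta> (z + h *\<^sub>R b))) has_real_derivative
      reg_norm \<eta> z * radial_k (reg_norm \<eta> z) * ((z \<bullet> b) / reg_norm \<eta> z)) (at 0)"
    by (rule DERIV_chain2[OF _ has_real_derivative_reg_norm[OF assms(1)]])
      (simp add: has_real_derivative_radial_g reg_norm_pos[OF assms(1)])
  have K: "((\<lambda>h. radial_k (reg_norm \<eta> (z + h *\<^sub>R b))) has_real_derivative
      radial_k' (reg_norm \<eta> z) * ((z \<bullet> b) / reg_norm \<eta> z)) (at 0)"
    by (rule DERIV_chain2[OF _ has_real_derivative_reg_norm[OF assms(1)]])
      (simp add: has_real_derivative_radial_k reg_norm_pos[OF assms(1)])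
  have L: "((\<lambda>h. (z + h *\<^sub>R b) \<bullet> b) has_real_derivative 1) (at 0)"
    unfolding inner_add_left inner_scaleR_left using assms(2)
    by (auto intro!: derivative_eq_intros)
  from DERIV_mult[OF has_real_derivative_tilt[of z b e]
      DERIV_diff[OF DERIV_mult[OF K L] DERIV_cmult[OF G, of "(e \<bullet> b) / 2"]]]
  show "((\<lambda>h. drift_kernel_deriv \<eta> e b (z + h *\<^sub>R b)) has_real_derivative drift_kernel_deriv2 \<eta> e b z) (at 0)"
    unfolding drift_kernel_deriv_def drift_kernel_deriv2_def using pos[THEN less_imp_neq, THEN not_sym]
    by (auto elim!: DERIV_cong simp: field_simps power2_eq_square)
qed

text \<open>In dimension three \<open>3 k + \<rho> k' = m'' / \<rho>\<close> for \<open>g = m / \<rho>\<close> and \<open>k = g' / \<rho>\<close>. The identity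
  \<open>|z|\<^sup>2 = \<rho>\<^sup>2 - \<eta>\<^sup>2\<close> makes the term \<open>\<eta>\<^sup>2 k' / \<rho>\<close> be subtracted, and the exponential factor turns
  the drift into the zeroth order term \<open>- g / 4\<close>.\<close>

lemma drift_laplacian_drift_kernel:
  fixes z e :: "'a::euclidean_space"
  assumes "\<eta> \<noteq> 0" "e \<in> Basis" "DIM('a) = 3"
  shows "(\<Sum>b\<in>Basis. drift_kernel_deriv2 \<eta> e b z) + drift_kernel_deriv \<eta> e e z = spread_part \<eta> e z - concentrated_part \<eta> e z"
proof -
  define \<rho> where "\<rho> = reg_norm \<eta> z"
  have pos: "0 < \<rho>" and sq: "(norm z)\<^sup>2 = \<rho>\<^sup>2 - \<eta>\<^sup>2"
    using reg_norm_pos[OF assms(1), of z] reg_norm_sq[of \<eta> z] by (auto simp: \<rho>_def)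
  have s1: "(\<Sum>b\<in>Basis. (e \<bullet> b) * F b) = F e" for F :: "'a \<Rightarrow> real"
  proof -
    have "(\<Sum>b\<in>Basis. (e \<bullet> b) * F b) = (\<Sum>b\<in>Basis. if b = e then F b else 0)"
      using assms(2) by (intro sum.cong) (auto simp: inner_Basis)
    then show ?thesis using assms(2) by simp
  qed
  have s2: "(\<Sum>b\<in>Basis. (z \<bullet> b)\<^sup>2) = (norm z)\<^sup>2"
    unfolding power2_norm_eq_inner euclidean_inner[of z z] by (simp add: power2_eq_square)
  have "(\<Sum>b\<in>(Basis::'a set). radial_k \<rho> + radial_k' \<rho> * (z \<bullet> b)\<^sup>2 / \<rho>
      - (e \<bullet> b) * radial_k \<rho> * (z \<bullet> b) + (e \<bullet> b)\<^sup>2 / 4 * radial_g \<rho>)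
    = (\<Sum>b\<in>(Basis::'a set). radial_k \<rho>) + (radial_k' \<rho> / \<rho>) * (\<Sum>b\<in>Basis. (z \<bullet> b)\<^sup>2)
      - (\<Sum>b\<in>Basis. (e \<bullet> b) * (radial_k \<rho> * (z \<bullet> b)))
      + (\<Sum>b\<in>Basis. (e \<bullet> b) * ((e \<bullet> b) / 4 * radial_g \<rho>))"
    by (simp add: sum.distrib sum_subtractf sum_distrib_left power2_eq_square mult.assoc)
  also have "\<dots> = 3 * radial_k \<rho> + radial_k' \<rho> / \<rho> * (\<rho>\<^sup>2 - \<eta>\<^sup>2) - radial_k \<rho> * (z \<bullet> e) + radial_g \<rho> / 4"
    unfolding s1 s2 sq using assms by simp
  finally have 1: "(\<Sum>b\<in>Basis. drift_kernel_deriv2 \<eta> e b z) = exp (- (z \<bullet> e) / 2) *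
      (3 * radial_k \<rho> + radial_k' \<rho> / \<rho> * (\<rho>\<^sup>2 - \<eta>\<^sup>2) - radial_k \<rho> * (z \<bullet> e) + radial_g \<rho> / 4)"
    by (simp add: drift_kernel_deriv2_def \<rho>_def sum_distrib_left[symmetric])
  have 2: "drift_kernel_deriv \<eta> e e z = exp (- (z \<bullet> e) / 2) * (radial_k \<rho> * (z \<bullet> e) - radial_g \<rho> / 2)"
    using assms by (simp add: drift_kernel_deriv_def \<rho>_def)
  have 3: "3 * radial_k \<rho> + radial_k' \<rho> / \<rho> * (\<rho>\<^sup>2 - \<eta>\<^sup>2) - radial_g \<rho> / 4
      = cutoff_profile \<rho> ^ 2 * (1/3 - cutoff_profile \<rho> ^ 2 / 4) / \<rho> - \<eta>\<^sup>2 * (radial_k' \<rho> / \<rho>)"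
    using pos unfolding radial_k_def radial_k'_def radial_g_def
    by (simp add: field_simps eval_nat_numeral)
  have "(\<Sum>b\<in>Basis. drift_kernel_deriv2 \<eta> e b z) + drift_kernel_deriv \<eta> e e z = exp (- (z \<bullet> e) / 2) *
      (3 * radial_k \<rho> + radial_k' \<rho> / \<rho> * (\<rho>\<^sup>2 - \<eta>\<^sup>2) - radial_g \<rho> / 4)"
    unfolding 1 2 distrib_left[symmetric] by (simp add: algebra_simps)
  also have "\<dots> = spread_part \<eta> e z - concentrated_part \<eta> e z"
    unfolding 3 spread_part_def concentrated_part_def \<rho>_def[symmetric] by (simp add: algebra_simps)
  finally show ?thesis .
qed

section \<open>Estimates for the kernel\<close>

lemma reg_norm_continuous [continuous_intros]: "continuous_on S (reg_norm \<eta>)"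
  unfolding reg_norm_def[abs_def] by (intro continuous_intros)

lemma cutoff_profile_continuous [continuous_intros]:
  "continuous_on S h \<Longrightarrow> continuous_on S (\<lambda>z. cutoff_profile (h z))"
  unfolding cutoff_profile_def by (intro continuous_intros) auto

lemma kernel_continuous:
  assumes "\<eta> \<noteq> 0"
  shows "continuous_on UNIV (drift_kernel \<eta> e)" "continuous_on UNIV (drift_kernel_deriv \<eta> e b)"
    "continuous_on UNIV (drift_kernel_deriv2 \<eta> e b)" "continuous_on UNIV (spread_part \<eta> e)" "continuous_on UNIV (concentrated_part \<eta> e)"
proof -
  have nz: "reg_norm \<eta> z \<noteq> 0" for z :: 'a using reg_norm_pos[OF assms, of z] by simp
  show "continuous_on UNIV (drift_kernel \<eta> e)" "continuous_on UNIV (drift_kernel_deriv \<eta> e b)"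
    "continuous_on UNIV (drift_kernel_deriv2 \<eta> e b)" "continuous_on UNIV (spread_part \<eta> e)" "continuous_on UNIV (concentrated_part \<eta> e)"
    unfolding drift_kernel_def[abs_def] drift_kernel_deriv_def[abs_def] drift_kernel_deriv2_def[abs_def] spread_part_def[abs_def] concentrated_part_def[abs_def]
      radial_g_def radial_k_def radial_k'_def
    by (intro continuous_intros; simp add: nz)+
qed

lemma kernel_support:
  assumes "6 \<le> norm z"
  shows "drift_kernel \<eta> e z = 0" "drift_kernel_deriv \<eta> e b z = 0" "spread_part \<eta> e z = 0" "concentrated_part \<eta> e z = 0"
proof -
  have "cutoff_profile (reg_norm \<eta> z) = 0"
    using assms norm_le_reg_norm[of z \<eta>] by (simp add: cutoff_profile_def)
  then show "drift_kernel \<eta> e z = 0" "drift_kernel_deriv \<eta> e b z = 0" "spread_part \<eta> e z = 0" "concentrated_part \<eta> e z = 0"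
    by (simp_all add: drift_kernel_def drift_kernel_deriv_def spread_part_def concentrated_part_def radial_g_def radial_k_def radial_k'_def)
qed

lemma tilt_le:
  assumes "norm z \<le> 6" "e \<in> Basis"
  shows "exp (- (z \<bullet> e) / 2) \<le> exp 3"
  using Basis_le_norm[OF assms(2), of z] assms(1) by simp

lemma spread_part_bounds:
  assumes "0 < \<eta>" "e \<in> Basis"
  shows "0 \<le> spread_part \<eta> e z" "spread_part \<eta> e z \<le> 2 * exp 3 * (1 / (reg_norm \<eta> z)\<^sup>2)"
proof -
  define P \<rho> where "P = cutoff_profile (reg_norm \<eta> z)" and "\<rho> = reg_norm \<eta> z"
  have \<rho>: "0 < \<rho>" using assms reg_norm_pos[of \<eta> z] by (simp add: \<rho>_def)
  have P: "0 \<le> P" "P \<le> 1" using \<rho> by (auto simp: P_def \<rho>_def cutoff_profile_bounds)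
  have P2: "0 \<le> P^2" "P^2 \<le> 1" using P by (auto intro: power_le_one)
  have a: "spread_part \<eta> e z = exp (- (z \<bullet> e) / 2) * (P\<^sup>2 * (1/3 - P\<^sup>2 / 4) / \<rho>)"
    by (simp add: spread_part_def P_def \<rho>_def)
  have 0: "0 \<le> P\<^sup>2 * (1/3 - P\<^sup>2 / 4) / \<rho>" using P2 \<rho> by (intro divide_nonneg_pos mult_nonneg_nonneg) auto
  show "0 \<le> spread_part \<eta> e z" unfolding a using 0 by (intro mult_nonneg_nonneg) auto
  show "spread_part \<eta> e z \<le> 2 * exp 3 * (1 / (reg_norm \<eta> z)\<^sup>2)"
  proof (cases "norm z < 6 \<and> \<rho> < 6")
    case True
    have "P\<^sup>2 * (1/3 - P\<^sup>2 / 4) \<le> 1 * (1/3)" using P2 by (intro mult_mono) auto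
    then have "P\<^sup>2 * (1/3 - P\<^sup>2 / 4) / \<rho> \<le> (1/3) / \<rho>" using \<rho> by (intro divide_right_mono) auto
    also have "\<dots> \<le> 2 / \<rho>\<^sup>2" using \<rho> True by (simp add: field_simps power2_eq_square)
    finally have "exp (- (z \<bullet> e) / 2) * (P\<^sup>2 * (1/3 - P\<^sup>2 / 4) / \<rho>) \<le> exp 3 * (2 / \<rho>\<^sup>2)"
      using True assms 0 by (intro mult_mono tilt_le) auto
    then show ?thesis unfolding a \<rho>_def[symmetric] by (simp add: mult.commute)
  next
    case False
    then have "P = 0" using norm_le_reg_norm[of z \<eta>] by (auto simp: P_def \<rho>_def cutoff_profile_def)
    then show ?thesis unfolding a by simp
  qed
qed

text \<open>The singularity of the gradient is of order \<open>\<rho>\<^sup>-\<^sup>2\<close>, which is integrable in dimension three uniformly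
  in \<open>\<eta>\<close>. Lower powers of \<open>1/\<rho>\<close> are absorbed because \<open>\<rho> < 6\<close> on the support.\<close>

lemma drift_kernel_deriv_bound:
  assumes "0 < \<eta>" "e \<in> Basis" "b \<in> Basis"
  shows "\<bar>drift_kernel_deriv \<eta> e b z\<bar> \<le> 8 * exp 3 * (1 / (reg_norm \<eta> z)\<^sup>2)"
proof -
  define P \<rho> where "P = cutoff_profile (reg_norm \<eta> z)" and "\<rho> = reg_norm \<eta> z"
  have \<rho>: "0 < \<rho>" using assms reg_norm_pos[of \<eta> z] by (simp add: \<rho>_def)
  have P: "0 \<le> P" "P \<le> 1" using \<rho> by (auto simp: P_def \<rho>_def cutoff_profile_bounds)
  have P34: "0 \<le> P^3" "P^3 \<le> 1" "0 \<le> P^4" "P^4 \<le> 1" using P by (auto intro: power_le_one)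
  show ?thesis
  proof (cases "norm z < 6 \<and> \<rho> < 6")
    case True
    have "radial_k \<rho> = - ((2/3) * P^3 / \<rho>\<^sup>2 + P^4 / \<rho>^3)"
      by (simp add: radial_k_def P_def[folded \<rho>_def, symmetric])
    moreover have "0 \<le> (2/3) * P^3 / \<rho>\<^sup>2 + P^4 / \<rho>^3" using P34 \<rho> by simp
    ultimately have "\<bar>radial_k \<rho>\<bar> = (2/3) * P^3 / \<rho>\<^sup>2 + P^4 / \<rho>^3"
      by (simp only: abs_minus_cancel abs_of_nonneg)
    also have "\<dots> \<le> (2/3) * 1 / \<rho>\<^sup>2 + 1 / \<rho>^3"
      using P34 \<rho> by (intro add_mono divide_right_mono mult_left_mono) auto
    finally have k: "\<bar>radial_k \<rho>\<bar> \<le> (2/3) / \<rho>\<^sup>2 + 1 / \<rho>^3" by simp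
    have zb: "\<bar>z \<bullet> b\<bar> \<le> \<rho>"
      using Basis_le_norm[OF assms(3), of z] norm_le_reg_norm[of z \<eta>] by (simp add: \<rho>_def)
    have "\<bar>radial_k \<rho> * (z \<bullet> b)\<bar> \<le> ((2/3) / \<rho>\<^sup>2 + 1 / \<rho>^3) * \<rho>"
      unfolding abs_mult using k zb by (intro mult_mono) auto
    moreover have "\<bar>(e \<bullet> b) / 2 * radial_g \<rho>\<bar> \<le> (1/2) * (1 / \<rho>)"
      unfolding abs_mult
    proof (intro mult_mono)
      show "\<bar>(e \<bullet> b) / 2\<bar> \<le> 1 / 2" using assms by (auto simp: inner_Basis)
      show "\<bar>radial_g \<rho>\<bar> \<le> 1 / \<rho>"
        using P34 \<rho> by (auto simp: radial_g_def P_def[folded \<rho>_def, symmetric] intro!: divide_right_mono)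
    qed auto
    ultimately have "\<bar>radial_k \<rho> * (z \<bullet> b) - (e \<bullet> b) / 2 * radial_g \<rho>\<bar>
        \<le> ((2/3) / \<rho>\<^sup>2 + 1 / \<rho>^3) * \<rho> + (1/2) * (1 / \<rho>)"
      by linarith
    also have "\<dots> = (7/6) / \<rho> + 1 / \<rho>\<^sup>2" using \<rho> by (simp add: field_simps eval_nat_numeral)
    also have "\<dots> \<le> 7 / \<rho>\<^sup>2 + 1 / \<rho>\<^sup>2" using \<rho> True by (simp add: field_simps power2_eq_square)
    finally have "\<bar>radial_k \<rho> * (z \<bullet> b) - (e \<bullet> b) / 2 * radial_g \<rho>\<bar> \<le> 8 / \<rho>\<^sup>2" by simp
    then have "exp (- (z \<bullet> e) / 2) * \<bar>radial_k \<rho> * (z \<bullet> b) - (e \<bullet> b) / 2 * radial_g \<rho>\<bar> \<le> exp 3 * (8 / \<rho>\<^sup>2)"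
      using True assms by (intro mult_mono tilt_le) auto
    then show ?thesis by (simp add: drift_kernel_deriv_def \<rho>_def abs_mult mult.commute)
  next
    case False
    then have "P = 0" using norm_le_reg_norm[of z \<eta>] by (auto simp: P_def \<rho>_def cutoff_profile_def)
    then show ?thesis by (simp add: drift_kernel_deriv_def radial_k_def radial_g_def P_def)
  qed
qed

lemma concentrated_part_bounds:
  assumes "0 < \<eta>" "e \<in> Basis"
  shows "0 \<le> concentrated_part \<eta> e z"
    "0 < d \<Longrightarrow> d \<le> norm z \<Longrightarrow> concentrated_part \<eta> e z \<le> \<eta>\<^sup>2 * (exp 3 * ((1/3 / d\<^sup>2 + 2 / d^3 + 3 / d^4) / d))"
proof -
  define P \<rho> where "P = cutoff_profile (reg_norm \<eta> z)" and "\<rho> = reg_norm \<eta> z"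
  have \<rho>: "0 < \<rho>" using assms reg_norm_pos[of \<eta> z] by (simp add: \<rho>_def)
  have P: "0 \<le> P" "P \<le> 1" using \<rho> by (auto simp: P_def \<rho>_def cutoff_profile_bounds)
  have P34: "P^2 \<le> 1" "P^3 \<le> 1" "P^4 \<le> 1" using P by (auto intro: power_le_one)
  have k: "radial_k' \<rho> = P\<^sup>2 / 3 / \<rho>\<^sup>2 + 2 * P^3 / \<rho>^3 + 3 * P^4 / \<rho>^4"
    by (simp add: radial_k'_def P_def \<rho>_def)
  have k0: "0 \<le> radial_k' \<rho>" unfolding k using P \<rho> by simp
  then show "0 \<le> concentrated_part \<eta> e z" using \<rho> by (simp add: concentrated_part_def \<rho>_def)
  show "concentrated_part \<eta> e z \<le> \<eta>\<^sup>2 * (exp 3 * ((1/3 / d\<^sup>2 + 2 / d^3 + 3 / d^4) / d))" if d: "0 < d" "d \<le> norm z"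
  proof (cases "norm z < 6")
    case True
    have d\<rho>: "d \<le> \<rho>" using d norm_le_reg_norm[of z \<eta>] by (simp add: \<rho>_def)
    have "radial_k' \<rho> \<le> 1/3 / d\<^sup>2 + 2 / d^3 + 3 / d^4"
      unfolding k using P P34 d d\<rho> by (intro add_mono frac_le power_mono) auto
    then have "radial_k' \<rho> / \<rho> \<le> (1/3 / d\<^sup>2 + 2 / d^3 + 3 / d^4) / d"
      using k0 d d\<rho> by (intro frac_le) auto
    then have "exp (- (z \<bullet> e) / 2) * (radial_k' \<rho> / \<rho>) \<le> exp 3 * ((1/3 / d\<^sup>2 + 2 / d^3 + 3 / d^4) / d)"
      using True assms k0 \<rho> by (intro mult_mono tilt_le) auto
    then show ?thesis unfolding concentrated_part_def \<rho>_def[symmetric] mult.assoc by (intro mult_left_mono) auto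
  next
    case False
    then show ?thesis using d by (simp add: kernel_support)
  qed
qed

text \<open>On this set \<open>\<rho>\<^sup>2 \<le> 22 + 1 < 25\<close>, so \<open>\<rho>\<close> keeps the distance \<open>1\<close> from the end of the support and
  \<open>P \<ge> 1/6\<close>.\<close>

lemma spread_part_lower_bound:
  assumes "0 < \<eta>" "\<eta> \<le> 1" "e \<in> Basis" "(norm z)\<^sup>2 \<le> 22"
  shows "exp (-3) / 2160 \<le> spread_part \<eta> e z"
proof -
  define P \<rho> where "P = cutoff_profile (reg_norm \<eta> z)" and "\<rho> = reg_norm \<eta> z"
  have \<rho>: "0 < \<rho>" using assms reg_norm_pos[of \<eta> z] by (simp add: \<rho>_def)
  have "\<eta>\<^sup>2 \<le> 1" using assms by (simp add: power_le_one)
  then have "\<rho>\<^sup>2 \<le> 5\<^sup>2" using assms by (simp add: \<rho>_def reg_norm_sq)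
  then have \<rho>5: "\<rho> \<le> 5" by (rule power2_le_imp_le) simp
  have P: "1/6 \<le> P" "P \<le> 1" using \<rho>5 \<rho> by (auto simp: P_def \<rho>_def[symmetric] cutoff_profile_def)
  have P2: "1/36 \<le> P\<^sup>2" "P\<^sup>2 \<le> 1" using power_mono[OF P(1), of 2] power_le_one[of P 2] P
    by (auto simp: power2_eq_square)
  have nz: "norm z \<le> 6" using norm_le_reg_norm[of z \<eta>] \<rho>5 by (simp add: \<rho>_def)
  have "(1/36) * (1/12) / 5 \<le> P\<^sup>2 * (1/3 - P\<^sup>2 / 4) / \<rho>"
    using P2 \<rho> \<rho>5 by (intro frac_le mult_mono) auto
  moreover have "exp (-3) \<le> exp (- (z \<bullet> e) / 2)"
    using Basis_le_norm[OF assms(3), of z] nz by simp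
  ultimately have "exp (-3) * ((1/36) * (1/12) / 5) \<le> exp (- (z \<bullet> e) / 2) * (P\<^sup>2 * (1/3 - P\<^sup>2 / 4) / \<rho>)"
    by (intro mult_mono) auto
  then show ?thesis by (simp add: spread_part_def P_def \<rho>_def)
qed

text \<open>The function \<open>3 s (s\<^sup>2 + c)\<^sup>-\<^sup>1\<^sup>/\<^sup>3\<close> has a derivative that dominates the integrand, for every \<open>c > 0\<close>.\<close>

lemma integral_powr_minus_third_le:
  assumes "0 < c"
  shows "integral {-7..7} (\<lambda>s::real. (s\<^sup>2 + c) powr (-1/3)) \<le> 42"
proof -
  define F F' where "F s = 3 * s * (s\<^sup>2 + c) powr (-1/3)"
    and "F' s = 3 * (s\<^sup>2 + c) powr (-1/3) - 2 * s\<^sup>2 * (s\<^sup>2 + c) powr (-4/3)" for s :: real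
  have pos: "0 < s\<^sup>2 + c" for s :: real using assms by (simp add: add_nonneg_pos)
  have "(F has_real_derivative F' s) (at s)" for s
    unfolding F_def[abs_def] F'_def using pos[of s]
    by (auto intro!: derivative_eq_intros simp: power2_eq_square)
  then have "(F' has_integral (F 7 - F (-7))) {-7..7}"
    by (intro fundamental_theorem_of_calculus)
      (auto simp: has_real_derivative_iff_has_vector_derivative[symmetric] intro: DERIV_subset)
  moreover have "(s\<^sup>2 + c) powr (-1/3) \<le> F' s" for s :: real
  proof -
    have "s\<^sup>2 * (s\<^sup>2 + c) powr (-4/3) \<le> (s\<^sup>2 + c) * (s\<^sup>2 + c) powr (-4/3)"
      using assms by (intro mult_right_mono) auto
    also have "\<dots> = (s\<^sup>2 + c) powr (1 + -4/3)" using pos[of s] by (intro powr_mult_base) simp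
    finally show ?thesis by (simp add: F'_def)
  qed
  moreover have "(\<lambda>s::real. (s\<^sup>2 + c) powr (-1/3)) integrable_on {-7..7}"
    using less_imp_neq[OF pos, THEN not_sym]
    by (intro integrable_continuous_interval continuous_intros) blast
  ultimately have "integral {-7..7} (\<lambda>s::real. (s\<^sup>2 + c) powr (-1/3)) \<le> F 7 - F (-7)"
    by (intro has_integral_le[OF integrable_integral]) auto
  also have "\<dots> = 42 * (49 + c) powr (-1/3)" by (simp add: F_def)
  also have "\<dots> \<le> 42 * 1"
  proof (intro mult_left_mono)
    have "(49 + c) powr (-1/3) \<le> (49 + c) powr 0" using assms by (intro powr_mono) auto
    then show "(49 + c) powr (-1/3) \<le> 1" using assms by simp
  qed simp
  finally show ?thesis by simp
qed

lemma inverse_sum_le_powr_product: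
  fixes a b c :: real
  assumes "0 < a" "0 < b" "0 < c"
  shows "1 / (a + b + c) \<le> a powr (-1/3) * (b powr (-1/3) * c powr (-1/3))"
proof -
  have "a * (b * c) \<le> (a + b + c) * ((a + b + c) * (a + b + c))"
    using assms by (intro mult_mono) auto
  also have "\<dots> = (a + b + c) powr 3" using assms by (simp add: powr_numeral power3_eq_cube)
  finally have "((a + b + c) powr 3) powr (-1/3) \<le> (a * (b * c)) powr (-1/3)"
    using assms by (intro powr_mono2') auto
  moreover have "((a + b + c) powr 3) powr (-1/3) = 1 / (a + b + c)"
    unfolding powr_powr using assms by (simp add: powr_minus_divide)
  moreover have "(a * (b * c)) powr (-1/3) = a powr (-1/3) * (b powr (-1/3) * c powr (-1/3))"
    using assms by (simp add: powr_mult)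
  ultimately show ?thesis by simp
qed

text \<open>Uniform integrability of \<open>\<rho>\<^sup>-\<^sup>2\<close> without polar coordinates: distributing \<open>\<eta>\<^sup>2\<close> over the three
  squares, \<open>\<rho>\<^sup>-\<^sup>2\<close> lies below a product of three functions of one variable each.\<close>

lemma integral_inverse_reg_norm_sq_le:
  assumes "0 < \<eta>"
  shows "integral (cbox (-7, -7, -7) (7, 7, 7)) (\<lambda>z::real \<times> real \<times> real. 1 / (reg_norm \<eta> z)\<^sup>2) \<le> 42 ^ 3"
proof -
  define A :: "real \<Rightarrow> real" where "A s = (s\<^sup>2 + \<eta>\<^sup>2 / 3) powr (-1/3)" for s
  have pos: "0 < s\<^sup>2 + \<eta>\<^sup>2 / 3" for s :: real using assms by (simp add: add_nonneg_pos)
  have cA: "continuous_on S (\<lambda>z. A (h z))" if "continuous_on S h" for S and h :: "'c::topological_space \<Rightarrow> real"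
    unfolding A_def using that less_imp_neq[OF pos, THEN not_sym] by (intro continuous_intros) auto
  have A0: "0 \<le> A s" for s by (simp add: A_def)
  have "A integrable_on {-7..7}"
    by (intro integrable_continuous_interval cA continuous_on_id)
  then have I: "0 \<le> integral {-7..7} A" "integral {-7..7} A \<le> 42"
    using integral_powr_minus_third_le[of "\<eta>\<^sup>2 / 3"] assms A0
    by (auto simp: A_def[abs_def] intro!: integral_nonneg)
  have "integral (cbox (-7, -7, -7) (7, 7, 7)) (\<lambda>z::real \<times> real \<times> real. 1 / (reg_norm \<eta> z)\<^sup>2)
      \<le> integral (cbox (-7, -7, -7) (7, 7, 7)) (\<lambda>(s, x, y). A s * (A x * A y))"
  proof (rule integral_le)
    show "(\<lambda>z::real \<times> real \<times> real. 1 / (reg_norm \<eta> z)\<^sup>2) integrable_on cbox (-7, -7, -7) (7, 7, 7)"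
      using less_imp_neq[OF reg_norm_pos, THEN not_sym, of \<eta>] assms
      by (intro integrable_continuous continuous_intros) auto
    show "(\<lambda>(s, x, y). A s * (A x * A y)) integrable_on cbox (-7, -7, -7) (7, 7, 7)"
      unfolding case_prod_unfold by (intro integrable_continuous continuous_intros cA)
    fix z :: "real \<times> real \<times> real"
    obtain s x y where z: "z = (s, x, y)" by (cases z)
    have "(reg_norm \<eta> z)\<^sup>2 = (s\<^sup>2 + \<eta>\<^sup>2 / 3) + (x\<^sup>2 + \<eta>\<^sup>2 / 3) + (y\<^sup>2 + \<eta>\<^sup>2 / 3)"
      by (simp add: reg_norm_sq z norm_prod_def)
    with inverse_sum_le_powr_product[OF pos pos pos, of s x y]
    show "1 / (reg_norm \<eta> z)\<^sup>2 \<le> (case z of (s, x, y) \<Rightarrow> A s * (A x * A y))"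
      by (simp add: z A_def)
  qed
  also have "\<dots> = integral {-7..7} (\<lambda>s. integral {-7..7} (\<lambda>x. integral {-7..7} (\<lambda>y. A s * (A x * A y))))"
  proof (subst integral_prod_continuous)
    show "continuous_on (cbox (-7, -7, -7) (7, 7, 7)) (\<lambda>(s, x, y). A s * (A x * A y))"
      unfolding case_prod_unfold by (intro continuous_intros cA)
    have "integral (cbox (-7, -7) (7, 7)) (\<lambda>(x, y). A s * (A x * A y)) =
        integral {-7..7} (\<lambda>x. integral {-7..7} (\<lambda>y. A s * (A x * A y)))" for s
      by (subst integral_prod_continuous)
        (auto simp: case_prod_unfold intro!: continuous_intros cA)
    then show "integral (cbox (-7) 7) (\<lambda>s. integral (cbox (-7, -7) (7, 7)) (\<lambda>z. case (s, z) of (s, x, y) \<Rightarrow> A s * (A x * A y)))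
      = integral {-7..7} (\<lambda>s. integral {-7..7} (\<lambda>x. integral {-7..7} (\<lambda>y. A s * (A x * A y))))"
      by simp
  qed
  also have "\<dots> = integral {-7..7} A * (integral {-7..7} A * integral {-7..7} A)"
    by simp
  also have "\<dots> \<le> 42 * (42 * 42)" using I by (intro mult_mono) auto
  finally show ?thesis by simp
qed

section \<open>Contraction of differences of translates\<close>

text \<open>The bound \<open>2 \<pi>\<^sup>2 + 1 \<le> 22\<close> is needed for the box below to lie where the kernel is bounded
  from below; it follows from Machin's formula.\<close>

lemma pi_le_16_5: "pi \<le> 16 / 5"
proof -
  have "arctan (1/5) - 1/5 \<le> arctan 0 - 0"
  proof (rule DERIV_nonpos_imp_nonincreasing[of 0 "1/5" "\<lambda>x. arctan x - x"])
    fix x :: real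
    have "((\<lambda>x. arctan x - x) has_real_derivative inverse (1 + x\<^sup>2) - 1) (at x)"
      by (auto intro!: derivative_eq_intros simp: add_nonneg_eq_0_iff)
    moreover have "inverse (1 + x\<^sup>2) \<le> 1" by (simp add: inverse_le_1_iff)
    ultimately show "\<exists>y. ((\<lambda>x. arctan x - x) has_real_derivative y) (at x) \<and> y \<le> 0"
      by (intro exI[of _ "inverse (1 + x\<^sup>2) - 1"]) simp
  qed simp
  then have "arctan (1/5) \<le> 1/5" by simp
  moreover have "0 < arctan (1/239)" by simp
  ultimately show ?thesis using machin by linarith
qed

abbreviation kernel_box :: "(real \<times> real \<times> real) set"
  where "kernel_box \<equiv> cbox (-7, -7, -7) (7, 7, 7)"

definition cell_box :: "(real \<times> real \<times> real) set"
  where "cell_box = cbox (-1, -pi, -pi) (1, pi, pi)"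

lemma cell_box_norm: "z \<in> cell_box \<Longrightarrow> (norm z)\<^sup>2 \<le> 22"
proof -
  assume "z \<in> cell_box"
  obtain s x y where z: "z = (s, x, y)" by (cases z)
  have "\<bar>s\<bar> \<le> 1" "\<bar>x\<bar> \<le> 16/5" "\<bar>y\<bar> \<le> 16/5"
    using \<open>z \<in> cell_box\<close> pi_le_16_5 by (auto simp: cell_box_def z)
  then have "s\<^sup>2 \<le> 1\<^sup>2" "x\<^sup>2 \<le> (16/5)\<^sup>2" "y\<^sup>2 \<le> (16/5)\<^sup>2"
    by (auto intro!: abs_le_square_iff[THEN iffD1] simp del: power_one)
  then have "s\<^sup>2 + (x\<^sup>2 + y\<^sup>2) \<le> 22" by (simp add: power2_eq_square)
  then show ?thesis by (simp add: z norm_prod_def)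
qed

lemma cell_box_subset: "cell_box \<subseteq> kernel_box"
  using pi_less_4 unfolding cell_box_def by (intro subset_box_imp) (auto simp: Basis_prod_def)

lemma measure_cell_box_pos: "0 < measure lebesgue cell_box"
  by (simp add: cell_box_def content_pos_lt_eq Basis_prod_def)

lemma ball_subset_kernel_box: "cball 0 (6 + 1) \<subseteq> kernel_box"
proof
  fix z :: "real \<times> real \<times> real" assume "z \<in> cball 0 (6 + 1)"
  obtain s x y where z: "z = (s, x, y)" by (cases z)
  have "norm s \<le> norm z" "norm (x, y) \<le> norm z" "norm x \<le> norm (x, y)" "norm y \<le> norm (x, y)"
    unfolding z by (metis norm_fst_le norm_snd_le fst_conv snd_conv)+
  then show "z \<in> kernel_box" using \<open>z \<in> cball 0 (6 + 1)\<close> by (auto simp: z)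
qed

lemma drift_poisson_one: "drift_poisson e (\<lambda>_. 1) (\<lambda>_ _. 0) (\<lambda>_ _. 0) (\<lambda>_ _. 0) (\<lambda>_ _. 0)"
  by (auto simp: drift_poisson_def has_dir_deriv_def)

text \<open>For \<open>u = 1\<close> and \<open>f = 0\<close> this says that the two parts of the kernel have the same mass.\<close>

lemma kernel_identity:
  fixes u :: "real \<times> real \<times> real \<Rightarrow> real"
  assumes sol: "drift_poisson e u du ddu f df" and e: "e \<in> Basis" and \<eta>: "0 < \<eta>"
  shows "integral kernel_box (\<lambda>z. concentrated_part \<eta> e z * u z) = integral kernel_box (\<lambda>z. spread_part \<eta> e z * u z)
    + integral kernel_box (\<lambda>z. \<Sum>b\<in>Basis. drift_kernel_deriv \<eta> e b z * f b z)"
proof -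
  have \<eta>0: "\<eta> \<noteq> 0" using \<eta> by simp
  note cont = kernel_continuous[OF \<eta>0, THEN continuous_on_subset[OF _ subset_UNIV]]
  note S = sol[unfolded drift_poisson_def]
  have c: "continuous_on A u" "b \<in> Basis \<Longrightarrow> continuous_on A (f b)" for A b
    using S continuous_on_subset subset_UNIV by blast+
  have "integral kernel_box (\<lambda>z. ((\<Sum>b\<in>Basis. drift_kernel_deriv2 \<eta> e b z) + drift_kernel_deriv \<eta> e e z) * u z
      + (\<Sum>b\<in>Basis. drift_kernel_deriv \<eta> e b z * f b z)) = 0"
    using has_dir_deriv_drift_kernel[OF \<eta>0] has_dir_deriv_drift_kernel_deriv[OF \<eta>0] kernel_continuous[OF \<eta>0] kernel_support
    by (intro drift_poisson_test_function[OF sol e, where \<phi> = "drift_kernel \<eta> e" and R = 6]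
        ball_subset_kernel_box) auto
  then have "integral kernel_box (\<lambda>z. (spread_part \<eta> e z * u z - concentrated_part \<eta> e z * u z)
      + (\<Sum>b\<in>Basis. drift_kernel_deriv \<eta> e b z * f b z)) = 0"
    using drift_laplacian_drift_kernel[OF \<eta>0 e] by (simp add: left_diff_distrib)
  moreover have "integral kernel_box (\<lambda>z. (spread_part \<eta> e z * u z - concentrated_part \<eta> e z * u z)
      + (\<Sum>b\<in>Basis. drift_kernel_deriv \<eta> e b z * f b z)) =
    integral kernel_box (\<lambda>z. spread_part \<eta> e z * u z) - integral kernel_box (\<lambda>z. concentrated_part \<eta> e z * u z)
    + integral kernel_box (\<lambda>z. \<Sum>b\<in>Basis. drift_kernel_deriv \<eta> e b z * f b z)"
    by (subst integral_add integral_diff;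
        (intro integrable_continuous continuous_intros c cont; simp)?)+ simp
  ultimately show ?thesis by simp
qed


lemma continuous_on_near:
  fixes w :: "'a::real_normed_vector \<Rightarrow> real"
  assumes "continuous_on UNIV w" "0 < \<kappa>"
  obtains d where "0 < d" "\<And>z. norm z < d \<Longrightarrow> \<bar>w 0 - w z\<bar> \<le> \<kappa>"
proof -
  have "isCont w 0" using assms(1) by (simp add: continuous_on_eq_continuous_at)
  then obtain d where "0 < d" "\<And>z. dist z 0 < d \<Longrightarrow> dist (w z) (w 0) < \<kappa>"
    using assms(2) unfolding continuous_at_eps_delta dist_norm by auto
  then show ?thesis by (intro that[of d]) (auto simp: dist_norm abs_minus_commute intro: less_imp_le)
qed

text \<open>Let \<open>m\<close> be the common mass of the two parts of the kernel. The left side of the kernel identity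
  differs from \<open>m w(0)\<close> by a term that tends to \<open>0\<close> with \<open>\<eta>\<close>. On the right side, subtracting \<open>c\<close> on the box does not change the integral of
  \<open>w\<close> and lowers the mass to \<open>m - c v\<close>, where \<open>v\<close> is the volume of the box. So \<open>\<theta> = 1 - c v / M\<^sub>1\<close> with a
  bound \<open>M\<^sub>1\<close> for \<open>m\<close> that is independent of \<open>\<eta>\<close>.\<close>

lemma oscillation_contraction:
  obtains \<theta> C :: real where "0 \<le> \<theta>" "\<theta> < 1" "0 \<le> C"
    "\<And>e w dw ddw f df \<omega> \<epsilon>. \<lbrakk>drift_poisson e w dw ddw f df; e \<in> Basis; integral cell_box w = 0;
       \<And>z. \<bar>w z\<bar> \<le> \<omega>; \<And>b z. b \<in> Basis \<Longrightarrow> \<bar>f b z\<bar> \<le> \<epsilon>\<rbrakk> \<Longrightarrow> w 0 \<le> \<theta> * \<omega> + C * \<epsilon>"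
proof -
  define c v where "c = exp (-3) / (2160::real)" and "v = integral cell_box (\<lambda>_. 1::real)"
  define M1 C1 where "M1 = 2 * exp 3 * (42::real) ^ 3" and "C1 = 24 * exp 3 * (42::real) ^ 3"
  define vol where "vol = integral kernel_box (\<lambda>_. 1::real)"
  have v: "0 < v" using measure_cell_box_pos by (simp add: v_def cell_box_def)
  have cv: "0 < c * v" using v by (simp add: c_def)
  have vol: "0 \<le> vol" unfolding vol_def by (intro integral_nonneg integrable_continuous) auto
  have key: "w 0 \<le> (1 - c * v / M1) * \<omega> + C1 / (c * v) * \<epsilon> \<and> c * v \<le> M1"
    if sol: "drift_poisson e w dw ddw f df" and e: "e \<in> Basis" and mean0: "integral cell_box w = 0"
      and \<omega>: "\<And>z. \<bar>w z\<bar> \<le> \<omega>" and f: "\<And>b z. b \<in> Basis \<Longrightarrow> \<bar>f b z\<bar> \<le> \<epsilon>"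
    for e w dw ddw f df \<omega> \<epsilon>
  proof -
    note S = sol[unfolded drift_poisson_def]
    have cw: "continuous_on A w" "b \<in> Basis \<Longrightarrow> continuous_on A (f b)" for A b
      using S continuous_on_subset subset_UNIV by blast+
    have \<omega>0: "0 \<le> \<omega>" using \<omega>[of 0] by linarith
    have \<epsilon>0: "0 \<le> \<epsilon>" using f[OF e, of 0] by linarith
    \<comment> \<open>The estimate for a fixed \<open>\<eta>\<close>: \<open>\<kappa>\<close> bounds
      \<open>|w(0) - w|\<close> on the ball of radius \<open>d\<close>, and \<open>\<eta>\<^sup>2
      L\<close> bounds the concentrated part outside that ball.\<close>
    have step: "w 0 \<le> (1 - c * v / M1) * \<omega> + (C1 * \<epsilon> + 2 * \<omega> * \<eta>\<^sup>2 * L * vol) / (c * v) + \<kappa>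
        \<and> c * v \<le> M1"
      if \<eta>: "0 < \<eta>" "\<eta> \<le> 1" and \<kappa>: "0 \<le> \<kappa>" and near: "\<And>z. norm z < d \<Longrightarrow> \<bar>w 0 - w z\<bar> \<le> \<kappa>"
        and far: "0 \<le> L" "\<And>z. d \<le> norm z \<Longrightarrow> concentrated_part \<eta> e z \<le> \<eta>\<^sup>2 * L" for \<eta> \<kappa> d L
    proof -
      have \<eta>0: "\<eta> \<noteq> 0" using \<eta> by simp
      note cont = kernel_continuous[OF \<eta>0, THEN continuous_on_subset[OF _ subset_UNIV]]
      have nz: "reg_norm \<eta> z \<noteq> 0" for z :: "real \<times> real \<times> real" using reg_norm_pos[OF \<eta>0, of z] by simp
      define r where "r z = 1 / (reg_norm \<eta> z)\<^sup>2" for z :: "real \<times> real \<times> real"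
      have cr: "continuous_on A r" for A unfolding r_def[abs_def] using nz by (intro continuous_intros) auto
      have r0: "0 \<le> r z" for z by (simp add: r_def)
      note ci = integrable_continuous continuous_on_add continuous_on_diff continuous_on_mult
        continuous_on_sum continuous_on_const cont cw cr
      have Ir: "integral kernel_box r \<le> 42 ^ 3"
        using integral_inverse_reg_norm_sq_le[OF \<eta>(1)] by (simp add: r_def[abs_def])
      define m where "m = integral kernel_box (spread_part \<eta> e)"
      have mb: "m = integral kernel_box (concentrated_part \<eta> e)"
        using kernel_identity[OF drift_poisson_one e \<eta>(1)] by (simp add: m_def)
      have "m \<le> integral kernel_box (\<lambda>z. 2 * exp 3 * r z)"
        unfolding m_def using spread_part_bounds(2)[OF \<eta>(1) e]
        by (intro integral_le ci) (auto simp: r_def)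
      also have "\<dots> \<le> M1" unfolding M1_def using Ir by simp
      finally have mM: "m \<le> M1" .
      define ind where "ind z = (if z \<in> cell_box then c else 0)" for z
      have cell: "cell_box \<inter> kernel_box = cell_box" using cell_box_subset by auto
      have ind_int: "(\<lambda>z. ind z * g z) integrable_on kernel_box"
        "integral kernel_box (\<lambda>z. ind z * g z) = c * integral cell_box g"
        if "continuous_on UNIV g" for g
      proof -
        have 1: "(\<lambda>z. ind z * g z) = (\<lambda>z. if z \<in> cell_box then c * g z else 0)"
          by (auto simp: ind_def)
        have "(\<lambda>z. c * g z) integrable_on cell_box" unfolding cell_box_def
          by (intro integrable_continuous continuous_intros continuous_on_subset[OF that]) auto
        then show "(\<lambda>z. ind z * g z) integrable_on kernel_box"
          unfolding 1 integrable_restrict_Int cell .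
        show "integral kernel_box (\<lambda>z. ind z * g z) = c * integral cell_box g"
          unfolding 1 integral_restrict_Int cell by simp
      qed
      have ind1: "ind integrable_on kernel_box" "integral kernel_box ind = c * v"
        using ind_int[of "\<lambda>_. 1"] by (auto simp: v_def)
      have ind_le: "ind z \<le> spread_part \<eta> e z" for z
        using spread_part_lower_bound[OF \<eta> e cell_box_norm, of z] spread_part_bounds(1)[OF \<eta>(1) e]
        by (auto simp: ind_def c_def)
      have ai: "spread_part \<eta> e integrable_on kernel_box" by (intro ci)
      have cm: "c * v \<le> m"
        unfolding ind1(2)[symmetric] m_def using ind_le by (intro integral_le ind1 ai) auto
      have "integral kernel_box (\<lambda>z. spread_part \<eta> e z * w z) =
          integral kernel_box (\<lambda>z. spread_part \<eta> e z * w z) - integral kernel_box (\<lambda>z. ind z * w z)"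
        using ind_int(2)[OF cw(1)] mean0 by simp
      also have "\<dots> = integral kernel_box (\<lambda>z. spread_part \<eta> e z * w z - ind z * w z)"
        by (intro integral_diff[symmetric] ind_int(1) ci)
      also have "\<dots> \<le> integral kernel_box (\<lambda>z. (spread_part \<eta> e z - ind z) * \<omega>)"
      proof (rule integral_le)
        show "(\<lambda>z. spread_part \<eta> e z * w z - ind z * w z) integrable_on kernel_box"
          by (intro integrable_diff ind_int(1) ci)
        show "(\<lambda>z. (spread_part \<eta> e z - ind z) * \<omega>) integrable_on kernel_box"
          by (intro integrable_on_mult_left integrable_diff ai ind1)
        show "spread_part \<eta> e z * w z - ind z * w z \<le> (spread_part \<eta> e z - ind z) * \<omega>" for z
          unfolding left_diff_distrib[symmetric] using \<omega>[of z] ind_le[of z]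
          by (intro mult_left_mono) auto
      qed
      also have "\<dots> = (m - c * v) * \<omega>"
        using integral_diff[OF ai ind1(1)] by (simp add: ind1(2) m_def)
      finally have A: "integral kernel_box (\<lambda>z. spread_part \<eta> e z * w z) \<le> (m - c * v) * \<omega>" .
      have "integral kernel_box (\<lambda>z. \<Sum>b\<in>Basis. drift_kernel_deriv \<eta> e b z * f b z)
          \<le> integral kernel_box (\<lambda>z. 24 * exp 3 * \<epsilon> * r z)"
      proof (rule integral_le)
        have "continuous_on kernel_box (\<lambda>z. \<Sum>b\<in>Basis. drift_kernel_deriv \<eta> e b z * f b z)"
          by (rule continuous_on_sum, rule continuous_on_mult[OF cont(2) cw(2)])
        then show "(\<lambda>z. \<Sum>b\<in>Basis. drift_kernel_deriv \<eta> e b z * f b z) integrable_on kernel_box"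
          by (rule integrable_continuous)
        show "(\<lambda>z. 24 * exp 3 * \<epsilon> * r z) integrable_on kernel_box"
          by (intro ci)
        fix z
        have "(\<Sum>b\<in>Basis. drift_kernel_deriv \<eta> e b z * f b z) \<le> (\<Sum>b\<in>(Basis::(real\<times>real\<times>real) set). (8 * exp 3 * r z) * \<epsilon>)"
        proof (rule sum_mono, rule order_trans[OF abs_ge_self])
          fix b :: "real \<times> real \<times> real" assume b: "b \<in> Basis"
          show "\<bar>drift_kernel_deriv \<eta> e b z * f b z\<bar> \<le> 8 * exp 3 * r z * \<epsilon>"
            unfolding abs_mult using drift_kernel_deriv_bound[OF \<eta>(1) e b, of z] f[OF b, of z] r0
            by (intro mult_mono) (auto simp: r_def)
        qed
        also have "\<dots> = 24 * exp 3 * \<epsilon> * r z" by simp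
        finally show "(\<Sum>b\<in>Basis. drift_kernel_deriv \<eta> e b z * f b z) \<le> 24 * exp 3 * \<epsilon> * r z" .
      qed
      also have "\<dots> = 24 * exp 3 * \<epsilon> * integral kernel_box r" by simp
      also have "\<dots> \<le> 24 * exp 3 * \<epsilon> * 42 ^ 3" using Ir \<epsilon>0 by (intro mult_left_mono) auto
      finally have F: "integral kernel_box (\<lambda>z. \<Sum>b\<in>Basis. drift_kernel_deriv \<eta> e b z * f b z) \<le> C1 * \<epsilon>"
        by (simp add: C1_def mult_ac)
      have "integral kernel_box (\<lambda>z. concentrated_part \<eta> e z * (w 0 - w z))
          \<le> integral kernel_box (\<lambda>z. \<kappa> * concentrated_part \<eta> e z + \<eta>\<^sup>2 * L * (2 * \<omega>))"
      proof (intro integral_le ci)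
        fix z
        show "concentrated_part \<eta> e z * (w 0 - w z) \<le> \<kappa> * concentrated_part \<eta> e z + \<eta>\<^sup>2 * L * (2 * \<omega>)"
        proof (cases "norm z < d")
          case True
          have "concentrated_part \<eta> e z * (w 0 - w z) \<le> concentrated_part \<eta> e z * \<kappa>"
            using near[OF True] concentrated_part_bounds(1)[OF \<eta>(1) e] by (intro mult_left_mono) auto
          moreover have "0 \<le> \<eta>\<^sup>2 * L * (2 * \<omega>)" using far \<omega>0 by simp
          moreover have "concentrated_part \<eta> e z * \<kappa> = \<kappa> * concentrated_part \<eta> e z" by simp
          ultimately show ?thesis by linarith
        next
          case False
          have "concentrated_part \<eta> e z * (w 0 - w z) \<le> concentrated_part \<eta> e z * (2 * \<omega>)"
            using \<omega>[of 0] \<omega>[of z] concentrated_part_bounds(1)[OF \<eta>(1) e] by (intro mult_left_mono) auto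
          also have "\<dots> \<le> \<eta>\<^sup>2 * L * (2 * \<omega>)"
            using far(2) False \<omega>0 by (intro mult_right_mono) auto
          finally show ?thesis using concentrated_part_bounds(1)[OF \<eta>(1) e, of z] \<kappa>
            by (simp add: add_increasing)
        qed
      qed
      also have "\<dots> = \<kappa> * m + 2 * \<omega> * \<eta>\<^sup>2 * L * vol"
      proof -
        have "integral kernel_box (\<lambda>z. \<kappa> * concentrated_part \<eta> e z + \<eta>\<^sup>2 * L * (2 * \<omega>) * 1) =
            integral kernel_box (\<lambda>z. \<kappa> * concentrated_part \<eta> e z) + integral kernel_box (\<lambda>z. \<eta>\<^sup>2 * L * (2 * \<omega>) * 1)"
          by (intro integral_add ci)
        then show ?thesis unfolding integral_mult_right mb[symmetric] vol_def[symmetric]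
          by (simp add: mult_ac)
      qed
      finally have N: "integral kernel_box (\<lambda>z. concentrated_part \<eta> e z * (w 0 - w z)) \<le> \<kappa> * m + 2 * \<omega> * \<eta>\<^sup>2 * L * vol" .
      have "m * w 0 = integral kernel_box (\<lambda>z. concentrated_part \<eta> e z * w 0)" by (simp add: mb)
      also have "\<dots> = integral kernel_box (\<lambda>z. concentrated_part \<eta> e z * (w 0 - w z) + concentrated_part \<eta> e z * w z)"
        by (simp add: algebra_simps)
      also have "\<dots> = integral kernel_box (\<lambda>z. concentrated_part \<eta> e z * (w 0 - w z)) + integral kernel_box (\<lambda>z. concentrated_part \<eta> e z * w z)"
        by (intro integral_add ci)
      also have "\<dots> \<le> (\<kappa> * m + 2 * \<omega> * \<eta>\<^sup>2 * L * vol) + ((m - c * v) * \<omega> + C1 * \<epsilon>)"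
        unfolding kernel_identity[OF sol e \<eta>(1)] using A F N by linarith
      finally have main: "m * w 0 \<le> m * \<omega> + m * \<kappa> + (C1 * \<epsilon> + 2 * \<omega> * \<eta>\<^sup>2 * L * vol) - c * v * \<omega>"
        by (simp add: algebra_simps)
      have m: "0 < m" using cm cv by linarith
      define X where "X = C1 * \<epsilon> + 2 * \<omega> * \<eta>\<^sup>2 * L * vol"
      have X: "0 \<le> X" unfolding X_def C1_def using \<epsilon>0 \<omega>0 far vol by simp
      have "m * w 0 / m \<le> (m * \<omega> + m * \<kappa> + X - c * v * \<omega>) / m"
        using main m unfolding X_def[symmetric] by (intro divide_right_mono) auto
      then have "w 0 \<le> \<omega> + \<kappa> + X / m - c * v / m * \<omega>"
        using m by (simp add: add_divide_distrib diff_divide_distrib)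
      moreover have "X / m \<le> X / (c * v)" using X cm cv by (intro divide_left_mono) auto
      moreover have "c * v / M1 * \<omega> \<le> c * v / m * \<omega>"
        using mM m cv \<omega>0 by (intro mult_right_mono divide_left_mono) auto
      ultimately show ?thesis using cm mM unfolding X_def by (auto simp: algebra_simps)
    qed
    have "w 0 \<le> ((1 - c * v / M1) * \<omega> + C1 / (c * v) * \<epsilon>) + \<kappa> \<and> c * v \<le> M1" if "0 < \<kappa>" for \<kappa>
    proof -
      obtain d where d: "0 < d" "\<And>z. norm z < d \<Longrightarrow> \<bar>w 0 - w z\<bar> \<le> \<kappa> / 2"
        by (rule continuous_on_near[OF cw(1), of "\<kappa> / 2"]) (use \<open>0 < \<kappa>\<close> in simp, blast)
      define L where "L = exp 3 * ((1/3 / d\<^sup>2 + 2 / d^3 + 3 / d^4) / d)"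
      have L: "0 \<le> L" using d by (simp add: L_def)
      \<comment> \<open>The far contribution is \<open>\<eta>\<^sup>2 K\<close>; this
        \<open>\<eta>\<close> makes it at most \<open>\<kappa> / 2\<close>.\<close>
      define K where "K = 2 * \<omega> * L * vol / (c * v)"
      have K: "0 \<le> K" using \<omega>0 L vol cv by (simp add: K_def)
      define \<eta> where "\<eta> = min 1 (\<kappa> / (2 * (K + 1)))"
      have \<eta>: "0 < \<eta>" "\<eta> \<le> 1" using that K by (auto simp: \<eta>_def)
      have "\<eta>\<^sup>2 * K \<le> \<eta> * K" using \<eta> K by (intro mult_right_mono) (auto simp: power2_eq_square)
      also have "\<dots> \<le> \<kappa> / (2 * (K + 1)) * (K + 1)" using \<eta> K that by (intro mult_mono) (auto simp: \<eta>_def)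
      also have "\<dots> = \<kappa> / 2" using K by (simp add: field_simps)
      finally have small: "\<eta>\<^sup>2 * K \<le> \<kappa> / 2" .
      have "w 0 \<le> (1 - c * v / M1) * \<omega> + (C1 * \<epsilon> + 2 * \<omega> * \<eta>\<^sup>2 * L * vol) / (c * v) + \<kappa> / 2 \<and> c * v \<le> M1"
        using d L that concentrated_part_bounds(2)[OF \<eta>(1) e d(1)]
        by (intro step[OF \<eta>, where d = d]) (auto simp: L_def)
      moreover have "(C1 * \<epsilon> + 2 * \<omega> * \<eta>\<^sup>2 * L * vol) / (c * v) = C1 / (c * v) * \<epsilon> + \<eta>\<^sup>2 * K"
        by (simp add: K_def add_divide_distrib)
      ultimately show ?thesis using small by linarith
    qed
    then show ?thesis using field_le_epsilon[of "w 0"] zero_less_one by blast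
  qed
  \<comment> \<open>The constants alone satisfy this; it is read off from the estimate for the zero
    solution.\<close>
  have cM: "c * v \<le> M1"
  proof -
    have "(1, 0, 0) \<in> (Basis :: (real \<times> real \<times> real) set)" by (simp add: Basis_prod_def zero_prod_def)
    moreover have "drift_poisson (1, 0, 0) (\<lambda>_::real \<times> real \<times> real. 0) (\<lambda>_ _. 0) (\<lambda>_ _. 0) (\<lambda>_ _. 0) (\<lambda>_ _. 0)"
      by (auto simp: drift_poisson_def has_dir_deriv_def)
    ultimately show ?thesis
      using key[of "(1, 0, 0)" "\<lambda>_. 0" "\<lambda>_ _. 0" "\<lambda>_ _. 0" "\<lambda>_ _. 0" "\<lambda>_ _. 0" 0 0] by simp
  qed
  show ?thesis
  proof (rule that[of "1 - c * v / M1" "C1 / (c * v)"])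
    show "0 \<le> 1 - c * v / M1" "1 - c * v / M1 < 1" using cM cv by (auto simp: divide_le_eq)
    show "0 \<le> C1 / (c * v)" using cv by (simp add: C1_def)
  qed (use key in blast)
qed

section \<open>The bound for periodic decaying solutions\<close>

lemma Basis_R3: "(Basis :: (real \<times> real \<times> real) set) = {(1, 0, 0), (0, 1, 0), (0, 0, 1)}"
  by (auto simp: Basis_prod_def zero_prod_def)

lemma has_dir_deriv_periodic:
  assumes "has_dir_deriv b f f'" "\<And>z. f (z + c) = f z"
  shows "f' (z + c) = f' z"
proof -
  have "has_dir_deriv b (\<lambda>z. f (c + z)) (\<lambda>z. f' (c + z))"
    by (rule has_dir_deriv_translate[OF assms(1)])
  then have "((\<lambda>h. f ((z + h *\<^sub>R b) + c)) has_real_derivative f' (z + c)) (at 0)"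
    unfolding has_dir_deriv_def add.commute[of c] by blast
  moreover have "((\<lambda>h. f (z + h *\<^sub>R b)) has_real_derivative f' z) (at 0)"
    using assms(1) unfolding has_dir_deriv_def by blast
  ultimately show ?thesis unfolding assms(2) by (rule DERIV_unique)
qed

lemma has_dir_deriv_slice:
  assumes "has_dir_deriv (0, b) g g'"
  shows "has_dir_deriv b (\<lambda>z. g (s, z)) (\<lambda>z. g' (s, z))"
  unfolding has_dir_deriv_def
proof
  fix z
  have "((\<lambda>h. g ((s, z) + h *\<^sub>R (0, b))) has_real_derivative g' (s, z)) (at 0)"
    using assms unfolding has_dir_deriv_def by blast
  then show "((\<lambda>h. g (s, z + h *\<^sub>R b)) has_real_derivative g' (s, z)) (at 0)" by simp
qed

lemma integral_dir_deriv_line: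
  assumes "has_dir_deriv b G g" "\<And>z. G (z + (2 * pi) *\<^sub>R b) = G z"
  shows "integral {a..a + 2 * pi} (\<lambda>h. g (z + h *\<^sub>R b)) = 0"
proof -
  have "((\<lambda>h. g (z + h *\<^sub>R b)) has_integral (G (z + (a + 2 * pi) *\<^sub>R b) - G (z + a *\<^sub>R b))) {a..a + 2 * pi}"
    using has_dir_deriv_along_line[OF assms(1)]
    by (intro fundamental_theorem_of_calculus)
      (auto simp: has_real_derivative_iff_has_vector_derivative[symmetric] intro: DERIV_subset)
  moreover have "z + (a + 2 * pi) *\<^sub>R b = (z + a *\<^sub>R b) + (2 * pi) *\<^sub>R b" by (simp add: algebra_simps)
  ultimately show ?thesis using assms(2) by (simp add: integral_unique)
qed

lemma integral_dir_deriv_cell: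
  fixes G g :: "real \<times> real \<Rightarrow> real"
  assumes "b \<in> Basis" "has_dir_deriv b G g" "\<And>z. G (z + (2 * pi) *\<^sub>R b) = G z" "continuous_on UNIV g"
  shows "integral (cbox (c, d) (c + 2 * pi, d + 2 * pi)) g = 0"
proof -
  have cg: "continuous_on A g" for A using assms(4) continuous_on_subset by blast
  have 1: "integral (cbox (c, d) (c + 2 * pi, d + 2 * pi)) g =
      integral (cbox c (c + 2 * pi)) (\<lambda>x. integral (cbox d (d + 2 * pi)) (\<lambda>y. g (x, y)))"
    by (rule integral_prod_continuous[OF cg])
  have "b = (1, 0) \<or> b = (0, 1)" using assms(1) by (auto simp: Basis_prod_def)
  then show ?thesis
  proof
    assume b: "b = (0, 1)"
    have "integral {d..d + 2 * pi} (\<lambda>y. g (x, y)) = 0" for x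
      using integral_dir_deriv_line[OF assms(2,3), of d "(x, 0)"] by (simp add: b)
    then show ?thesis unfolding 1 by simp
  next
    assume b: "b = (1, 0)"
    have "integral {c..c + 2 * pi} (\<lambda>x. g (x, y)) = 0" for y
      using integral_dir_deriv_line[OF assms(2,3), of c "(0, y)"] by (simp add: b)
    moreover have "integral (cbox c (c + 2 * pi)) (\<lambda>x. integral (cbox d (d + 2 * pi)) (\<lambda>y. g (x, y)))
        = integral (cbox d (d + 2 * pi)) (\<lambda>y. integral (cbox c (c + 2 * pi)) (\<lambda>x. g (x, y)))"
      by (rule integral_swap_continuous) (simp add: cg)
    ultimately show ?thesis unfolding 1 by simp
  qed
qed

definition torus_periodic :: "(real \<times> real \<times> real \<Rightarrow> real) \<Rightarrow> bool"
  where "torus_periodic g \<longleftrightarrow> (\<forall>b\<in>Basis. \<forall>z. g (z + (0, (2 * pi) *\<^sub>R b)) = g z)"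

lemma integral_dir_deriv_cell_box:
  fixes G g :: "real \<times> real \<times> real \<Rightarrow> real"
  assumes "b \<in> Basis" "has_dir_deriv (0, b) G g" "torus_periodic G" "continuous_on UNIV g"
  shows "integral cell_box (\<lambda>z. g (c + z)) = 0"
proof -
  have cg: "continuous_on A (\<lambda>z. g (h z))" if "continuous_on A h" for A and h :: "'c::topological_space \<Rightarrow> _"
    using continuous_on_compose2[OF assms(4) that] by simp
  have "integral (cbox (-pi, -pi) (pi, pi)) (\<lambda>z. g (c + (s, z))) = 0" for s
  proof -
    have "has_dir_deriv b (\<lambda>z. G (c + (s, z))) (\<lambda>z. g (c + (s, z)))"
      by (rule has_dir_deriv_slice[OF has_dir_deriv_translate[OF assms(2)]])
    moreover have "G (c + (s, z + (2 * pi) *\<^sub>R b)) = G (c + (s, z))" for z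
    proof -
      have "G ((c + (s, z)) + (0, (2 * pi) *\<^sub>R b)) = G (c + (s, z))"
        using assms(1,3) unfolding torus_periodic_def by blast
      then show ?thesis by (simp add: add.assoc)
    qed
    ultimately show ?thesis
      using integral_dir_deriv_cell[OF assms(1), of _ _ "-pi" "-pi"]
      by (simp add: cg continuous_intros)
  qed
  moreover have "integral cell_box (\<lambda>z. g (c + z)) =
      integral (cbox (-1) 1) (\<lambda>s. integral (cbox (-pi, -pi) (pi, pi)) (\<lambda>z. g (c + (s, z))))"
    unfolding cell_box_def by (rule integral_prod_continuous) (intro cg continuous_intros)
  ultimately show ?thesis by simp
qed

text \<open>The derivative of the left side in \<open>h\<close> is the integral of a derivative over a full period.\<close>

lemma integral_cell_box_shift:
  assumes "b \<in> Basis" "has_dir_deriv (0, b) g g'" "torus_periodic g"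
    "continuous_on UNIV g" "continuous_on UNIV g'"
  shows "integral cell_box (\<lambda>z. g ((c + (0, h *\<^sub>R b)) + z)) = integral cell_box (\<lambda>z. g (c + z))"
proof -
  define I where "I h = integral cell_box (\<lambda>z. g (c + (z + h *\<^sub>R (0, b))))" for h
  have cc: "continuous_on UNIV (\<lambda>z. g (c + z))" "continuous_on UNIV (\<lambda>z. g' (c + z))"
    by (intro continuous_on_compose2[OF assms(4)] continuous_on_compose2[OF assms(5)] continuous_intros; simp)+
  have "(I has_real_derivative 0) (at x)" for x
  proof -
    have "(I has_real_derivative integral cell_box (\<lambda>z. g' (c + (z + x *\<^sub>R (0, b))))) (at x)"
      unfolding I_def[abs_def] cell_box_def
      by (rule has_derivative_integral_dir_deriv[OF has_dir_deriv_translate[OF assms(2)] cc])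
    also have "(\<lambda>z. g' (c + (z + x *\<^sub>R (0, b)))) = (\<lambda>z. g' ((c + x *\<^sub>R (0, b)) + z))"
      by (simp add: algebra_simps)
    also have "integral cell_box \<dots> = 0"
      by (rule integral_dir_deriv_cell_box[OF assms(1-3,5)])
    finally show ?thesis .
  qed
  then have "I h = I 0" by (intro DERIV_isconst_all) auto
  then show ?thesis by (simp add: I_def ac_simps flip: zero_prod_def)
qed


lemma integral_slice_deriv:
  fixes g g' :: "real \<times> real \<times> real \<Rightarrow> real"
  assumes "has_dir_deriv (1, 0, 0) g g'" "continuous_on UNIV g" "continuous_on UNIV g'"
  shows "((\<lambda>s. integral (cbox a b) (\<lambda>z. g (s, z))) has_real_derivative
    integral (cbox a b) (\<lambda>z. g' (s, z))) (at s)"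
proof (rule leibniz_rule_field_derivative[where U = UNIV and fx = "\<lambda>s z. g' (s, z)"])
  show "(\<lambda>z. g (s, z)) integrable_on cbox a b" for s
    by (intro integrable_continuous continuous_on_compose2[OF assms(2)] continuous_intros) auto
  show "continuous_on (UNIV \<times> cbox a b) (\<lambda>(s, z). g' (s, z))"
    using assms(3) continuous_on_subset by (auto simp: case_prod_unfold)
  show "((\<lambda>s. g (s, z)) has_real_derivative g' (s, z)) (at s within UNIV)" for s z
    using has_dir_deriv_along_line[OF assms(1), of "(0, z)" s]
    by (simp flip: zero_prod_def)
qed auto

abbreviation torus_cell :: "(real \<times> real) set"
  where "torus_cell \<equiv> cbox (0, 0) (2 * pi, 2 * pi)"

lemma torus_periodic_slice:
  assumes "torus_periodic g" "b \<in> Basis"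
  shows "g (s, z + (2 * pi) *\<^sub>R b) = g (s, z)"
proof -
  have "g ((s, z) + (0, (2 * pi) *\<^sub>R b)) = g (s, z)"
    using assms unfolding torus_periodic_def by blast
  then show ?thesis by simp
qed

lemma slice_integral_divergence:
  fixes G g :: "real \<times> real \<times> real \<Rightarrow> real"
  assumes "b \<in> Basis" "has_dir_deriv (0, b) G g" "torus_periodic G" "continuous_on UNIV g"
  shows "integral torus_cell (\<lambda>z. g (s, z)) = 0"
proof -
  have "continuous_on UNIV (\<lambda>z. g (s, z))"
    by (intro continuous_on_compose2[OF assms(4)] continuous_intros) auto
  then show ?thesis
    using integral_dir_deriv_cell[OF assms(1) has_dir_deriv_slice[OF assms(2)], of s 0 0]
      torus_periodic_slice[OF assms(3,1)] by simp
qed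

lemma torus_periodic_deriv:
  "has_dir_deriv b f f' \<Longrightarrow> torus_periodic f \<Longrightarrow> torus_periodic f'"
  unfolding torus_periodic_def using has_dir_deriv_periodic by blast

text \<open>Integrating the equation over the slice removes the divergence in \<open>x\<close> and \<open>y\<close>, so
  \<open>E = U' - U - F\<close> is constant, where \<open>U\<close> and \<open>F\<close> are the slice integrals of \<open>u\<close> and of the
  \<open>s\<close>-component of \<open>f\<close>. For large \<open>s\<close> the term \<open>F\<close> is zero, so \<open>exp (-s) (U + E)\<close> is constant there; its
  limit is \<open>0\<close>, hence \<open>U = - E\<close>, and \<open>U \<rightarrow> 0\<close> gives \<open>E = 0\<close>. Then \<open>exp (-s) (U - K)\<close> is nondecreasing
  and \<open>exp (-s) (U + K)\<close> is nonincreasing if \<open>|F| \<le> K\<close>, and both tend to \<open>0\<close>.\<close>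

lemma slice_mean_bound:
  fixes u :: "real \<times> real \<times> real \<Rightarrow> real"
  assumes sol: "drift_poisson (1, 0, 0) u du ddu f df"
    and per: "torus_periodic u" "\<And>b. b \<in> Basis \<Longrightarrow> torus_periodic (f b)"
    and f: "\<And>b z. b \<in> Basis \<Longrightarrow> \<bar>f b z\<bar> \<le> \<epsilon>"
    and vanish: "\<And>s z. S \<le> s \<Longrightarrow> f (1, 0, 0) (s, z) = 0"
    and decay: "\<And>\<kappa>. 0 < \<kappa> \<Longrightarrow> \<exists>R. \<forall>s\<ge>R. \<forall>z. \<bar>u (s, z)\<bar> \<le> \<kappa>"
  shows "\<bar>integral torus_cell (\<lambda>z. u (s, z))\<bar> \<le> (2 * pi)\<^sup>2 * \<epsilon>"
proof -
  note D = sol[unfolded drift_poisson_def Basis_R3]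
  have deriv: "has_dir_deriv b u (du b)" "has_dir_deriv b (du b) (ddu b)" "has_dir_deriv b (f b) (df b)"
    "continuous_on UNIV (du b)" "continuous_on UNIV (ddu b)" "continuous_on UNIV (f b)" "continuous_on UNIV (df b)"
    if "b \<in> Basis" for b using sol that unfolding drift_poisson_def by auto
  have cu: "continuous_on UNIV u" using D by auto
  have e: "(1, 0, 0) \<in> (Basis :: (real \<times> real \<times> real) set)" "(0, 1, 0) \<in> (Basis :: (real \<times> real \<times> real) set)"
    "(0, 0, 1) \<in> (Basis :: (real \<times> real \<times> real) set)" "(1, 0) \<in> (Basis :: (real \<times> real) set)"
    "(0, 1) \<in> (Basis :: (real \<times> real) set)"
    by (auto simp: Basis_R3 Basis_prod_def)
  note d0 = deriv[OF e(1)] and d1 = deriv[OF e(2)] and d2 = deriv[OF e(3)]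
  have slice: "continuous_on A (\<lambda>z. g (s, z))" if "continuous_on UNIV g" for A s and g :: "real \<times> real \<times> real \<Rightarrow> real"
    by (intro continuous_on_compose2[OF that] continuous_intros) auto
  have int: "(\<lambda>z. g (s, z)) integrable_on torus_cell" if "continuous_on UNIV g" for s and g :: "real \<times> real \<times> real \<Rightarrow> real"
    by (intro integrable_continuous slice that)
  define U where "U s = integral torus_cell (\<lambda>z. u (s, z))" for s
  define F where "F s = integral torus_cell (\<lambda>z. f (1, 0, 0) (s, z))" for s
  define E where "E s = integral torus_cell (\<lambda>z. du (1, 0, 0) (s, z) - u (s, z) - f (1, 0, 0) (s, z))" for s
  have dU: "(U has_real_derivative integral torus_cell (\<lambda>z. du (1, 0, 0) (s, z))) (at s)" for s
    unfolding U_def[abs_def] by (rule integral_slice_deriv[OF d0(1) cu d0(4)])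
  have E: "E s = integral torus_cell (\<lambda>z. du (1, 0, 0) (s, z)) - U s - F s" for s
    unfolding E_def U_def F_def using int d0 cu
    by (subst integral_diff integral_diff; (intro integrable_diff int)?; simp)+
  have "(E has_real_derivative 0) (at s)" for s
  proof -
    have "(E has_real_derivative integral torus_cell
        (\<lambda>z. ddu (1, 0, 0) (s, z) - du (1, 0, 0) (s, z) - df (1, 0, 0) (s, z))) (at s)"
      unfolding E_def[abs_def] using d0 cu
      by (intro integral_slice_deriv has_dir_deriv_diff continuous_on_diff) auto
    also have "(\<lambda>z. ddu (1, 0, 0) (s, z) - du (1, 0, 0) (s, z) - df (1, 0, 0) (s, z)) =
        (\<lambda>z. (df (0, 1, 0) (s, z) - ddu (0, 1, 0) (s, z)) + (df (0, 0, 1) (s, z) - ddu (0, 0, 1) (s, z)))"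
    proof
      fix z
      have "(\<Sum>b\<in>Basis. ddu b (s, z)) - du (1, 0, 0) (s, z) = (\<Sum>b\<in>Basis. df b (s, z))"
        using sol unfolding drift_poisson_def by blast
      then show "ddu (1, 0, 0) (s, z) - du (1, 0, 0) (s, z) - df (1, 0, 0) (s, z) =
        (df (0, 1, 0) (s, z) - ddu (0, 1, 0) (s, z)) + (df (0, 0, 1) (s, z) - ddu (0, 0, 1) (s, z))"
        by (simp add: Basis_R3)
    qed
    also have "integral torus_cell \<dots> = integral torus_cell (\<lambda>z. df (0, 1, 0) (s, z) - ddu (0, 1, 0) (s, z))
        + integral torus_cell (\<lambda>z. df (0, 0, 1) (s, z) - ddu (0, 0, 1) (s, z))"
      using d1 d2 by (intro integral_add integrable_diff int)
    also have "integral torus_cell (\<lambda>z. df (0, 1, 0) (s, z) - ddu (0, 1, 0) (s, z)) =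
        integral torus_cell (\<lambda>z. df (0, 1, 0) (s, z)) - integral torus_cell (\<lambda>z. ddu (0, 1, 0) (s, z))"
      using d1 by (intro integral_diff int)
    also have "integral torus_cell (\<lambda>z. df (0, 0, 1) (s, z) - ddu (0, 0, 1) (s, z)) =
        integral torus_cell (\<lambda>z. df (0, 0, 1) (s, z)) - integral torus_cell (\<lambda>z. ddu (0, 0, 1) (s, z))"
      using d2 by (intro integral_diff int)
    also have "integral torus_cell (\<lambda>z. df (0, 1, 0) (s, z)) = 0"
      by (rule slice_integral_divergence[OF e(4) d1(3) per(2)[OF e(2)] d1(7)])
    also have "integral torus_cell (\<lambda>z. ddu (0, 1, 0) (s, z)) = 0"
      by (rule slice_integral_divergence[OF e(4) d1(2) torus_periodic_deriv[OF d1(1) per(1)] d1(5)])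
    also have "integral torus_cell (\<lambda>z. df (0, 0, 1) (s, z)) = 0"
      by (rule slice_integral_divergence[OF e(5) d2(3) per(2)[OF e(3)] d2(7)])
    also have "integral torus_cell (\<lambda>z. ddu (0, 0, 1) (s, z)) = 0"
      by (rule slice_integral_divergence[OF e(5) d2(2) torus_periodic_deriv[OF d2(1) per(1)] d2(5)])
    finally show ?thesis by simp
  qed
  then have Ec: "E s = E 0" for s by (intro DERIV_isconst_all) auto
  define c where "c = E 0"
  have ode: "(U has_real_derivative U s + F s + c) (at s)" for s
    using dU[of s] E[of s] Ec[of s] by (simp add: c_def)
  have area: "integral torus_cell (\<lambda>_. k) = (2 * pi)\<^sup>2 * k" for k :: real
    by (simp add: content_Pair power2_eq_square)
  have abs_le: "\<bar>integral torus_cell (\<lambda>z. g (s, z))\<bar> \<le> (2 * pi)\<^sup>2 * k"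
    if "continuous_on UNIV g" "\<And>z. \<bar>g (s, z)\<bar> \<le> k" for g :: "real \<times> real \<times> real \<Rightarrow> real" and s k
  proof -
    have "norm (integral torus_cell (\<lambda>z. g (s, z))) \<le> integral torus_cell (\<lambda>_. k)"
      using that(2) by (intro integral_norm_bound_integral int[OF that(1)]) auto
    then show ?thesis unfolding area by simp
  qed
  have F_le: "\<bar>F s\<bar> \<le> (2 * pi)\<^sup>2 * \<epsilon>" for s
    unfolding F_def using f[OF e(1)] d0 by (intro abs_le) auto
  have F0: "F s = 0" if "S \<le> s" for s using vanish[OF that] by (simp add: F_def)
  have U0: "(U \<longlongrightarrow> 0) at_top"
  proof (rule tendstoI)
    fix \<kappa> :: real assume \<kappa>: "0 < \<kappa>"
    then obtain R where R: "\<forall>s\<ge>R. \<forall>z. \<bar>u (s, z)\<bar> \<le> \<kappa> / (2 * (2 * pi)\<^sup>2)"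
      using decay[of "\<kappa> / (2 * (2 * pi)\<^sup>2)"] by auto
    have "\<bar>U s\<bar> < \<kappa>" if "R \<le> s" for s
    proof -
      have "\<bar>U s\<bar> \<le> (2 * pi)\<^sup>2 * (\<kappa> / (2 * (2 * pi)\<^sup>2))"
        unfolding U_def using R that cu by (intro abs_le) auto
      also have "\<dots> = \<kappa> / 2" by simp
      finally show ?thesis using \<kappa> by simp
    qed
    then show "\<forall>\<^sub>F s in at_top. dist (U s) 0 < \<kappa>"
      unfolding eventually_at_top_linorder by (intro exI[of _ R]) (auto simp: dist_real_def)
  qed
  define W where "W k s = exp (- s) * (U s + k)" for k s
  have dW: "(W k has_real_derivative exp (- s) * (F s + c - k)) (at s)" for k s
    unfolding W_def[abs_def]
    by (rule derivative_eq_intros ode refl | simp add: algebra_simps)+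
  have W0: "(W k \<longlongrightarrow> 0) at_top" for k
  proof -
    have "((\<lambda>s::real. exp (- s)) \<longlongrightarrow> 0) at_top"
      by (rule filterlim_compose[OF exp_at_bot filterlim_uminus_at_bot_at_top])
    then have "(W k \<longlongrightarrow> 0 * (0 + k)) at_top"
      unfolding W_def[abs_def] by (intro tendsto_intros U0)
    then show ?thesis by simp
  qed
  have "c = 0"
  proof -
    have const: "W c s = W c S" if "S \<le> s" for s
    proof (rule DERIV_isconst2[of S "s + 1"])
      show "continuous_on {S..s + 1} (W c)"
        using dW by (intro DERIV_continuous_on) (auto intro: DERIV_subset)
      show "(W c has_real_derivative 0) (at x)" if "S < x" "x < s + 1" for x
        using dW[of c x] F0[of x] that by simp
    qed (use that in auto)
    have "W c S = 0"
    proof (rule tendsto_unique[OF _ _ W0[of c]])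
      have "((\<lambda>_. W c S) \<longlongrightarrow> W c S) at_top" by simp
      then show "(W c \<longlongrightarrow> W c S) at_top"
        by (rule Lim_transform_eventually)
          (rule eventually_mono[OF eventually_ge_at_top[of S]], rule const[symmetric])
    qed simp
    have "U s = - c" if "S \<le> s" for s
    proof -
      have "exp (- s) * (U s + c) = 0"
        using const[OF that] \<open>W c S = 0\<close> by (simp only: W_def)
      then show ?thesis by simp
    qed
    then have "((\<lambda>_. - c) \<longlongrightarrow> 0) (at_top :: real filter)"
      by (intro Lim_transform_eventually[OF U0] eventually_mono[OF eventually_ge_at_top[of S]])
    then show "c = 0" by (simp add: tendsto_const_iff)
  qed
  define K where "K = (2 * pi)\<^sup>2 * \<epsilon>"
  have "W (- K) s \<le> 0"
  proof (rule tendsto_lowerbound[OF W0])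
    show "\<forall>\<^sub>F t in at_top. W (- K) s \<le> W (- K) t"
      using eventually_ge_at_top[of s]
    proof eventually_elim
      case (elim t)
      show ?case
      proof (rule DERIV_nonneg_imp_nondecreasing[OF elim])
        fix x show "\<exists>y. (W (- K) has_real_derivative y) (at x) \<and> 0 \<le> y"
          using dW[of "- K" x] F_le[of x] \<open>c = 0\<close>
          by (intro exI conjI) (auto simp: K_def intro!: mult_nonneg_nonneg)
      qed
    qed
  qed simp
  moreover have "0 \<le> W K s"
  proof (rule tendsto_upperbound[OF W0])
    show "\<forall>\<^sub>F t in at_top. W K t \<le> W K s"
      using eventually_ge_at_top[of s]
    proof eventually_elim
      case (elim t)
      show ?case
      proof (rule DERIV_nonpos_imp_nonincreasing[OF elim])
        fix x show "\<exists>y. (W K has_real_derivative y) (at x) \<and> y \<le> 0"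
          using dW[of K x] F_le[of x] \<open>c = 0\<close>
          by (intro exI conjI) (auto simp: K_def intro!: mult_nonneg_nonpos)
      qed
    qed
  qed simp
  ultimately show ?thesis
    by (auto simp: W_def K_def U_def mult_le_0_iff zero_le_mult_iff abs_le_iff)
qed

lemma drift_poisson_shift_difference:
  assumes "drift_poisson e u du ddu f df"
  shows "drift_poisson e (\<lambda>z. u (a + z) - u (b + z)) (\<lambda>v z. du v (a + z) - du v (b + z))
    (\<lambda>v z. ddu v (a + z) - ddu v (b + z)) (\<lambda>v z. f v (a + z) - f v (b + z)) (\<lambda>v z. df v (a + z) - df v (b + z))"
proof -
  have c: "continuous_on UNIV (\<lambda>z. g (k + z))" if "continuous_on UNIV g" for g :: "'a \<Rightarrow> real" and k
    by (intro continuous_on_compose2[OF that] continuous_intros) auto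
  have eq: "(\<Sum>b\<in>Basis. ddu b z) - du e z = (\<Sum>b\<in>Basis. df b z)" for z
    using assms unfolding drift_poisson_def by blast
  show ?thesis
    unfolding drift_poisson_def
    using assms[unfolded drift_poisson_def] eq[of "a + _"] eq[of "b + _"]
    by (intro conjI ballI allI continuous_on_diff c has_dir_deriv_diff has_dir_deriv_translate)
      (auto simp: sum_subtractf algebra_simps)
qed

text \<open>The supremum of the oscillations is finite, because \<open>u\<close> is bounded, and the contraction bounds it by
  \<open>\<theta>\<close> times itself plus \<open>2 C \<epsilon>\<close>.\<close>

lemma slice_oscillation_bound:
  obtains C :: real where "0 \<le> C"
    "\<And>u du ddu f df \<epsilon> M s z z'. \<lbrakk>drift_poisson (1, 0, 0) u du ddu f df; torus_periodic u;
       \<And>b z. b \<in> Basis \<Longrightarrow> \<bar>f b z\<bar> \<le> \<epsilon>; \<And>z. \<bar>u z\<bar> \<le> M\<rbrakk> \<Longrightarrow> u (s, z) - u (s, z') \<le> C * \<epsilon>"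
proof -
  obtain \<theta> C :: real where \<theta>: "0 \<le> \<theta>" "\<theta> < 1" and C: "0 \<le> C" and contr:
    "\<And>e w dw ddw f df \<omega> \<epsilon>. \<lbrakk>drift_poisson e w dw ddw f df; e \<in> Basis; integral cell_box w = 0;
       \<And>z. \<bar>w z\<bar> \<le> \<omega>; \<And>b z. b \<in> Basis \<Longrightarrow> \<bar>f b z\<bar> \<le> \<epsilon>\<rbrakk> \<Longrightarrow> w 0 \<le> \<theta> * \<omega> + C * \<epsilon>"
    using oscillation_contraction by blast
  show ?thesis
  proof (rule that[of "2 * C / (1 - \<theta>)"])
    show "0 \<le> 2 * C / (1 - \<theta>)" using C \<theta> by simp
    show "u (s, z) - u (s, z') \<le> 2 * C / (1 - \<theta>) * \<epsilon>"
      if sol: "drift_poisson (1, 0, 0) u du ddu f df" and per: "torus_periodic u"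
        and f: "\<And>b z. b \<in> Basis \<Longrightarrow> \<bar>f b z\<bar> \<le> \<epsilon>" and M: "\<And>z. \<bar>u z\<bar> \<le> M"
      for u du ddu f df \<epsilon> M s z z'
    proof -
      define T where "T = range (\<lambda>(s, z, z'). u (s, z) - u (s, z'))"
      have bdd: "bdd_above T"
      proof (rule bdd_aboveI[of _ "2 * M"])
        fix x assume "x \<in> T"
        then obtain s z z' where "x = u (s, z) - u (s, z')" by (auto simp: T_def)
        then show "x \<le> 2 * M" using M[of "(s, z)"] M[of "(s, z')"] by linarith
      qed
      have mem: "u (s, z) - u (s, z') \<le> Sup T" for s z z'
        unfolding T_def by (rule cSup_upper[OF _ bdd[unfolded T_def]], rule image_eqI[of _ _ "(s, z, z')"]) auto
      have cu: "continuous_on UNIV u" "b \<in> Basis \<Longrightarrow> continuous_on UNIV (du b)"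
        "b \<in> Basis \<Longrightarrow> has_dir_deriv b u (du b)" for b
        using sol unfolding drift_poisson_def by auto
      have shift: "integral cell_box (\<lambda>v. u ((c + (0, h)) + v)) = integral cell_box (\<lambda>v. u (c + v))" for c h
      proof -
        obtain x y where h: "h = (x, y)" by (cases h)
        have e: "(0, 1, 0) \<in> (Basis :: (real \<times> real \<times> real) set)" "(0, 0, 1) \<in> (Basis :: (real \<times> real \<times> real) set)"
          "(1, 0) \<in> (Basis :: (real \<times> real) set)" "(0, 1) \<in> (Basis :: (real \<times> real) set)"
          by (auto simp: Basis_R3 Basis_prod_def)
        have "integral cell_box (\<lambda>v. u (((c + (0, x *\<^sub>R (1, 0))) + (0, y *\<^sub>R (0, 1))) + v)) = integral cell_box (\<lambda>v. u (c + v))"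
          using integral_cell_box_shift[OF e(4) cu(3)[OF e(2)] per cu(1) cu(2)[OF e(2)]]
            integral_cell_box_shift[OF e(3) cu(3)[OF e(1)] per cu(1) cu(2)[OF e(1)]] by simp
        then show ?thesis by (simp add: h add.assoc)
      qed
      have "u (s, z) - u (s, z') \<le> \<theta> * Sup T + C * (2 * \<epsilon>)" for s z z'
      proof -
        define w where "w v = u ((s, z) + v) - u ((s, z') + v)" for v
        have cs: "(\<lambda>v. u (c + v)) integrable_on cell_box" for c
          unfolding cell_box_def by (intro integrable_continuous continuous_on_compose2[OF cu(1)] continuous_intros) auto
        have "integral cell_box w = integral cell_box (\<lambda>v. u ((s, z) + v)) - integral cell_box (\<lambda>v. u ((s, z') + v))"
          unfolding w_def by (intro integral_diff cs)
        also have "\<dots> = 0" using shift[of "(s, z')" "z - z'"] by simp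
        finally have "integral cell_box w = 0" .
        moreover have "\<bar>w v\<bar> \<le> Sup T" for v
          using mem[of "s + fst v" "z + snd v" "z' + snd v"] mem[of "s + fst v" "z' + snd v" "z + snd v"]
          by (cases v) (auto simp: w_def abs_le_iff)
        moreover have "\<bar>f b ((s, z) + v) - f b ((s, z') + v)\<bar> \<le> 2 * \<epsilon>" if "b \<in> Basis" for b v
          using f[OF that, of "(s, z) + v"] f[OF that, of "(s, z') + v"] by linarith
        ultimately have "w 0 \<le> \<theta> * Sup T + C * (2 * \<epsilon>)"
          using drift_poisson_shift_difference[OF sol, of "(s, z)" "(s, z')"]
          by (intro contr[of "(1, 0, 0)"]) (auto simp: w_def[abs_def] Basis_R3)
        then show ?thesis by (simp add: w_def)
      qed
      then have "Sup T \<le> \<theta> * Sup T + C * (2 * \<epsilon>)"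
        by (intro cSup_least) (auto simp: T_def)
      then have "Sup T \<le> 2 * C / (1 - \<theta>) * \<epsilon>" using \<theta> by (simp add: field_simps)
      then show ?thesis using mem order_trans by blast
    qed
  qed
qed

text \<open>Averaging \<open>u(s, t) - u(s, v) \<le> C \<epsilon>\<close> over \<open>v\<close> compares \<open>u(s, t)\<close> with the mean over the slice.\<close>

lemma drift_poisson_sup_bound:
  obtains C :: real where "0 \<le> C"
    "\<And>u du ddu f df \<epsilon> M S z. \<lbrakk>drift_poisson (1, 0, 0) u du ddu f df; torus_periodic u;
       \<And>b. b \<in> Basis \<Longrightarrow> torus_periodic (f b); \<And>b z. b \<in> Basis \<Longrightarrow> \<bar>f b z\<bar> \<le> \<epsilon>; \<And>z. \<bar>u z\<bar> \<le> M;
       \<And>s z. S \<le> s \<Longrightarrow> f (1, 0, 0) (s, z) = 0;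
       \<And>\<kappa>. 0 < \<kappa> \<Longrightarrow> \<exists>R. \<forall>s\<ge>R. \<forall>z. \<bar>u (s, z)\<bar> \<le> \<kappa>\<rbrakk> \<Longrightarrow> \<bar>u z\<bar> \<le> C * \<epsilon>"
proof -
  obtain C where C: "0 \<le> C" and osc:
    "\<And>u du ddu f df \<epsilon> M s z z'. \<lbrakk>drift_poisson (1, 0, 0) u du ddu f df; torus_periodic u;
       \<And>b z. b \<in> Basis \<Longrightarrow> \<bar>f b z\<bar> \<le> \<epsilon>; \<And>z. \<bar>u z\<bar> \<le> M\<rbrakk> \<Longrightarrow> u (s, z) - u (s, z') \<le> C * \<epsilon>"
    using slice_oscillation_bound by blast
  show ?thesis
  proof (rule that[of "C + 1"])
    show "0 \<le> C + 1" using C by simp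
    show "\<bar>u z\<bar> \<le> (C + 1) * \<epsilon>"
      if sol: "drift_poisson (1, 0, 0) u du ddu f df" and per: "torus_periodic u"
        "\<And>b. b \<in> Basis \<Longrightarrow> torus_periodic (f b)" and f: "\<And>b z. b \<in> Basis \<Longrightarrow> \<bar>f b z\<bar> \<le> \<epsilon>"
        and M: "\<And>z. \<bar>u z\<bar> \<le> M" and vanish: "\<And>s z. S \<le> s \<Longrightarrow> f (1, 0, 0) (s, z) = 0"
        and decay: "\<And>\<kappa>. 0 < \<kappa> \<Longrightarrow> \<exists>R. \<forall>s\<ge>R. \<forall>z. \<bar>u (s, z)\<bar> \<le> \<kappa>"
      for u du ddu f df \<epsilon> M S z
    proof -
      obtain s t where z: "z = (s, t)" by (cases z)
      have mean: "\<bar>integral torus_cell (\<lambda>v. u (s, v))\<bar> \<le> (2 * pi)\<^sup>2 * \<epsilon>"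
        by (rule slice_mean_bound[OF sol per f vanish decay])
      have cu: "continuous_on UNIV u" using sol unfolding drift_poisson_def by auto
      have int: "(\<lambda>v. u (s, v)) integrable_on torus_cell"
        by (intro integrable_continuous continuous_on_compose2[OF cu] continuous_intros) auto
      have area: "integral torus_cell (\<lambda>_. k) = (2 * pi)\<^sup>2 * k" for k :: real
        by (simp add: content_Pair power2_eq_square)
      have "integral torus_cell (\<lambda>v. u (s, v)) \<le> integral torus_cell (\<lambda>_. u (s, t) + C * \<epsilon>)"
        using osc[OF sol per(1) f M, of s _ t] by (intro integral_le int) (auto simp: algebra_simps)
      moreover have "integral torus_cell (\<lambda>_. u (s, t) - C * \<epsilon>) \<le> integral torus_cell (\<lambda>v. u (s, v))"
        using osc[OF sol per(1) f M, of s t] by (intro integral_le int) (auto simp: algebra_simps)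
      ultimately have "(2 * pi)\<^sup>2 * (u (s, t) - C * \<epsilon>) \<le> (2 * pi)\<^sup>2 * \<epsilon>"
        "(2 * pi)\<^sup>2 * (- \<epsilon>) \<le> (2 * pi)\<^sup>2 * (u (s, t) + C * \<epsilon>)"
        using mean unfolding area abs_le_iff by linarith+
      then have "u (s, t) - C * \<epsilon> \<le> \<epsilon>" "- \<epsilon> \<le> u (s, t) + C * \<epsilon>"
        by (simp_all only: mult_le_cancel_left_pos zero_less_power mult_pos_pos pi_gt_zero zero_less_numeral)
      then show ?thesis by (auto simp: z algebra_simps abs_le_iff)
    qed
  qed
qed

section \<open>Calculus of smooth functions\<close>

lemma smooth_on_foldr_differentiable:
  assumes "smooth_on U f" "open U" "z \<in> U" "set vs \<subseteq> Basis"
  shows "foldr partial_deriv vs f differentiable (at z)"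
proof -
  have "foldr partial_deriv vs f differentiable_on U" using assms unfolding smooth_on_def by blast
  then show ?thesis using assms by (simp add: differentiable_on_eq_differentiable_at)
qed

lemma smooth_on_differentiable:
  assumes "smooth_on U f" "open U" "z \<in> U"
  shows "f differentiable (at z)"
  using smooth_on_foldr_differentiable[OF assms, of "[]"] by simp

lemma smooth_on_partial_deriv:
  assumes "smooth_on U f" "b \<in> Basis"
  shows "smooth_on U (partial_deriv b f)"
  unfolding smooth_on_def
proof (intro allI impI)
  fix vs :: "'a list" assume "set vs \<subseteq> Basis"
  then have "foldr partial_deriv (vs @ [b]) f differentiable_on U"
    using assms(2) by (intro assms(1)[unfolded smooth_on_def, rule_format]) simp
  then show "foldr partial_deriv vs (partial_deriv b f) differentiable_on U" by simp
qed

lemma partial_deriv_eqI: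
  assumes "(f has_derivative f') (at z)"
  shows "partial_deriv b f z = f' b"
  unfolding partial_deriv_def using frechet_derivative_at[OF assms] by simp

lemma has_derivative_eq_on_open:
  assumes "open U" "z \<in> U" "\<And>x. x \<in> U \<Longrightarrow> f x = g x" "g differentiable (at z)"
  shows "(f has_derivative frechet_derivative g (at z)) (at z)"
  using assms(4) by - (rule has_derivative_transform_within_open[OF _ assms(1,2)], auto simp: assms(3) frechet_derivative_works)

text \<open>Iterated partial derivatives commute with bounded linear maps. The hypothesis relates \<open>f\<close> and \<open>g\<close> only
  on an open set, so this also transfers derivatives from a local representative to a global function.\<close>

lemma smooth_on_linear_foldr:
  fixes f :: "'a::euclidean_space \<Rightarrow> 'b::real_normed_vector" and g :: "'a \<Rightarrow> 'c::real_normed_vector"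
  assumes "smooth_on U f" "open U" "bounded_linear L" "\<And>x. x \<in> U \<Longrightarrow> g x = L (f x)" "set vs \<subseteq> Basis" "z \<in> U"
  shows "foldr partial_deriv vs g z = L (foldr partial_deriv vs f z)"
  using assms(5,6)
proof (induction vs arbitrary: z)
  case Nil
  then show ?case using assms(4) by simp
next
  case (Cons v vs)
  have d: "(foldr partial_deriv vs f has_derivative frechet_derivative (foldr partial_deriv vs f) (at z)) (at z)"
    using smooth_on_foldr_differentiable[OF assms(1,2)] Cons.prems by (simp add: frechet_derivative_works)
  have "(foldr partial_deriv vs g has_derivative (\<lambda>h. L (frechet_derivative (foldr partial_deriv vs f) (at z) h))) (at z)"
    using bounded_linear.has_derivative[OF assms(3) d] Cons
    by - (rule has_derivative_transform_within_open[OF _ assms(2), of _ _ z], auto)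
  from partial_deriv_eqI[OF this, of v] partial_deriv_eqI[OF d, of v] show ?case by simp
qed

lemma smooth_on_linear:
  fixes f :: "'a::euclidean_space \<Rightarrow> 'b::real_normed_vector" and g :: "'a \<Rightarrow> 'c::real_normed_vector"
  assumes "smooth_on U f" "open U" "bounded_linear L" "\<And>x. x \<in> U \<Longrightarrow> g x = L (f x)"
  shows "smooth_on U g"
  unfolding smooth_on_def differentiable_on_def
proof (intro allI impI ballI)
  fix vs :: "'a list" and z assume vs: "set vs \<subseteq> Basis" and z: "z \<in> U"
  have d: "(foldr partial_deriv vs f has_derivative frechet_derivative (foldr partial_deriv vs f) (at z)) (at z)"
    using smooth_on_foldr_differentiable[OF assms(1,2) z vs] by (simp add: frechet_derivative_works)
  have "(foldr partial_deriv vs g has_derivative (\<lambda>h. L (frechet_derivative (foldr partial_deriv vs f) (at z) h))) (at z)"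
    using bounded_linear.has_derivative[OF assms(3) d] smooth_on_linear_foldr[OF assms vs] z
    by - (rule has_derivative_transform_within_open[OF _ assms(2), of _ _ z], auto)
  then show "foldr partial_deriv vs g differentiable (at z within U)"
    unfolding differentiable_def using has_derivative_at_withinI by blast
qed

lemma smooth_on_cong:
  assumes "smooth_on U f" "open U" "\<And>x. x \<in> U \<Longrightarrow> g x = f x"
  shows "smooth_on U g"
  using smooth_on_linear[OF assms(1,2) bounded_linear_ident assms(3)] by simp

lemma smooth_on_add:
  assumes f: "smooth_on U f" and g: "smooth_on U g" and U: "open U"
  shows "smooth_on U (\<lambda>x. f x + g x)"
proof -
  have eq: "foldr partial_deriv vs (\<lambda>x. f x + g x) z = foldr partial_deriv vs f z + foldr partial_deriv vs g z"
    if "set vs \<subseteq> Basis" "z \<in> U" for vs z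
    using that
  proof (induction vs arbitrary: z)
    case (Cons v vs)
    have "(foldr partial_deriv vs (\<lambda>x. f x + g x) has_derivative
        (\<lambda>h. frechet_derivative (foldr partial_deriv vs f) (at z) h + frechet_derivative (foldr partial_deriv vs g) (at z) h)) (at z)"
      using smooth_on_foldr_differentiable[OF f U] smooth_on_foldr_differentiable[OF g U] Cons
      by - (rule has_derivative_transform_within_open[OF has_derivative_add U, of _ _ z], auto simp: frechet_derivative_works)
    from partial_deriv_eqI[OF this, of v] show ?case
      by (simp add: partial_deriv_def[of v "foldr partial_deriv vs f" z]
          partial_deriv_def[of v "foldr partial_deriv vs g" z])
  qed simp
  show ?thesis
    unfolding smooth_on_def differentiable_on_def
  proof (intro allI impI ballI)
    fix vs :: "'a list" and z assume vs: "set vs \<subseteq> Basis" and z: "z \<in> U"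
    have "(foldr partial_deriv vs (\<lambda>x. f x + g x) has_derivative
        (\<lambda>h. frechet_derivative (foldr partial_deriv vs f) (at z) h + frechet_derivative (foldr partial_deriv vs g) (at z) h)) (at z)"
      using smooth_on_foldr_differentiable[OF f U z vs] smooth_on_foldr_differentiable[OF g U z vs] z eq[OF vs]
      by - (rule has_derivative_transform_within_open[OF has_derivative_add U, of _ _ z], auto simp: frechet_derivative_works)
    then show "foldr partial_deriv vs (\<lambda>x. f x + g x) differentiable (at z within U)"
      unfolding differentiable_def using has_derivative_at_withinI by blast
  qed
qed

lemma smooth_on_uminus:
  assumes "smooth_on U f" "open U"
  shows "smooth_on U (\<lambda>x. - f x)"
  by (rule smooth_on_linear[OF assms bounded_linear_minus[OF bounded_linear_ident]]) simp

lemma smooth_on_diff: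
  assumes "smooth_on U f" "smooth_on U g" "open U"
  shows "smooth_on U (\<lambda>x. f x - g x)"
  using smooth_on_add[OF assms(1) smooth_on_uminus[OF assms(2,3)] assms(3)] by simp

lemma smooth_on_UNIV_if_locally:
  assumes "\<And>z. \<exists>U. open U \<and> z \<in> U \<and> smooth_on U f"
  shows "smooth_on UNIV f"
  unfolding smooth_on_def differentiable_on_def
proof (intro allI impI ballI)
  fix vs :: "'a list" and z assume vs: "set vs \<subseteq> Basis"
  obtain U where "open U" "z \<in> U" "smooth_on U f" using assms by blast
  then show "foldr partial_deriv vs f differentiable at z within UNIV"
    using smooth_on_foldr_differentiable[OF _ _ _ vs] by blast
qed

lemma partial_deriv_add:
  assumes "f differentiable (at z)" "g differentiable (at z)"
  shows "partial_deriv b (\<lambda>x. f x + g x) z = partial_deriv b f z + partial_deriv b g z"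
  using assms by (intro trans[OF partial_deriv_eqI[OF has_derivative_add]])
    (auto simp: frechet_derivative_works partial_deriv_def)

lemma partial_deriv_uminus:
  assumes "f differentiable (at z)"
  shows "partial_deriv b (\<lambda>x. - f x) z = - partial_deriv b f z"
  using assms by (intro trans[OF partial_deriv_eqI[OF has_derivative_minus]])
    (auto simp: frechet_derivative_works partial_deriv_def)

lemma partial_deriv_diff:
  assumes "f differentiable (at z)" "g differentiable (at z)"
  shows "partial_deriv b (\<lambda>x. f x - g x) z = partial_deriv b f z - partial_deriv b g z"
  using assms by (intro trans[OF partial_deriv_eqI[OF has_derivative_diff]])
    (auto simp: frechet_derivative_works partial_deriv_def)

lemma partial_deriv_cong:
  assumes "open U" "z \<in> U" "\<And>x. x \<in> U \<Longrightarrow> f x = g x" "g differentiable (at z)"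
  shows "partial_deriv b f z = partial_deriv b g z"
  using partial_deriv_eqI[OF has_derivative_eq_on_open[OF assms]] by (simp add: partial_deriv_def)

lemma partial_deriv_line:
  fixes f :: "'a::euclidean_space \<Rightarrow> real"
  assumes "f differentiable (at (z + x *\<^sub>R b))"
  shows "((\<lambda>h. f (z + h *\<^sub>R b)) has_real_derivative partial_deriv b f (z + x *\<^sub>R b)) (at x)"
proof -
  let ?D = "frechet_derivative f (at (z + x *\<^sub>R b))"
  have D: "(f has_derivative ?D) (at (z + x *\<^sub>R b))"
    using assms by (simp add: frechet_derivative_works)
  have "((\<lambda>h. z + h *\<^sub>R b) has_derivative (\<lambda>h. h *\<^sub>R b)) (at x)"
    by (auto intro!: derivative_eq_intros)
  from has_derivative_compose[OF this D]
  have "((\<lambda>h. f (z + h *\<^sub>R b)) has_derivative (\<lambda>h. ?D (h *\<^sub>R b))) (at x)" .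
  moreover have "?D (h *\<^sub>R b) = ?D b * h" for h
    using linear_scale[OF has_derivative_linear[OF D], of h b] by simp
  ultimately show ?thesis by (simp add: has_field_derivative_def partial_deriv_def)
qed

lemma smooth_on_UNIV_dir_deriv:
  fixes f :: "'a::euclidean_space \<Rightarrow> real"
  assumes "smooth_on UNIV f"
  shows "has_dir_deriv b f (partial_deriv b f)" "continuous_on UNIV f"
proof -
  have d: "f differentiable (at z)" for z using smooth_on_differentiable[OF assms] by simp
  show "has_dir_deriv b f (partial_deriv b f)"
    unfolding has_dir_deriv_def using partial_deriv_line[of f _ 0 b] d by auto
  show "continuous_on UNIV f"
    using d by (simp add: continuous_at_imp_continuous_on differentiable_imp_continuous_within)
qed

text \<open>Two applications of the mean value theorem, first in the direction \<open>b\<close>, then in the direction \<open>c\<close>.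
  The second difference is symmetric in \<open>b\<close> and \<open>c\<close>, which gives the symmetry of mixed derivatives.\<close>

lemma second_difference_mean_value:
  fixes f :: "'a::euclidean_space \<Rightarrow> real"
  assumes f: "smooth_on (ball z r) f" and bc: "b \<in> Basis" "c \<in> Basis" and t: "0 < t" "2 * t < r"
  shows "\<exists>p. dist z p \<le> 2 * t \<and>
    f (z + t *\<^sub>R b + t *\<^sub>R c) - f (z + t *\<^sub>R b) - f (z + t *\<^sub>R c) + f z = t\<^sup>2 * partial_deriv c (partial_deriv b f) p"
proof -
  have near: "dist z (z + x *\<^sub>R b + y *\<^sub>R c) \<le> 2 * t" if "0 \<le> x" "x \<le> t" "0 \<le> y" "y \<le> t" for x y
  proof -
    have "norm (x *\<^sub>R b + y *\<^sub>R c) \<le> norm (x *\<^sub>R b) + norm (y *\<^sub>R c)" by (rule norm_triangle_ineq)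
    also have "\<dots> \<le> 2 * t" using that bc by simp
    finally have "norm (x *\<^sub>R b + y *\<^sub>R c) \<le> 2 * t" .
    moreover have "dist z (z + v) = norm v" for v by (simp add: dist_norm)
    ultimately show ?thesis by (simp only: add.assoc)
  qed
  have mem: "z + x *\<^sub>R b + y *\<^sub>R c \<in> ball z r" if "0 \<le> x" "x \<le> t" "0 \<le> y" "y \<le> t" for x y
    using near[OF that] t by simp
  note df = smooth_on_differentiable[OF f open_ball]
  note dbf = smooth_on_differentiable[OF smooth_on_partial_deriv[OF f bc(1)] open_ball]
  have "\<exists>\<xi>>0. \<xi> < t \<and> (f (z + t *\<^sub>R b + t *\<^sub>R c) - f (z + t *\<^sub>R b)) - (f (z + 0 *\<^sub>R b + t *\<^sub>R c) - f (z + 0 *\<^sub>R b)) =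
      (t - 0) * (partial_deriv b f (z + \<xi> *\<^sub>R b + t *\<^sub>R c) - partial_deriv b f (z + \<xi> *\<^sub>R b))"
  proof (rule MVT2[OF t(1)])
    fix x assume x: "0 \<le> x" "x \<le> t"
    have 1: "((\<lambda>h. f (z + t *\<^sub>R c + h *\<^sub>R b)) has_real_derivative partial_deriv b f (z + t *\<^sub>R c + x *\<^sub>R b)) (at x)"
      using mem[of x t] x t by (intro partial_deriv_line df) (simp add: ac_simps)
    have 2: "((\<lambda>h. f (z + h *\<^sub>R b)) has_real_derivative partial_deriv b f (z + x *\<^sub>R b)) (at x)"
      using mem[of x 0] x t by (intro partial_deriv_line df) simp
    show "((\<lambda>x. f (z + x *\<^sub>R b + t *\<^sub>R c) - f (z + x *\<^sub>R b)) has_real_derivative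
        partial_deriv b f (z + x *\<^sub>R b + t *\<^sub>R c) - partial_deriv b f (z + x *\<^sub>R b)) (at x)"
      using DERIV_diff[OF 1 2] by (simp add: ac_simps)
  qed
  then obtain \<xi> where \<xi>: "0 < \<xi>" "\<xi> < t" and eq1: "(f (z + t *\<^sub>R b + t *\<^sub>R c) - f (z + t *\<^sub>R b)) - (f (z + t *\<^sub>R c) - f z) =
      t * (partial_deriv b f (z + \<xi> *\<^sub>R b + t *\<^sub>R c) - partial_deriv b f (z + \<xi> *\<^sub>R b))"
    by auto
  have "\<exists>\<zeta>>0. \<zeta> < t \<and> partial_deriv b f (z + \<xi> *\<^sub>R b + t *\<^sub>R c) - partial_deriv b f (z + \<xi> *\<^sub>R b + 0 *\<^sub>R c) =
      (t - 0) * partial_deriv c (partial_deriv b f) (z + \<xi> *\<^sub>R b + \<zeta> *\<^sub>R c)"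
    using mem \<xi> by (intro MVT2[OF t(1)] partial_deriv_line dbf) auto
  then obtain \<zeta> where \<zeta>: "0 < \<zeta>" "\<zeta> < t" and eq2: "partial_deriv b f (z + \<xi> *\<^sub>R b + t *\<^sub>R c) - partial_deriv b f (z + \<xi> *\<^sub>R b) =
      t * partial_deriv c (partial_deriv b f) (z + \<xi> *\<^sub>R b + \<zeta> *\<^sub>R c)"
    by auto
  show ?thesis
    using near[of \<xi> \<zeta>] \<xi> \<zeta> eq1[unfolded eq2]
    by (intro exI[of _ "z + \<xi> *\<^sub>R b + \<zeta> *\<^sub>R c"]) (simp add: power2_eq_square algebra_simps)
qed

lemma mixed_partial_derivs_commute:
  fixes f :: "'a::euclidean_space \<Rightarrow> real"
  assumes f: "smooth_on U f" and U: "open U" "z \<in> U" and bc: "b \<in> Basis" "c \<in> Basis"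
  shows "partial_deriv c (partial_deriv b f) z = partial_deriv b (partial_deriv c f) z"
proof -
  obtain r where r: "0 < r" "ball z r \<subseteq> U" using U open_contains_ball by blast
  have fr: "smooth_on (ball z r) f" using f r unfolding smooth_on_def by (meson differentiable_on_subset)
  define A B where "A = partial_deriv c (partial_deriv b f)" and "B = partial_deriv b (partial_deriv c f)"
  have "\<forall>n. \<exists>p q. dist z p \<le> 2 * (r / (3 * real (Suc n))) \<and> dist z q \<le> 2 * (r / (3 * real (Suc n))) \<and> A p = B q"
  proof
    fix n
    \<comment> \<open>The factor \<open>3\<close> keeps \<open>2 t < r\<close>.\<close>
    define t where "t = r / (3 * real (Suc n))"
    have t: "0 < t" "2 * t < r" using r by (auto simp: t_def field_simps add_pos_nonneg)
    obtain p where p: "dist z p \<le> 2 * t" "f (z + t *\<^sub>R b + t *\<^sub>R c) - f (z + t *\<^sub>R b) - f (z + t *\<^sub>R c) + f z = t\<^sup>2 * A p"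
      using second_difference_mean_value[OF fr bc t] by (auto simp: A_def)
    obtain q where q: "dist z q \<le> 2 * t" "f (z + t *\<^sub>R c + t *\<^sub>R b) - f (z + t *\<^sub>R c) - f (z + t *\<^sub>R b) + f z = t\<^sup>2 * B q"
      using second_difference_mean_value[OF fr bc(2,1) t] by (auto simp: B_def)
    have "z + t *\<^sub>R c + t *\<^sub>R b = z + t *\<^sub>R b + t *\<^sub>R c" by (simp add: ac_simps)
    with p(2) q(2) have "t\<^sup>2 * A p = t\<^sup>2 * B q" by (simp only:)
    then have "A p = B q" using t by simp
    with p q show "\<exists>p q. dist z p \<le> 2 * (r / (3 * real (Suc n))) \<and> dist z q \<le> 2 * (r / (3 * real (Suc n))) \<and> A p = B q"
      unfolding t_def by blast
  qed
  then obtain p q where pq: "\<And>n. dist z (p n) \<le> 2 * (r / (3 * real (Suc n)))"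
    "\<And>n. dist z (q n) \<le> 2 * (r / (3 * real (Suc n)))" "\<And>n. A (p n) = B (q n)"
    by metis
  have lim: "(\<lambda>n. 2 * (r / (3 * real (Suc n)))) \<longlonglongrightarrow> 0"
  proof -
    have "(\<lambda>n. (2 * r / 3) * inverse (real (Suc n))) \<longlonglongrightarrow> (2 * r / 3) * 0"
      by (intro tendsto_intros LIMSEQ_inverse_real_of_nat)
    then show ?thesis by (simp add: field_simps)
  qed
  have conv: "x \<longlonglongrightarrow> z" if "\<And>n. dist z (x n) \<le> 2 * (r / (3 * real (Suc n)))" for x
  proof (rule tendsto_dist_iff[THEN iffD2], rule Lim_null_comparison[OF _ lim], rule always_eventually, rule allI)
    show "norm (dist (x n) z) \<le> 2 * (r / (3 * real (Suc n)))" for n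
      using that[of n] by (simp only: dist_commute[of "x n"] real_norm_def abs_of_nonneg zero_le_dist)
  qed
  have pz: "p \<longlonglongrightarrow> z" and qz: "q \<longlonglongrightarrow> z" using conv pq(1,2) by blast+
  have cAB: "isCont A z" "isCont B z"
    unfolding A_def B_def
    by (rule differentiable_imp_continuous_within smooth_on_differentiable
        smooth_on_partial_deriv f bc U)+
  have "(\<lambda>n. A (p n)) \<longlonglongrightarrow> A z" "(\<lambda>n. B (q n)) \<longlonglongrightarrow> B z"
    by (rule isCont_tendsto_compose[OF cAB(1) pz], rule isCont_tendsto_compose[OF cAB(2) qz])
  then have "A z = B z" unfolding pq(3) by (rule LIMSEQ_unique)
  then show ?thesis by (simp add: A_def B_def)
qed

section \<open>From the Dirac-type system to the Poisson equation\<close>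

abbreviation "dir_s \<equiv> (1, 0, 0) :: real \<times> real \<times> real"
abbreviation "dir_x \<equiv> (0, 1, 0) :: real \<times> real \<times> real"
abbreviation "dir_y \<equiv> (0, 0, 1) :: real \<times> real \<times> real"

lemma dirs_Basis: "dir_s \<in> Basis" "dir_x \<in> Basis" "dir_y \<in> Basis"
  by (auto simp: Basis_R3)

text \<open>One fibre coordinate \<open>u\<close> in the system \<open>D Z = (0, p) + F\<close>: the four components of the equation that
  belong to one index \<open>j\<close> involve two base coordinates \<open>q1\<close>, \<open>q2\<close> and two fibre coordinates \<open>u\<close>, \<open>v\<close>, and
  the three used here yield a scalar equation for \<open>u\<close>.\<close>

definition dirac_system where
  "dirac_system U u q1 q2 v F0 F1 F2 \<longleftrightarrow> open U \<and>
     smooth_on U u \<and> smooth_on U q1 \<and> smooth_on U q2 \<and> smooth_on U v \<and>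
     (\<forall>z\<in>U.
       F0 z = partial_deriv dir_s u z + partial_deriv dir_x q1 z + partial_deriv dir_y q2 z - u z \<and>
       F1 z = partial_deriv dir_s q1 z - partial_deriv dir_x u z + partial_deriv dir_y v z \<and>
       F2 z = partial_deriv dir_s q2 z - partial_deriv dir_x v z - partial_deriv dir_y (u :: _ \<Rightarrow> real) z)"

text \<open>Taking \<open>\<partial>\<^sub>s\<close> of the first equation, minus \<open>\<partial>\<^sub>x\<close> of the second and minus \<open>\<partial>\<^sub>y\<close> of the third,
  the mixed second derivatives of \<open>q1\<close>, \<open>q2\<close> and \<open>v\<close> cancel.\<close>

lemma first_order_system_imp_poisson:
  fixes u q1 q2 v :: "real \<times> real \<times> real \<Rightarrow> real"
  assumes sys: "dirac_system U u q1 q2 v F0 F1 F2" and z: "z \<in> U"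
  shows "smooth_on U F0" "smooth_on U F1" "smooth_on U F2"
    "partial_deriv dir_s (partial_deriv dir_s u) z + partial_deriv dir_x (partial_deriv dir_x u) z
       + partial_deriv dir_y (partial_deriv dir_y u) z - partial_deriv dir_s u z =
     partial_deriv dir_s F0 z - partial_deriv dir_x F1 z - partial_deriv dir_y F2 z"
proof -
  have U: "open U" "z \<in> U"
    and smooth: "smooth_on U u" "smooth_on U q1" "smooth_on U q2" "smooth_on U v"
    using sys z unfolding dirac_system_def by auto
  have F: "F0 z = partial_deriv dir_s u z + partial_deriv dir_x q1 z + partial_deriv dir_y q2 z - u z"
      "F1 z = partial_deriv dir_s q1 z - partial_deriv dir_x u z + partial_deriv dir_y v z"
      "F2 z = partial_deriv dir_s q2 z - partial_deriv dir_x v z - partial_deriv dir_y u z" if "z \<in> U" for z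
    using sys that unfolding dirac_system_def by blast+
  note sp = smooth[THEN smooth_on_partial_deriv]
  note pd = sp[OF dirs_Basis(1)] sp[OF dirs_Basis(2)] sp[OF dirs_Basis(3)]
  note diff = smooth_on_differentiable[OF _ U]
  note d = smooth[THEN diff] pd[THEN diff]
  show "smooth_on U F0"
    by (rule smooth_on_cong[OF _ U(1) F(1)]) (intro smooth_on_add smooth_on_diff pd smooth U)
  show "smooth_on U F1"
    by (rule smooth_on_cong[OF _ U(1) F(2)]) (intro smooth_on_add smooth_on_diff pd smooth U)
  show "smooth_on U F2"
    by (rule smooth_on_cong[OF _ U(1) F(3)]) (intro smooth_on_add smooth_on_diff pd smooth U)
  have D0: "partial_deriv dir_s F0 z = partial_deriv dir_s (partial_deriv dir_s u) z
      + partial_deriv dir_s (partial_deriv dir_x q1) z + partial_deriv dir_s (partial_deriv dir_y q2) z - partial_deriv dir_s u z"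
    by (subst partial_deriv_cong[OF U F(1)]) (simp_all add: partial_deriv_add partial_deriv_diff d)
  have D1: "partial_deriv dir_x F1 z = partial_deriv dir_x (partial_deriv dir_s q1) z
      - partial_deriv dir_x (partial_deriv dir_x u) z + partial_deriv dir_x (partial_deriv dir_y v) z"
    by (subst partial_deriv_cong[OF U F(2)]) (simp_all add: partial_deriv_add partial_deriv_diff d)
  have D2: "partial_deriv dir_y F2 z = partial_deriv dir_y (partial_deriv dir_s q2) z
      - partial_deriv dir_y (partial_deriv dir_x v) z - partial_deriv dir_y (partial_deriv dir_y u) z"
    by (subst partial_deriv_cong[OF U F(3)]) (simp_all add: partial_deriv_add partial_deriv_diff d)
  show "partial_deriv dir_s (partial_deriv dir_s u) z + partial_deriv dir_x (partial_deriv dir_x u) z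
       + partial_deriv dir_y (partial_deriv dir_y u) z - partial_deriv dir_s u z =
     partial_deriv dir_s F0 z - partial_deriv dir_x F1 z - partial_deriv dir_y F2 z"
    unfolding D0 D1 D2
    using mixed_partial_derivs_commute[OF smooth(2) U dirs_Basis(1,2)]
      mixed_partial_derivs_commute[OF smooth(3) U dirs_Basis(1,3)]
      mixed_partial_derivs_commute[OF smooth(4) U dirs_Basis(2,3)]
    by simp
qed

text \<open>The base coordinates exist only locally, as coordinates of local lifts, but they do not occur in the
  resulting equation, so the local equations fit together without a global lift.\<close>

lemma drift_poisson_of_local_system:
  fixes u F0 F1 F2 :: "real \<times> real \<times> real \<Rightarrow> real"
  assumes sys: "\<And>z. \<exists>U q1 q2 v. z \<in> U \<and> dirac_system U u q1 q2 v F0 F1 F2"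
  defines "f \<equiv> \<lambda>b. if b = dir_s then F0 else if b = dir_x then (\<lambda>z. - F1 z) else (\<lambda>z. - F2 z)"
  shows "drift_poisson dir_s u (\<lambda>b. partial_deriv b u) (\<lambda>b. partial_deriv b (partial_deriv b u)) f (\<lambda>b. partial_deriv b (f b))"
proof -
  have loc: "\<exists>U. open U \<and> z \<in> U \<and> smooth_on U u \<and> smooth_on U F0 \<and> smooth_on U F1 \<and> smooth_on U F2" for z
  proof -
    obtain U q1 q2 v where z: "z \<in> U" and sys: "dirac_system U u q1 q2 v F0 F1 F2" using assms(1) by blast
    have "open U" "smooth_on U u" using sys unfolding dirac_system_def by auto
    then show ?thesis using first_order_system_imp_poisson(1-3)[OF sys z] z by blast
  qed
  have S: "smooth_on UNIV u" "smooth_on UNIV F0" "smooth_on UNIV F1" "smooth_on UNIV F2"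
    by (rule smooth_on_UNIV_if_locally, use loc in blast)+
  have f: "smooth_on UNIV (f b)" for b
    unfolding f_def using S smooth_on_uminus[OF _ open_UNIV] by auto
  have fs: "f dir_s = F0" "f dir_x = (\<lambda>z. - F1 z)" "f dir_y = (\<lambda>z. - F2 z)" by (simp_all add: f_def)
  have eq: "(\<Sum>b\<in>Basis. partial_deriv b (partial_deriv b u) z) - partial_deriv dir_s u z =
      (\<Sum>b\<in>Basis. partial_deriv b (f b) z)" for z
  proof -
    obtain U q1 q2 v where z: "z \<in> U" and sys: "dirac_system U u q1 q2 v F0 F1 F2" using assms(1) by blast
    have d: "F1 differentiable (at z)" "F2 differentiable (at z)"
      using S smooth_on_differentiable by blast+
    show ?thesis
      using first_order_system_imp_poisson(4)[OF sys z] d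
      by (simp add: Basis_R3 fs partial_deriv_uminus)
  qed
  show ?thesis
    unfolding drift_poisson_def
    using smooth_on_UNIV_dir_deriv[OF S(1)] smooth_on_UNIV_dir_deriv[OF f]
      smooth_on_UNIV_dir_deriv[OF smooth_on_partial_deriv[OF S(1)]]
      smooth_on_UNIV_dir_deriv[OF smooth_on_partial_deriv[OF smooth_on_partial_deriv[OF S(1)]]]
      smooth_on_UNIV_dir_deriv[OF smooth_on_partial_deriv[OF f]]
    by (intro conjI ballI allI eq) auto
qed

text \<open>Two points with the same image differ by a translation that preserves all fibres of the projection.\<close>

lemma torus_proj_translate:
  assumes "torus_proj \<Lambda> x = torus_proj \<Lambda> x'"
  shows "torus_proj \<Lambda> (y + (x' - x)) = torus_proj \<Lambda> y"
proof -
  have eq: "v - x \<in> \<Lambda> \<longleftrightarrow> v - x' \<in> \<Lambda>" for v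
    using assms by (auto simp: torus_proj_def lattice_rel_def set_eq_iff)
  have "v - (y + (x' - x)) \<in> \<Lambda> \<longleftrightarrow> v - y \<in> \<Lambda>" for v
    using eq[of "v - y + x"] by (simp add: algebra_simps)
  then show ?thesis by (auto simp: torus_proj_def lattice_rel_def)
qed

lemma T2_proj_shift:
  "T2_proj (t + (2 * pi * of_int k, 2 * pi * of_int l)) = T2_proj t"
proof -
  have shift: "v - (2 * pi * of_int k, 2 * pi * of_int l) \<in> lattice_2pi \<longleftrightarrow> v \<in> lattice_2pi" for v and k l :: int
  proof
    assume "v \<in> lattice_2pi"
    then obtain k' l' :: int where "v = (2 * pi * of_int k', 2 * pi * of_int l')" by (auto simp: lattice_2pi_def)
    then have "v - (2 * pi * of_int k, 2 * pi * of_int l) = (2 * pi * of_int (k' - k), 2 * pi * of_int (l' - l))"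
      by (simp add: algebra_simps)
    then show "v - (2 * pi * of_int k, 2 * pi * of_int l) \<in> lattice_2pi" unfolding lattice_2pi_def by blast
  next
    assume "v - (2 * pi * of_int k, 2 * pi * of_int l) \<in> lattice_2pi"
    then obtain k' l' :: int where "v - (2 * pi * of_int k, 2 * pi * of_int l) = (2 * pi * of_int k', 2 * pi * of_int l')"
      by (auto simp: lattice_2pi_def)
    then have "v = (2 * pi * of_int (k' + k), 2 * pi * of_int (l' + l))"
      by (cases v) (simp add: algebra_simps)
    then show "v \<in> lattice_2pi" unfolding lattice_2pi_def by blast
  qed
  show ?thesis
    using shift[of "_ - t" k l] by (auto simp: torus_proj_def lattice_rel_def diff_diff_add)
qed

lemma T2_proj_periodic:
  assumes "b \<in> Basis"
  shows "T2_proj (t + (2 * pi) *\<^sub>R b) = T2_proj t"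
proof -
  have "b = (1, 0) \<or> b = (0, 1)" using assms by (auto simp: Basis_prod_def)
  then show ?thesis using T2_proj_shift[of t 1 0] T2_proj_shift[of t 0 1] by auto
qed

lemma partial_deriv_translate:
  fixes f :: "'a::euclidean_space \<Rightarrow> 'b::real_normed_vector"
  assumes "\<And>y. f (y + d) = f y" "f differentiable (at x)"
  shows "partial_deriv b f (x + d) = partial_deriv b f x"
proof -
  have D: "(f has_derivative frechet_derivative f (at x)) (at x)"
    using assms(2) by (simp add: frechet_derivative_works)
  have "((\<lambda>y. y - d) has_derivative (\<lambda>h. h)) (at (x + d))"
    by (auto intro!: derivative_eq_intros)
  moreover have "(f has_derivative frechet_derivative f (at x)) (at (x + d - d))" using D by simp
  ultimately have "((\<lambda>y. f (y - d)) has_derivative frechet_derivative f (at x)) (at (x + d))"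
    by (rule has_derivative_compose)
  moreover have "f (y - d) = f y" for y using assms(1)[of "y - d"] by simp
  ultimately have "(f has_derivative frechet_derivative f (at x)) (at (x + d))" by simp
  from partial_deriv_eqI[OF this] show ?thesis by (simp add: partial_deriv_def)
qed

text \<open>The pullback is invariant under the translation from \<open>(t, v)\<close> to \<open>(t', v')\<close>, and so are its derivatives.
  Hence the gradient of \<open>h\<close> along a solution does not depend on the choice of a lift.\<close>

lemma pullback_deriv_well_defined:
  assumes "smooth_perturbation \<Lambda> h" "T2_proj t = T2_proj t'" "cot_proj \<Lambda> v = cot_proj \<Lambda> v'"
  shows "partial_deriv a (pullback \<Lambda> h) (t, v) = partial_deriv a (pullback \<Lambda> h) (t', v')"
proof -
  have p: "torus_proj \<Lambda> (fst v) = torus_proj \<Lambda> (fst v')" "snd v = snd v'"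
    using assms(3) by (auto simp: cot_proj_def)
  have "cot_proj \<Lambda> (y + (v' - v)) = cot_proj \<Lambda> y" for y
    using torus_proj_translate[OF p(1)] p(2) by (simp add: cot_proj_def)
  moreover have "T2_proj (y + (t' - t)) = T2_proj y" for y
    by (rule torus_proj_translate[OF assms(2)])
  ultimately have "pullback \<Lambda> h (y + ((t', v') - (t, v))) = pullback \<Lambda> h y" for y
    by (cases y) (simp add: pullback_def)
  moreover have "pullback \<Lambda> h differentiable (at (t, v))"
    using assms(1) smooth_on_differentiable unfolding smooth_perturbation_def by blast
  ultimately have "partial_deriv a (pullback \<Lambda> h) ((t, v) + ((t', v') - (t, v))) = partial_deriv a (pullback \<Lambda> h) (t, v)"
    by (rule partial_deriv_translate)
  then show ?thesis by simp
qed

lemma partial_deriv_le_C1_norm: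
  fixes f :: "'a::euclidean_space \<Rightarrow> real"
  assumes "Ck_norm 1 f \<le> ennreal \<epsilon>" "0 \<le> \<epsilon>" "b \<in> Basis"
  shows "\<bar>partial_deriv b f x\<bar> \<le> \<epsilon>"
proof -
  have "ennreal \<bar>foldr partial_deriv [b] f x\<bar> \<le> (SUP x. ennreal \<bar>foldr partial_deriv [b] f x\<bar>)"
    by (rule SUP_upper) simp
  also have "\<dots> \<le> Ck_norm 1 f"
    unfolding Ck_norm_def using assms(3)
    by (intro SUP_upper2[of "[b]"]) auto
  finally have "ennreal \<bar>partial_deriv b f x\<bar> \<le> ennreal \<epsilon>" using assms(1) by simp
  then show ?thesis using assms(2) by simp
qed

lemma hamiltonian_gradient_component:
  assumes "smooth_perturbation \<Lambda> h"
    and "GDERIV (\<lambda>z. hamiltonian \<beta> h s (T2_proj t) (cot_proj \<Lambda> z)) v :> D"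
  shows "D \<bullet> a = snd v \<bullet> snd a + \<beta> s * partial_deriv (0, a) (pullback \<Lambda> h) (t, v)"
proof -
  let ?P = "frechet_derivative (pullback \<Lambda> h) (at (t, v))"
  have "pullback \<Lambda> h differentiable (at (t, v))"
    using assms(1) smooth_on_differentiable unfolding smooth_perturbation_def by blast
  then have P: "(pullback \<Lambda> h has_derivative ?P) (at (t, v))"
    by (simp add: frechet_derivative_works)
  have "((\<lambda>z. (t, z)) has_derivative (\<lambda>k. (0, k))) (at v)"
    by (auto intro!: derivative_eq_intros)
  from has_derivative_compose[OF this P]
  have "((\<lambda>z. 1/2 * (snd z \<bullet> snd z) + \<beta> s * pullback \<Lambda> h (t, z)) has_derivative
      (\<lambda>k. 1/2 * (snd v \<bullet> snd k + snd k \<bullet> snd v) + \<beta> s * ?P (0, k))) (at v)"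
    by (auto intro!: derivative_eq_intros)
  moreover have "(\<lambda>z. hamiltonian \<beta> h s (T2_proj t) (cot_proj \<Lambda> z)) =
      (\<lambda>z. 1/2 * (snd z \<bullet> snd z) + \<beta> s * pullback \<Lambda> h (t, z))"
    by (auto simp: hamiltonian_def pullback_def cot_proj_def power2_norm_eq_inner)
  ultimately have 1: "((\<lambda>z. hamiltonian \<beta> h s (T2_proj t) (cot_proj \<Lambda> z)) has_derivative
      (\<lambda>k. 1/2 * (snd v \<bullet> snd k + snd k \<bullet> snd v) + \<beta> s * ?P (0, k))) (at v)" by simp
  have 2: "((\<lambda>z. hamiltonian \<beta> h s (T2_proj t) (cot_proj \<Lambda> z)) has_derivative (\<lambda>k. k \<bullet> D)) (at v)"
    using assms(2) by (simp add: gderiv_def)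
  have "a \<bullet> D = 1/2 * (snd v \<bullet> snd a + snd a \<bullet> snd v) + \<beta> s * ?P (0, a)"
    using fun_cong[OF has_derivative_unique[OF 2 1], of a] .
  then show ?thesis by (simp add: partial_deriv_def inner_commute)
qed

section \<open>Solutions of the perturbed equation\<close>

lemma partial_deriv_minus_direction:
  assumes "f differentiable (at x)"
  shows "partial_deriv (- b) f x = - partial_deriv b f x"
  unfolding partial_deriv_def
  using linear_neg[OF has_derivative_linear[OF assms[unfolded frechet_derivative_works]]] .

text \<open>The component of \<open>\<beta> \<nabla>h\<close> along the solution in the direction \<open>a\<close>. Any point over \<open>Z\<close> may be used to
  evaluate the derivative of the pullback.\<close>

definition gradient_term ::
  "'n::finite base set \<Rightarrow> (real \<Rightarrow> real) \<Rightarrow> ((real \<times> real) set \<Rightarrow> 'n cot \<Rightarrow> real) \<Rightarrow>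
    (real \<Rightarrow> (real \<times> real) set \<Rightarrow> 'n cot) \<Rightarrow> 'n cover \<Rightarrow> real \<times> real \<times> real \<Rightarrow> real"
  where "gradient_term \<Lambda> \<beta> h Z a z = \<beta> (fst z) *
    partial_deriv (0, a) (pullback \<Lambda> h) (snd z, SOME v. cot_proj \<Lambda> v = Z (fst z) (T2_proj (snd z)))"

definition momentum :: "(real \<Rightarrow> (real \<times> real) set \<Rightarrow> 'n::finite cot) \<Rightarrow> real \<times> real \<times> real \<Rightarrow> 'n base"
  where "momentum Z z = snd (Z (fst z) (T2_proj (snd z)))"

text \<open>The coordinate functionals \<open>x \<mapsto> x \<bullet> A\<close> etc. are permuted up to sign by \<open>J\<close> and \<open>K\<close>. Here \<open>A\<close> and \<open>A'\<close>
  are the directions of \<open>u\<close> and \<open>v\<close> in a \<open>dirac_system\<close>, and \<open>B1\<close>, \<open>B2\<close> those of \<open>q1\<close>, \<open>q2\<close>. The signs in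
  the second frame below reduce the second fibre coordinate to the same system as the first.\<close>

definition momentum_frame :: "'n::finite cover \<Rightarrow> 'n cover \<Rightarrow> 'n cover \<Rightarrow> 'n cover \<Rightarrow> bool"
  where "momentum_frame A B1 B2 A' \<longleftrightarrow> fst A = 0 \<and> snd B1 = 0 \<and> snd B2 = 0 \<and>
    (\<forall>x. hk_J x \<bullet> A = x \<bullet> B1 \<and> hk_K x \<bullet> A = x \<bullet> B2 \<and>
      hk_J x \<bullet> B1 = - (x \<bullet> A) \<and> hk_K x \<bullet> B1 = x \<bullet> A' \<and>
      hk_J x \<bullet> B2 = - (x \<bullet> A') \<and> hk_K x \<bullet> B2 = - (x \<bullet> A))"

lemma momentum_frames:
  "momentum_frame (0, (e, 0)) ((e, 0), 0) ((0, e), 0) (0, (0, e))"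
  "momentum_frame (0, (0, e)) ((0, e), 0) (- ((e, 0), 0)) (- (0, (e, 0)))"
proof -
  have eq: "hk_J x = ((- fst (snd x), - snd (snd x)), fst x)"
    "hk_K x = ((snd (snd x), - fst (snd x)), (snd (fst x), - fst (fst x)))" for x :: "'a cover"
    by (cases x rule: hk_J.cases; simp add: hk_K_apply)+
  show "momentum_frame (0, (e, 0)) ((e, 0), 0) ((0, e), 0) (0, (0, e))"
    "momentum_frame (0, (0, e)) ((0, e), 0) (- ((e, 0), 0)) (- (0, (e, 0)))"
    by (auto simp: momentum_frame_def eq inner_prod_def)
qed

lemma gradient_term_local_lift:
  assumes "smooth_perturbation \<Lambda> h" "local_lift \<Lambda> Z U w" "z \<in> U"
  shows "gradient_term \<Lambda> \<beta> h Z a z = \<beta> (fst z) * partial_deriv (0, a) (pullback \<Lambda> h) (snd z, w z)"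
proof -
  have w: "cot_proj \<Lambda> (w z) = Z (fst z) (T2_proj (snd z))"
    using assms(2,3) unfolding local_lift_def by (cases z) fastforce
  have "cot_proj \<Lambda> (SOME v. cot_proj \<Lambda> v = Z (fst z) (T2_proj (snd z))) = cot_proj \<Lambda> (w z)"
    unfolding w by (rule someI[of _ "w z"]) (rule w)
  then show ?thesis
    unfolding gradient_term_def using pullback_deriv_well_defined[OF assms(1) refl] by metis
qed

text \<open>Pairing the equation with the three vectors \<open>A\<close>, \<open>B1\<close>, \<open>B2\<close>. The gradient of \<open>|p|\<^sup>2 / 2\<close> contributes only to
  the first, since \<open>B1\<close> and \<open>B2\<close> are base directions.\<close>

lemma dirac_system_of_solution:
  assumes h: "smooth_perturbation \<Lambda> h" and sol: "solves_equation \<Lambda> (hamiltonian \<beta> h) Z"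
    and lift: "local_lift \<Lambda> Z U w" and frame: "momentum_frame A B1 B2 A'"
  shows "dirac_system U (\<lambda>z. momentum Z z \<bullet> snd A) (\<lambda>z. w z \<bullet> B1) (\<lambda>z. w z \<bullet> B2) (\<lambda>z. w z \<bullet> A')
    (gradient_term \<Lambda> \<beta> h Z A) (gradient_term \<Lambda> \<beta> h Z B1) (gradient_term \<Lambda> \<beta> h Z B2)"
proof -
  have U: "open U" and w: "smooth_on U w" using lift by (auto simp: local_lift_def)
  have wz: "momentum Z z = snd (w z)" if "z \<in> U" for z
    using lift that unfolding local_lift_def by (cases z) (fastforce simp: momentum_def cot_proj_def)
  have A: "momentum Z z \<bullet> snd A = w z \<bullet> A" if "z \<in> U" for z
    using wz[OF that] frame by (cases A; cases "w z") (auto simp: momentum_frame_def inner_prod_def)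
  note lin = bounded_linear_inner_left
  have pd: "partial_deriv b (\<lambda>z. w z \<bullet> a) z = partial_deriv b w z \<bullet> a" if "z \<in> U" "b \<in> Basis" for a b z
    using smooth_on_linear_foldr[OF w U lin, of _ a "[b]" z] that by simp
  have pdA: "partial_deriv b (\<lambda>z. momentum Z z \<bullet> snd A) z = partial_deriv b w z \<bullet> A" if "z \<in> U" "b \<in> Basis" for b z
    using smooth_on_linear_foldr[OF w U lin A, of "[b]" z] that by simp
  have eq: "partial_deriv dir_s w z \<bullet> a + hk_J (partial_deriv dir_x w z) \<bullet> a + hk_K (partial_deriv dir_y w z) \<bullet> a
      = snd (w z) \<bullet> snd a + gradient_term \<Lambda> \<beta> h Z a z" if "z \<in> U" for z a
  proof -
    obtain s t where z: "z = (s, t)" by (cases z)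
    have "GDERIV (\<lambda>v. hamiltonian \<beta> h s (T2_proj t) (cot_proj \<Lambda> v)) (w (s, t)) :>
        partial_deriv dir_s w (s, t) + hk_J (partial_deriv dir_x w (s, t)) + hk_K (partial_deriv dir_y w (s, t))"
      using sol lift that unfolding solves_equation_def z by fast
    from hamiltonian_gradient_component[OF h this, of a] gradient_term_local_lift[OF h lift that]
    show ?thesis by (simp add: z inner_add_left)
  qed
  have sm: "smooth_on U (\<lambda>z. w z \<bullet> a)" for a by (rule smooth_on_linear[OF w U lin]) simp
  have smA: "smooth_on U (\<lambda>z. momentum Z z \<bullet> snd A)" by (rule smooth_on_cong[OF sm U A])
  show ?thesis
    unfolding dirac_system_def
  proof (intro conjI ballI U sm smA)
    fix z assume z: "z \<in> U"
    have fr: "snd B1 = 0" "snd B2 = 0" "\<And>x. hk_J x \<bullet> A = x \<bullet> B1" "\<And>x. hk_K x \<bullet> A = x \<bullet> B2"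
      "\<And>x. hk_J x \<bullet> B1 = - (x \<bullet> A)" "\<And>x. hk_K x \<bullet> B1 = x \<bullet> A'"
      "\<And>x. hk_J x \<bullet> B2 = - (x \<bullet> A')" "\<And>x. hk_K x \<bullet> B2 = - (x \<bullet> A)"
      using frame unfolding momentum_frame_def by blast+
    show "gradient_term \<Lambda> \<beta> h Z A z = partial_deriv dir_s (\<lambda>z. momentum Z z \<bullet> snd A) z
        + partial_deriv dir_x (\<lambda>z. w z \<bullet> B1) z + partial_deriv dir_y (\<lambda>z. w z \<bullet> B2) z - momentum Z z \<bullet> snd A"
      using eq[OF z, of A] wz[OF z] unfolding pd[OF z dirs_Basis(2)] pd[OF z dirs_Basis(3)] pdA[OF z dirs_Basis(1)] fr
      by simp
    show "gradient_term \<Lambda> \<beta> h Z B1 z = partial_deriv dir_s (\<lambda>z. w z \<bullet> B1) z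
        - partial_deriv dir_x (\<lambda>z. momentum Z z \<bullet> snd A) z + partial_deriv dir_y (\<lambda>z. w z \<bullet> A') z"
      using eq[OF z, of B1] unfolding pd[OF z dirs_Basis(1)] pd[OF z dirs_Basis(3)] pdA[OF z dirs_Basis(2)] fr
      by simp
    show "gradient_term \<Lambda> \<beta> h Z B2 z = partial_deriv dir_s (\<lambda>z. w z \<bullet> B2) z
        - partial_deriv dir_x (\<lambda>z. w z \<bullet> A') z - partial_deriv dir_y (\<lambda>z. momentum Z z \<bullet> snd A) z"
      using eq[OF z, of B2] unfolding pd[OF z dirs_Basis(1)] pd[OF z dirs_Basis(2)] pdA[OF z dirs_Basis(3)] fr
      by simp
  qed
qed

text \<open>Up to periods, the complement of the region of decay is compact.\<close>

lemma bounded_if_periodic_and_decaying: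
  fixes u :: "real \<times> real \<times> real \<Rightarrow> real"
  assumes cont: "continuous_on UNIV u"
    and per: "\<And>s t t'. T2_proj t = T2_proj t' \<Longrightarrow> u (s, t) = u (s, t')"
    and decay: "\<And>s t. R \<le> \<bar>s\<bar> \<Longrightarrow> \<bar>u (s, t)\<bar> \<le> 1"
  shows "\<exists>M. \<forall>z. \<bar>u z\<bar> \<le> M"
proof -
  let ?K = "cbox (- \<bar>R\<bar>, 0, 0) (\<bar>R\<bar>, 2 * pi, 2 * pi) :: (real \<times> real \<times> real) set"
  have "compact (u ` ?K)"
    by (intro compact_continuous_image continuous_on_subset[OF cont] compact_cbox) auto
  then obtain M where M: "\<And>z. z \<in> ?K \<Longrightarrow> \<bar>u z\<bar> \<le> M"
    using compact_imp_bounded[of "u ` ?K"] unfolding bounded_iff by auto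
  have "\<bar>u z\<bar> \<le> max M 1" for z
  proof -
    obtain s x y where z: "z = (s, x, y)" by (cases z)
    define k l where "k = \<lfloor>x / (2 * pi)\<rfloor>" and "l = \<lfloor>y / (2 * pi)\<rfloor>"
    define x' y' where "x' = x - 2 * pi * of_int k" and "y' = y - 2 * pi * of_int l"
    have "T2_proj (x', y') = T2_proj (x, y)"
      using T2_proj_shift[of "(x', y')" k l] by (simp add: x'_def y'_def)
    then have eq: "u z = u (s, x', y')" unfolding z by (intro per) simp
    have r: "of_int k * (2 * pi) \<le> x" "x \<le> (of_int k + 1) * (2 * pi)"
      "of_int l * (2 * pi) \<le> y" "y \<le> (of_int l + 1) * (2 * pi)"
      using floor_divide_lower[of "2 * pi" x] floor_divide_upper[of "2 * pi" x]
        floor_divide_lower[of "2 * pi" y] floor_divide_upper[of "2 * pi" y]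
      by (auto simp: k_def l_def)
    show ?thesis
    proof (cases "R \<le> \<bar>s\<bar>")
      case True
      then show ?thesis using decay[OF True, of "(x, y)"] by (simp add: z)
    next
      case False
      then have "(s, x', y') \<in> ?K" using r by (auto simp: x'_def y'_def algebra_simps)
      then show ?thesis using M unfolding eq by fastforce
    qed
  qed
  then show ?thesis by blast
qed

lemma fibre_decay_momentum:
  assumes "fibre_decay Z" "0 < \<kappa>"
  shows "\<exists>R. \<forall>s t. R \<le> \<bar>s\<bar> \<longrightarrow> norm (momentum Z (s, t)) \<le> \<kappa>"
proof -
  have T: "T2_proj t \<in> T2" for t by (auto simp: torus_def torus_proj_def intro: quotientI)
  have "\<forall>\<^sub>F s in at_top. \<forall>t\<in>T2. dist (norm (snd (Z s t))) 0 < \<kappa>"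
    "\<forall>\<^sub>F s in at_bot. \<forall>t\<in>T2. dist (norm (snd (Z s t))) 0 < \<kappa>"
    using assms unfolding fibre_decay_def uniform_limit_iff by blast+
  then obtain R1 R2 where R: "\<forall>s\<ge>R1. \<forall>t\<in>T2. dist (norm (snd (Z s t))) 0 < \<kappa>"
    "\<forall>s\<le>R2. \<forall>t\<in>T2. dist (norm (snd (Z s t))) 0 < \<kappa>"
    unfolding eventually_at_top_linorder eventually_at_bot_linorder by blast
  have "norm (momentum Z (s, t)) \<le> \<kappa>" if "max \<bar>R1\<bar> \<bar>R2\<bar> \<le> \<bar>s\<bar>" for s t
  proof -
    have "R1 \<le> s \<or> s \<le> R2" using that by linarith
    then have "dist (norm (snd (Z s (T2_proj t)))) 0 < \<kappa>" using R T by blast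
    then show ?thesis by (simp add: momentum_def)
  qed
  then show ?thesis by blast
qed

lemma gradient_term_bound:
  assumes h: "smooth_perturbation \<Lambda> h" "Ck_norm 1 (pullback \<Lambda> h) \<le> ennreal \<epsilon>" "0 \<le> \<epsilon>"
    and \<beta>: "0 \<le> \<beta> (fst z)" "\<beta> (fst z) \<le> 1" and a: "a \<in> Basis \<or> - a \<in> Basis"
  shows "\<bar>gradient_term \<Lambda> \<beta> h Z a z\<bar> \<le> \<epsilon>"
proof -
  define x where "x = (snd z, SOME v. cot_proj \<Lambda> v = Z (fst z) (T2_proj (snd z)))"
  have d: "pullback \<Lambda> h differentiable (at x)"
    using h(1) smooth_on_differentiable unfolding smooth_perturbation_def by blast
  have "\<bar>partial_deriv (0, a) (pullback \<Lambda> h) x\<bar> \<le> \<epsilon>"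
    using a
  proof
    assume "a \<in> Basis"
    then show ?thesis by (intro partial_deriv_le_C1_norm h) (simp add: Basis_prod_def)
  next
    assume "- a \<in> Basis"
    then have "\<bar>partial_deriv (- (0, a)) (pullback \<Lambda> h) x\<bar> \<le> \<epsilon>"
      by (intro partial_deriv_le_C1_norm h) (simp add: Basis_prod_def)
    then show ?thesis unfolding partial_deriv_minus_direction[OF d] by simp
  qed
  then have "\<bar>\<beta> (fst z)\<bar> * \<bar>partial_deriv (0, a) (pullback \<Lambda> h) x\<bar> \<le> 1 * \<epsilon>"
    using \<beta> by (intro mult_mono) auto
  then show ?thesis by (simp add: gradient_term_def x_def abs_mult)
qed

lemma gradient_term_periodic:
  assumes "smooth_perturbation \<Lambda> h"
  shows "torus_periodic (gradient_term \<Lambda> \<beta> h Z a)"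
  unfolding torus_periodic_def
proof (intro ballI allI)
  fix b :: "real \<times> real" and z :: "real \<times> real \<times> real" assume b: "b \<in> Basis"
  have "T2_proj (snd z + (2 * pi) *\<^sub>R b) = T2_proj (snd z)" by (rule T2_proj_periodic[OF b])
  then show "gradient_term \<Lambda> \<beta> h Z a (z + (0, (2 * pi) *\<^sub>R b)) = gradient_term \<Lambda> \<beta> h Z a z"
    using pullback_deriv_well_defined[OF assms, of "snd z + (2 * pi) *\<^sub>R b" "snd z"]
    by (simp add: gradient_term_def)
qed

lemma momentum_component_bound:
  obtains C :: real where "0 \<le> C"
    "\<And>(\<Lambda> :: 'n::finite base set) h \<beta> Z \<epsilon> S A B1 B2 A' z.
      \<lbrakk>smooth_perturbation \<Lambda> h; Ck_norm 1 (pullback \<Lambda> h) \<le> ennreal \<epsilon>; 0 \<le> \<epsilon>;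
       \<And>s. 0 \<le> \<beta> s \<and> \<beta> s \<le> 1; \<And>s. S \<le> s \<Longrightarrow> \<beta> s = 0;
       smooth_map \<Lambda> Z; solves_equation \<Lambda> (hamiltonian \<beta> h) Z; fibre_decay Z;
       momentum_frame A B1 B2 A'; A \<in> Basis; B1 \<in> Basis; B2 \<in> Basis \<or> - B2 \<in> Basis\<rbrakk>
      \<Longrightarrow> \<bar>momentum Z z \<bullet> snd A\<bar> \<le> C * \<epsilon>"
proof -
  obtain C :: real where C: "0 \<le> C" and bound:
    "\<And>u du ddu f df \<epsilon> M S z. \<lbrakk>drift_poisson (1, 0, 0) u du ddu f df; torus_periodic u;
       \<And>b. b \<in> Basis \<Longrightarrow> torus_periodic (f b); \<And>b z. b \<in> Basis \<Longrightarrow> \<bar>f b z\<bar> \<le> \<epsilon>; \<And>z. \<bar>u z\<bar> \<le> M;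
       \<And>s z. S \<le> s \<Longrightarrow> f (1, 0, 0) (s, z) = 0;
       \<And>\<kappa>. 0 < \<kappa> \<Longrightarrow> \<exists>R. \<forall>s\<ge>R. \<forall>z. \<bar>u (s, z)\<bar> \<le> \<kappa>\<rbrakk> \<Longrightarrow> \<bar>u z\<bar> \<le> C * \<epsilon>"
    using drift_poisson_sup_bound by blast
  show ?thesis
  proof (rule that[OF C])
    fix \<Lambda> :: "'n base set" and h \<beta> and Z :: "real \<Rightarrow> (real \<times> real) set \<Rightarrow> 'n cot" and \<epsilon> S
      and A B1 B2 A' :: "'n cover" and z
    assume h: "smooth_perturbation \<Lambda> h" "Ck_norm 1 (pullback \<Lambda> h) \<le> ennreal \<epsilon>" "0 \<le> \<epsilon>"
      and \<beta>: "\<And>s. 0 \<le> \<beta> s \<and> \<beta> s \<le> 1" "\<And>s. S \<le> s \<Longrightarrow> \<beta> s = 0"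
      and Z: "smooth_map \<Lambda> Z" "solves_equation \<Lambda> (hamiltonian \<beta> h) Z" "fibre_decay Z"
      and frame: "momentum_frame A B1 B2 A'" and basis: "A \<in> Basis" "B1 \<in> Basis" "B2 \<in> Basis \<or> - B2 \<in> Basis"
    let ?g = "gradient_term \<Lambda> \<beta> h Z"
    let ?u = "\<lambda>z. momentum Z z \<bullet> snd A"
    define f where "f = (\<lambda>b. if b = dir_s then ?g A else if b = dir_x then (\<lambda>z. - ?g B1 z) else (\<lambda>z. - ?g B2 z))"
    have sol: "drift_poisson dir_s ?u (\<lambda>b. partial_deriv b ?u) (\<lambda>b. partial_deriv b (partial_deriv b ?u))
        f (\<lambda>b. partial_deriv b (f b))"
      unfolding f_def
    proof (rule drift_poisson_of_local_system)
      fix z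
      obtain U w where "z \<in> U" "local_lift \<Lambda> Z U w" using Z(1) unfolding smooth_map_def by blast
      then show "\<exists>U q1 q2 v. z \<in> U \<and> dirac_system U ?u q1 q2 v (?g A) (?g B1) (?g B2)"
        using dirac_system_of_solution[OF h(1) Z(2) _ frame] by blast
    qed
    have "snd A \<in> Basis" using frame basis(1) unfolding momentum_frame_def by (auto simp: Basis_prod_def)
    then have le: "\<bar>?u z\<bar> \<le> norm (momentum Z z)" for z by (rule Basis_le_norm)
    have decay: "\<exists>R. \<forall>s t. R \<le> \<bar>s\<bar> \<longrightarrow> \<bar>?u (s, t)\<bar> \<le> \<kappa>" if "0 < \<kappa>" for \<kappa>
      using fibre_decay_momentum[OF Z(3) that] le order_trans by meson
    obtain R where R: "\<And>s t. R \<le> \<bar>s\<bar> \<Longrightarrow> \<bar>?u (s, t)\<bar> \<le> 1" using decay[of 1] by auto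
    have cont: "continuous_on UNIV ?u" using sol unfolding drift_poisson_def by blast
    have "\<exists>M. \<forall>z. \<bar>?u z\<bar> \<le> M"
    proof (rule bounded_if_periodic_and_decaying[OF cont _ R])
      show "?u (s, t) = ?u (s, t')" if "T2_proj t = T2_proj t'" for s t t'
        using that by (simp add: momentum_def)
    qed
    then obtain M where M: "\<And>z. \<bar>?u z\<bar> \<le> M" by blast
    show "\<bar>?u z\<bar> \<le> C * \<epsilon>"
    proof (rule bound[OF sol _ _ _ M, where S = S])
      show "torus_periodic ?u" using T2_proj_periodic by (simp add: torus_periodic_def momentum_def)
      show "torus_periodic (f b)" for b
        using gradient_term_periodic[OF h(1), of \<beta>] by (auto simp: f_def torus_periodic_def)
      show "\<bar>f b z\<bar> \<le> \<epsilon>" for b z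
        using gradient_term_bound[OF h, of \<beta>] \<beta>(1) basis by (auto simp: f_def)
      show "f dir_s (s, z) = 0" if "S \<le> s" for s z
        using \<beta>(2)[OF that] by (simp add: f_def gradient_term_def)
      show "\<exists>R. \<forall>s\<ge>R. \<forall>z. \<bar>?u (s, z)\<bar> \<le> \<kappa>" if \<kappa>: "0 < \<kappa>" for \<kappa>
      proof -
        obtain R where "\<And>s t. R \<le> \<bar>s\<bar> \<Longrightarrow> \<bar>?u (s, t)\<bar> \<le> \<kappa>" using decay[OF \<kappa>] by blast
        then show ?thesis by (intro exI[of _ R]) (use abs_ge_self order_trans in blast)
      qed
    qed
  qed
qed

theorem theorem7p1:
  fixes \<Lambda> :: "((real^'n) \<times> (real^'n)) set" and \<delta> :: real
  assumes "full_lattice \<Lambda>" and "0 < \<delta>"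
  shows "\<exists>\<nu> :: ennreal \<Rightarrow> real.
    (\<forall>C<\<infinity>. 0 < \<nu> C) \<and>
    (\<forall>h \<beta> \<tau> Z.
       smooth_perturbation \<Lambda> h \<and> perturbation_norm \<Lambda> 2 h < \<infinity> \<and>
       cutoff_family \<beta> \<and> 0 \<le> \<tau> \<and>
       perturbation_norm \<Lambda> 1 h < ennreal (\<nu> (perturbation_norm \<Lambda> 2 h)) \<and>
       smooth_map \<Lambda> Z \<and>
       solves_equation \<Lambda> (hamiltonian (\<beta> \<tau>) h) Z \<and>
       fibre_decay Z \<longrightarrow>
         (\<forall>s. \<forall>t\<in>T2. Z s t \<in> disc_cot \<Lambda> \<delta>))"
proof -
  obtain C :: real where C: "0 \<le> C" and bound:
    "\<And>(\<Lambda> :: 'n base set) h \<beta> Z \<epsilon> S A B1 B2 A' z.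
      \<lbrakk>smooth_perturbation \<Lambda> h; Ck_norm 1 (pullback \<Lambda> h) \<le> ennreal \<epsilon>; 0 \<le> \<epsilon>;
       \<And>s. 0 \<le> \<beta> s \<and> \<beta> s \<le> 1; \<And>s. S \<le> s \<Longrightarrow> \<beta> s = 0;
       smooth_map \<Lambda> Z; solves_equation \<Lambda> (hamiltonian \<beta> h) Z; fibre_decay Z;
       momentum_frame A B1 B2 A'; A \<in> Basis; B1 \<in> Basis; B2 \<in> Basis \<or> - B2 \<in> Basis\<rbrakk>
      \<Longrightarrow> \<bar>momentum Z z \<bullet> snd A\<bar> \<le> C * \<epsilon>"
    using momentum_component_bound by blast
  define N where "N = 2 * real CARD('n)"
  have N: "0 < N" by (simp add: N_def)
  \<comment> \<open>Each of the \<open>N\<close> fibre coordinates is bounded by \<open>C \<epsilon>\<close>; \<open>C + 1\<close> excludes the denominator \<open>0\<close>.\<close>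
  define \<nu> where "\<nu> = \<delta> / (N * (C + 1))"
  have \<nu>: "0 < \<nu>" using assms(2) N C by (simp add: \<nu>_def)
  have main: "Z s t \<in> disc_cot \<Lambda> \<delta>"
    if h: "smooth_perturbation \<Lambda> h" and \<beta>: "cutoff_family \<beta>" "0 \<le> \<tau>"
      and small: "perturbation_norm \<Lambda> 1 h < ennreal \<nu>"
      and Z: "smooth_map \<Lambda> Z" "solves_equation \<Lambda> (hamiltonian (\<beta> \<tau>) h) Z" "fibre_decay Z"
      and t: "t \<in> T2" for h \<beta> \<tau> Z s t
  proof -
    obtain y where y: "t = T2_proj y" using t by (auto simp: torus_def torus_proj_def elim: quotientE)
    define \<epsilon> where "\<epsilon> = enn2real (perturbation_norm \<Lambda> 1 h)"
    have fin: "perturbation_norm \<Lambda> 1 h \<noteq> \<infinity>" using small by auto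
    have \<epsilon>: "0 \<le> \<epsilon>" "Ck_norm 1 (pullback \<Lambda> h) \<le> ennreal \<epsilon>"
      using fin by (auto simp: \<epsilon>_def perturbation_norm_def[symmetric] less_top)
    have \<epsilon>\<nu>: "\<epsilon> < \<nu>"
      using small fin \<nu> by (simp add: \<epsilon>_def enn2real_less_iff less_top)
    have \<beta>1: "\<And>s. 0 \<le> \<beta> \<tau> s \<and> \<beta> \<tau> s \<le> 1" and \<beta>0: "\<And>s. \<tau> + 1 \<le> s \<Longrightarrow> \<beta> \<tau> s = 0"
      using \<beta> unfolding cutoff_family_def by blast+
    have b: "\<bar>momentum Z z \<bullet> snd A\<bar> \<le> C * \<epsilon>"
      if "momentum_frame A B1 B2 A'" "A \<in> Basis" "B1 \<in> Basis" "B2 \<in> Basis \<or> - B2 \<in> Basis"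
      for A B1 B2 A' :: "'n cover" and z
      by (rule bound[where S = "\<tau> + 1", OF h \<epsilon>(2,1) \<beta>1 _ Z that]) (rule \<beta>0)
    have e: "axis j 1 \<in> (Basis :: (real^'n) set)" for j :: 'n by (simp add: axis_in_Basis_iff)
    define p where "p = momentum Z (s, y)"
    have comp: "\<bar>fst p $ j\<bar> \<le> C * \<epsilon>" "\<bar>snd p $ j\<bar> \<le> C * \<epsilon>" for j
      using b[OF momentum_frames(1)[of "axis j 1"], of "(s, y)"] b[OF momentum_frames(2)[of "axis j 1"], of "(s, y)"] e[of j]
      by (auto simp: p_def[symmetric] inner_prod_def inner_axis Basis_prod_def)
    have "norm p \<le> norm (fst p) + norm (snd p)" using norm_Pair_le[of "fst p" "snd p"] by simp
    also have "\<dots> \<le> (\<Sum>j\<in>UNIV. \<bar>fst p $ j\<bar>) + (\<Sum>j\<in>UNIV. \<bar>snd p $ j\<bar>)"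
      by (intro add_mono norm_le_l1_cart)
    also have "\<dots> \<le> (\<Sum>j\<in>(UNIV::'n set). C * \<epsilon>) + (\<Sum>j\<in>(UNIV::'n set). C * \<epsilon>)"
      by (intro add_mono sum_mono comp)
    also have "\<dots> = N * C * \<epsilon>" by (simp add: N_def)
    also have "\<dots> \<le> N * (C + 1) * \<epsilon>" using N \<epsilon>(1) by (intro mult_right_mono mult_left_mono) auto
    also have "\<dots> < N * (C + 1) * \<nu>" using \<epsilon>\<nu> N C by (intro mult_strict_left_mono) auto
    also have "\<dots> = \<delta>" using N C by (simp add: \<nu>_def)
    finally have "norm (snd (Z s t)) < \<delta>" by (simp add: p_def momentum_def y)
    moreover have "fst (Z s t) \<in> torus \<Lambda>"
    proof -
      obtain U w where Uw: "(s, y) \<in> U" "local_lift \<Lambda> Z U w" using Z(1) unfolding smooth_map_def by blast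
      then have "Z s t = cot_proj \<Lambda> (w (s, y))" unfolding local_lift_def y by fast
      then show ?thesis by (simp add: cot_proj_def torus_def torus_proj_def quotientI)
    qed
    ultimately show ?thesis by (cases "Z s t") (auto simp: disc_cot_def)
  qed
  show ?thesis
    by (rule exI[of _ "\<lambda>_. \<nu>"]) (use \<nu> main in blast)
qed

end
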